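(* Let $A$ be one of the six matrices listed in the context, let $\{h_{\vec n}\}_{\vec n\in\mathbb{Z}^2}$ be a finitely supported complex solution of Lawton's equations for $A$, let $\varphi$ be the associated scaling function, and let $$\psi=\sum_{\vec n\in\mathbb{Z}^2}(-1)^{\sigma_A(\vec n)}\,\overline{h_{\vec\ell_A-\vec n}}\;D_AT_{\vec n}\varphi .$$ Then $\{D_A^nT_{\vec\ell}\,\psi:\ n\in\mathbb{Z},\ \vec\ell\in\mathbb{Z}^2\}$ is a normalized tight frame for $L^2(\mathbb{R}^2)$.
   Context: A countable family $\{\psi_i\}_{i\in\Lambda}\subset L^2(\mathbb{R}^2)$ is a normalized tight frame of $L^2(\mathbb{R}^2)$ if $\sum_{i\in\Lambda}|\langle f,\psi_i\rangle|^2=\|f\|^2$ for all $f\in L^2(\mathbb{R}^2)$. Matrices: $A$ is one of $\begin{pmatrix}1&1\\1&-1\end{pmatrix},\begin{pmatrix}1&-3\\1&-1\end{pmatrix},\begin{pmatrix}1&1\\-1&1\end{pmatrix},\begin{pmatrix}-1&-1\\1&-1\end{pmatrix},\begin{pmatrix}-1&2\\-2&2\end{pmatrix},\begin{pmatrix}1&-2\\2&-2\end{pmatrix}$. For the first four, $\vec\ell_A=(1,0)^\tau$; for the last two, $\vec\ell_A=(0,1)^\tau$. $A^\tau$ denotes the transpose of $A$. Operators on $L^2(\mathbb{R}^2)$: $(T_{\vec\ell}f)(\vec t)=f(\vec t-\vec\ell)$ and $(D_Af)(\vec t)=\sqrt2\,f(A\vec t)$ (here $|\det A|=2$). Lawton's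 equations for $A$: $\sum_{\vec n\in\mathbb{Z}^2}h_{\vec n}\overline{h_{\vec n+\vec k}}=\delta_{\vec 0\,\vec k}$ for all $\vec k\in A^\tau\mathbb{Z}^2$, and $\sum_{\vec n\in\mathbb{Z}^2}h_{\vec n}=\sqrt2$; finitely supported means $h_{\vec n}=0$ for $\vec n\in\mathbb{Z}^2\setminus[-N_0,N_0]^2$ for some $N_0\in\mathbb{N}$. Filter: $m_0(\vec t)=\frac1{\sqrt2}\sum_{\vec n}h_{\vec n}e^{-i\vec n\circ\vec t}$ with $\vec n\circ\vec t=n_1t_1+n_2t_2$. Define $g(\vec\xi)=\frac1{2\pi}\prod_{j=1}^\infty m_0((A^\tau)^{-j}\vec\xi)$, $\vec\xi\in\mathbb{R}^2$ (this is a function in $L^2(\mathbb{R}^2)$), and the scaling function $\varphi=\mathcal F^{-1}g$, where $\mathcal F$ is the unitary Fourier transform $(\mathcal Ff)(\vec s)=\frac1{2\pi}\int_{\mathbb{R}^2}e^{-i\vec s\circ\vec t}f(\vec t)\,d\vec t$. $\sigma_A(\vec n)=0$ if $\vec n\in A\mathbb{Z}^2$ and $\sigma_A(\vec n)=1$ if $\vec n\in\mathbb{Z}^2\setminus A\mathbb{Z}^2$. *)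

theory Defs
  imports "HOL-Analysis.Analysis"
begin

text \<open>
  Elements of $L^2(R^2)$ are represented by Borel functions; equality in $L^2$ is equality
  almost everywhere, and the notions below only depend on the class of a function.
\<close>

definition L2 :: "(real^2 \<Rightarrow> complex) set" where
  "L2 = {f \<in> borel_measurable lborel. integrable lborel (\<lambda>t. (cmod (f t))\<^sup>2)}"

definition L2_inner :: "(real^2 \<Rightarrow> complex) \<Rightarrow> (real^2 \<Rightarrow> complex) \<Rightarrow> complex" where
  "L2_inner f g = (\<integral>t. f t * cnj (g t) \<partial>lborel)"

definition L2_norm :: "(real^2 \<Rightarrow> complex) \<Rightarrow> real" where
  "L2_norm f = sqrt (\<integral>t. (cmod (f t))\<^sup>2 \<partial>lborel)"

definition normalized_tight_frame :: "'i set \<Rightarrow> ('i \<Rightarrow> real^2 \<Rightarrow> complex) \<Rightarrow> bool" where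
  "normalized_tight_frame \<Lambda> \<psi> \<longleftrightarrow>
     countable \<Lambda> \<and> (\<forall>i\<in>\<Lambda>. \<psi> i \<in> L2) \<and>
     (\<forall>f\<in>L2. ((\<lambda>i. (cmod (L2_inner f (\<psi> i)))\<^sup>2) has_sum (L2_norm f)\<^sup>2) \<Lambda>)"

text \<open>
  The unitary Fourier transform is the continuous extension to $L^2$ of the integral formula on
  $L^1 \cap L^2$; its graph is the closure of the graph of that formula. The squared distances are
  extended nonnegative integrals, since the Bochner integral of a non-integrable function is 0.
\<close>

definition fourier_integral :: "(real^2 \<Rightarrow> complex) \<Rightarrow> real^2 \<Rightarrow> complex" where
  "fourier_integral f s =
     complex_of_real (1 / (2 * pi)) * (\<integral>t. exp (- (\<i> * complex_of_real (s \<bullet> t))) * f t \<partial>lborel)"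

definition L2_tendsto :: "(nat \<Rightarrow> real^2 \<Rightarrow> complex) \<Rightarrow> (real^2 \<Rightarrow> complex) \<Rightarrow> bool" where
  "L2_tendsto F f \<longleftrightarrow>
     (\<lambda>k. \<integral>\<^sup>+t. ennreal ((cmod (F k t - f t))\<^sup>2) \<partial>lborel) \<longlonglongrightarrow> 0"

definition has_L2_fourier :: "(real^2 \<Rightarrow> complex) \<Rightarrow> (real^2 \<Rightarrow> complex) \<Rightarrow> bool" where
  "has_L2_fourier f g \<longleftrightarrow> f \<in> L2 \<and> g \<in> L2 \<and>
     (\<exists>F. (\<forall>k. F k \<in> L2 \<and> integrable lborel (F k)) \<and>
          L2_tendsto F f \<and> L2_tendsto (\<lambda>k. fourier_integral (F k)) g)"

text \<open>A representative of the inverse Fourier transform, which is unique almost everywhere.\<close>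

definition L2_fourier_inv :: "(real^2 \<Rightarrow> complex) \<Rightarrow> real^2 \<Rightarrow> complex" where
  "L2_fourier_inv g = (SOME f. has_L2_fourier f g)"

definition rvec :: "int^2 \<Rightarrow> real^2" where
  "rvec n = (\<chi> i. of_int (n $ i))"

definition rmat :: "int^2^2 \<Rightarrow> real^2^2" where
  "rmat A = (\<chi> i j. of_int (A $ i $ j))"

definition matrices_type1 :: "(int^2^2) set" where
  "matrices_type1 =
     {vector [vector [1, 1], vector [1, -1]],
      vector [vector [1, -3], vector [1, -1]],
      vector [vector [1, 1], vector [-1, 1]],
      vector [vector [-1, -1], vector [1, -1]]}"

definition matrices_type2 :: "(int^2^2) set" where
  "matrices_type2 =
     {vector [vector [-1, 2], vector [-2, 2]],
      vector [vector [1, -2], vector [2, -2]]}"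

definition ell :: "int^2^2 \<Rightarrow> int^2" where
  "ell A = (if A \<in> matrices_type1 then vector [1, 0] else vector [0, 1])"

definition translation :: "int^2 \<Rightarrow> (real^2 \<Rightarrow> complex) \<Rightarrow> real^2 \<Rightarrow> complex" where
  "translation l f t = f (t - rvec l)"

definition dilation :: "int^2^2 \<Rightarrow> (real^2 \<Rightarrow> complex) \<Rightarrow> real^2 \<Rightarrow> complex" where
  "dilation A f t = complex_of_real (sqrt 2) * f (rmat A *v t)"

text \<open>
  For invertible \<open>A\<close> the dilation is a bijection on all functions, and \<open>inv\<close> is its genuine inverse.
\<close>

definition dilation_power :: "int^2^2 \<Rightarrow> int \<Rightarrow> (real^2 \<Rightarrow> complex) \<Rightarrow> real^2 \<Rightarrow> complex" where
  "dilation_power A n =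
     (if n \<ge> 0 then dilation A ^^ nat n else inv (dilation A) ^^ nat (- n))"

definition finitely_supported :: "(int^2 \<Rightarrow> complex) \<Rightarrow> bool" where
  "finitely_supported h \<longleftrightarrow>
     (\<exists>N0::nat. \<forall>n. \<not> (\<forall>i. - int N0 \<le> n $ i \<and> n $ i \<le> int N0) \<longrightarrow> h n = 0)"

definition lawton :: "int^2^2 \<Rightarrow> (int^2 \<Rightarrow> complex) \<Rightarrow> bool" where
  "lawton A h \<longleftrightarrow>
     (\<forall>k \<in> range (\<lambda>n. transpose A *v n).
        (\<Sum>\<^sub>\<infinity>n. h n * cnj (h (n + k))) = (if k = 0 then 1 else 0)) \<and>
     (\<Sum>\<^sub>\<infinity>n. h n) = complex_of_real (sqrt 2)"

definition filter_m0 :: "(int^2 \<Rightarrow> complex) \<Rightarrow> real^2 \<Rightarrow> complex" where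
  "filter_m0 h t =
     complex_of_real (1 / sqrt 2) * (\<Sum>\<^sub>\<infinity>n. h n * exp (- (\<i> * complex_of_real (rvec n \<bullet> t))))"

text \<open>The product starts at $j = 1$, whence \<open>Suc j\<close>.\<close>

definition scaling_hat :: "int^2^2 \<Rightarrow> (int^2 \<Rightarrow> complex) \<Rightarrow> real^2 \<Rightarrow> complex" where
  "scaling_hat A h \<xi> = complex_of_real (1 / (2 * pi)) *
     prodinf (\<lambda>j. filter_m0 h (((\<lambda>x. matrix_inv (transpose (rmat A)) *v x) ^^ Suc j) \<xi>))"

definition scaling_function :: "int^2^2 \<Rightarrow> (int^2 \<Rightarrow> complex) \<Rightarrow> real^2 \<Rightarrow> complex" where
  "scaling_function A h = L2_fourier_inv (scaling_hat A h)"

definition sigma :: "int^2^2 \<Rightarrow> int^2 \<Rightarrow> nat" where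
  "sigma A n = (if n \<in> range (\<lambda>m. A *v m) then 0 else 1)"

definition wavelet :: "int^2^2 \<Rightarrow> (int^2 \<Rightarrow> complex) \<Rightarrow> real^2 \<Rightarrow> complex" where
  "wavelet A h t =
     (\<Sum>\<^sub>\<infinity>n. (-1) ^ sigma A n * cnj (h (ell A - n)) *
           dilation A (translation n (scaling_function A h)) t)"

end

theory Submission
  imports Defs
begin

text \<open>
  Write $B$ for the transpose of $A$ and $\widehat\varphi$ for the infinite product. Since
  $\widehat\varphi(B\xi) = m_0(\xi)\widehat\varphi(\xi)$, the coefficients
  $c_{j,l} = \langle f, D^j T_l\varphi\rangle$ at scale $j$ are obtained from those at scale $j+1$ by a
  low-pass filter, and the coefficients against the wavelets $D^j T_l\psi$ by the corresponding
  high-pass filter. Because $A\mathbf{Z}^2 = A^\tau\mathbf{Z}^2$ has index 2, Lawton's equations make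
  this filter bank unitary on $\ell^2$, so the wavelet energy at scale $j$ is $P_{j+1}(f) - P_j(f)$ with
  $P_j(f) = \sum_l |c_{j,l}|^2$. It remains to see that $P_j(f) \to \|f\|^2$ as $j\to\infty$ and
  $P_j(f) \to 0$ as $j \to -\infty$. If $\widehat f$ has compact support, then for large $j$ Parseval's
  identity on the torus gives $P_j(f) = \int |\widehat f|^2 |2\pi\,\widehat\varphi(B^{-j}\cdot)|^2$, which
  converges to $\|f\|^2$; as $P_j$ increases with $j$ this also yields the Bessel bound
  $P_j(f) \le \|f\|^2$, first for such $f$ and by density for all $f$. If $f$ has compact support,
  $P_{-j}(f) \to 0$ because $D^j f$ lives on a set shrinking to the origin.

  The Plancherel theorem itself is obtained from Parseval's identity on the torus, applied to
  $e^{-i\theta\cdot t} f(t)$ and integrated over all $\theta$ in a unit cell.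
\<close>

section \<open>Square-integrable functions\<close>

text \<open>Lawton's equations do not force the translates of the scaling function to be
  orthonormal, so there is no orthogonal splitting of L2 to rely on; only energies are compared. The
  obstacle is that the two limits want compact support on opposite sides of the Fourier transform,
  and no nonzero function has both. Energies are therefore defined for every square-integrable
  function on the frequency side, and the fine limit is pushed from its dense class to all of them
  before the coarse limit is taken. Negative scales cost nothing extra: the dilation is unitary, so
  the scales \<open>n \<ge> - N\<close> of \<open>f\<close> are the nonnegative scales of
  \<open>(D ^^ N) f\<close>, and only the energy of \<open>(D ^^ N) f\<close> at scale 0 has to be
  shown to vanish. That the infinite product is square integrable at all is a separate point: its
  partial products, cut off to dilated period cells, all have norm \<open>2 * pi\<close>, and
  Fatou's lemma passes this bound to the limit.\<close>

lemma L2_measurable [measurable_dest]: "f \<in> L2 \<Longrightarrow> f \<in> borel_measurable borel"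
  by (simp add: L2_def)

lemma L2_integrable: "f \<in> L2 \<Longrightarrow> integrable lborel (\<lambda>t. (cmod (f t))\<^sup>2)"
  by (simp add: L2_def)

lemma L2I: "f \<in> borel_measurable borel \<Longrightarrow> integrable lborel (\<lambda>t. (cmod (f t))\<^sup>2) \<Longrightarrow> f \<in> L2"
  by (simp add: L2_def)

lemma L2_nn_integral:
  assumes "f \<in> L2"
  shows "(\<integral>\<^sup>+t. ennreal ((cmod (f t))\<^sup>2) \<partial>lborel) = ennreal ((L2_norm f)\<^sup>2)"
  using L2_integrable[OF assms] by (subst nn_integral_eq_integral) (auto simp: L2_norm_def)

lemma L2I_nn_integral:
  assumes [measurable]: "f \<in> borel_measurable borel"
    and "(\<integral>\<^sup>+t. ennreal ((cmod (f t))\<^sup>2) \<partial>lborel) < \<infinity>"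
  shows "f \<in> L2"
  using assms(2) by (intro L2I integrableI_bounded) auto

lemma L2_nn_norm_le:
  assumes "f \<in> borel_measurable borel" "0 \<le> c"
    and "(\<integral>\<^sup>+t. ennreal ((cmod (f t))\<^sup>2) \<partial>lborel) \<le> ennreal (c\<^sup>2)"
  shows "f \<in> L2" "L2_norm f \<le> c"
proof -
  show "f \<in> L2" using assms by (intro L2I_nn_integral) (auto intro: le_less_trans)
  from L2_nn_integral[OF this] assms show "L2_norm f \<le> c"
    by (auto intro: power2_le_imp_le)
qed

lemma L2_norm_nonneg [simp]: "0 \<le> L2_norm f"
  by (simp add: L2_norm_def)

lemma L2_norm_sq: "(L2_norm f)\<^sup>2 = (\<integral>t. (cmod (f t))\<^sup>2 \<partial>lborel)"
  by (simp add: L2_norm_def)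

lemma L2_dominated:
  assumes "f \<in> borel_measurable borel" "g \<in> L2" "\<And>t. cmod (f t) \<le> cmod (g t)"
  shows "f \<in> L2"
  using assms by (intro L2I Bochner_Integration.integrable_bound[OF L2_integrable[OF assms(2)]]) auto

lemma borel_measurable_cnj [measurable]:
  "f \<in> borel_measurable M \<Longrightarrow> (\<lambda>t. cnj (f t)) \<in> borel_measurable M"
  by (rule borel_measurable_continuous_on[of cnj]) (auto intro: continuous_intros)

lemma L2_cnj [simp, intro]: "f \<in> L2 \<Longrightarrow> (\<lambda>t. cnj (f t)) \<in> L2"
  by (rule L2_dominated) auto

lemma L2_zero [simp, intro]: "(\<lambda>t. 0) \<in> L2"
  by (rule L2I) auto

lemma L2_cmult [simp, intro]: "f \<in> L2 \<Longrightarrow> (\<lambda>t. c * f t) \<in> L2"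
  by (rule L2I) (auto simp: norm_mult power_mult_distrib L2_integrable)

lemma L2_add [simp, intro]:
  assumes "f \<in> L2" "g \<in> L2"
  shows "(\<lambda>t. f t + g t) \<in> L2"
proof (rule L2I)
  show m: "(\<lambda>t. f t + g t) \<in> borel_measurable borel" using assms by auto
  have "integrable lborel (\<lambda>t. 2 * (cmod (f t))\<^sup>2 + 2 * (cmod (g t))\<^sup>2)"
    using assms by (auto simp: L2_integrable)
  moreover have "(cmod (f t + g t))\<^sup>2 \<le> 2 * (cmod (f t))\<^sup>2 + 2 * (cmod (g t))\<^sup>2" for t
  proof -
    have "(cmod (f t + g t))\<^sup>2 \<le> (cmod (f t) + cmod (g t))\<^sup>2"
      by (intro power_mono norm_triangle_ineq) auto
    also have "\<dots> \<le> 2 * (cmod (f t))\<^sup>2 + 2 * (cmod (g t))\<^sup>2"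
      using sum_squares_bound[of "cmod (f t)" "cmod (g t)"] by (simp add: power2_sum)
    finally show ?thesis .
  qed
  ultimately show "integrable lborel (\<lambda>t. (cmod (f t + g t))\<^sup>2)"
    using m by (auto elim!: Bochner_Integration.integrable_bound)
qed

lemma L2_minus [simp, intro]: "f \<in> L2 \<Longrightarrow> (\<lambda>t. - f t) \<in> L2"
  using L2_cmult[of f "-1"] by simp

lemma L2_diff [simp, intro]: "f \<in> L2 \<Longrightarrow> g \<in> L2 \<Longrightarrow> (\<lambda>t. f t - g t) \<in> L2"
  using L2_add[of f "\<lambda>t. - g t"] by simp

lemma L2_sum [intro]: "(\<And>i. i \<in> I \<Longrightarrow> f i \<in> L2) \<Longrightarrow> (\<lambda>t. \<Sum>i\<in>I. f i t) \<in> L2"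
  by (induction I rule: infinite_finite_induct) auto

lemma L2_indicator [intro]:
  assumes "f \<in> L2" "S \<in> sets borel"
  shows "(\<lambda>t. f t * indicator S t) \<in> L2"
  using assms by (intro L2_dominated[OF _ assms(1)]) (auto split: split_indicator)

lemma L2_indicator_const [intro]:
  assumes "S \<in> sets borel" "emeasure lborel S < \<infinity>"
  shows "(\<lambda>t. c * indicator S t) \<in> L2"
proof (rule L2_cmult, rule L2I)
  show "indicator S \<in> borel_measurable borel" using assms by auto
  have "(\<lambda>t. (cmod (indicator S t))\<^sup>2) = indicator S"
    by (auto split: split_indicator)
  then show "integrable lborel (\<lambda>t. (cmod (indicator S t))\<^sup>2)"
    using assms by auto
qed

section \<open>Inner product and norm\<close>

lemma L2_mult_integrable:
  assumes "f \<in> L2" "g \<in> L2"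
  shows "integrable lborel (\<lambda>t. f t * g t)"
proof -
  have "integrable lborel (\<lambda>t. (cmod (f t))\<^sup>2 + (cmod (g t))\<^sup>2)"
    using assms by (auto simp: L2_integrable)
  moreover have "cmod (f t * g t) \<le> (cmod (f t))\<^sup>2 + (cmod (g t))\<^sup>2" for t
    using sum_squares_bound[of "cmod (f t)" "cmod (g t)"]
      mult_nonneg_nonneg[OF norm_ge_zero[of "f t"] norm_ge_zero[of "g t"]]
    unfolding norm_mult by linarith
  ultimately show ?thesis
    using assms by (auto elim!: Bochner_Integration.integrable_bound)
qed

lemma L2_inner_integrable [intro]:
  assumes "f \<in> L2" "g \<in> L2"
  shows "integrable lborel (\<lambda>t. f t * cnj (g t))"
  using assms by (intro L2_mult_integrable) auto

lemma L2_inner_add_left: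
  "f \<in> L2 \<Longrightarrow> g \<in> L2 \<Longrightarrow> h \<in> L2 \<Longrightarrow> L2_inner (\<lambda>t. f t + g t) h = L2_inner f h + L2_inner g h"
  unfolding L2_inner_def by (simp add: distrib_right L2_inner_integrable)

lemma L2_inner_diff_left:
  "f \<in> L2 \<Longrightarrow> g \<in> L2 \<Longrightarrow> h \<in> L2 \<Longrightarrow> L2_inner (\<lambda>t. f t - g t) h = L2_inner f h - L2_inner g h"
  unfolding L2_inner_def by (simp add: left_diff_distrib L2_inner_integrable)

lemma L2_inner_cmult_left: "L2_inner (\<lambda>t. c * f t) h = c * L2_inner f h"
  unfolding L2_inner_def by (simp add: mult.assoc)

lemma L2_inner_cnj: "cnj (L2_inner f g) = L2_inner g f"
  unfolding L2_inner_def by (subst Bochner_Integration.integral_cnj[symmetric]) (simp add: mult.commute)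

lemma L2_inner_diff_right:
  "f \<in> L2 \<Longrightarrow> g \<in> L2 \<Longrightarrow> h \<in> L2 \<Longrightarrow> L2_inner h (\<lambda>t. f t - g t) = L2_inner h f - L2_inner h g"
  unfolding L2_inner_def by (simp add: right_diff_distrib L2_inner_integrable)

lemma L2_inner_cmult_right: "L2_inner h (\<lambda>t. c * f t) = cnj c * L2_inner h f"
  unfolding L2_inner_def by (simp add: mult.left_commute)

lemma L2_inner_sum_left:
  assumes "\<And>i. i \<in> I \<Longrightarrow> f i \<in> L2" "h \<in> L2"
  shows "L2_inner (\<lambda>t. \<Sum>i\<in>I. c i * f i t) h = (\<Sum>i\<in>I. c i * L2_inner (f i) h)"
  using assms(1)
proof (induction I rule: infinite_finite_induct)
  case (insert i I)
  then have "L2_inner (\<lambda>t. c i * f i t + (\<Sum>i\<in>I. c i * f i t)) h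
      = c i * L2_inner (f i) h + (\<Sum>i\<in>I. c i * L2_inner (f i) h)"
    using assms(2) by (subst L2_inner_add_left) (auto simp: L2_inner_cmult_left)
  with insert show ?case by simp
qed (auto simp: L2_inner_def)

lemma L2_inner_sum_right:
  assumes "\<And>i. i \<in> I \<Longrightarrow> f i \<in> L2" "h \<in> L2"
  shows "L2_inner h (\<lambda>t. \<Sum>i\<in>I. c i * f i t) = (\<Sum>i\<in>I. cnj (c i) * L2_inner h (f i))"
proof -
  have "L2_inner h (\<lambda>t. \<Sum>i\<in>I. c i * f i t) = cnj (L2_inner (\<lambda>t. \<Sum>i\<in>I. c i * f i t) h)"
    by (simp add: L2_inner_cnj)
  also have "\<dots> = (\<Sum>i\<in>I. cnj (c i) * L2_inner h (f i))"
    using assms by (subst L2_inner_sum_left) (auto simp: L2_inner_cnj)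
  finally show ?thesis .
qed

lemma L2_inner_self: "L2_inner f f = complex_of_real ((L2_norm f)\<^sup>2)"
  unfolding L2_inner_def L2_norm_sq
  by (simp only: complex_norm_square[symmetric] integral_complex_of_real)

lemma L2_norm_diff_sq:
  assumes "f \<in> L2" "g \<in> L2"
  shows "(L2_norm (\<lambda>t. f t - g t))\<^sup>2 = (L2_norm f)\<^sup>2 - 2 * Re (L2_inner f g) + (L2_norm g)\<^sup>2"
proof -
  have "complex_of_real ((L2_norm (\<lambda>t. f t - g t))\<^sup>2)
      = L2_inner (\<lambda>t. f t - g t) (\<lambda>t. f t - g t)"
    by (simp add: L2_inner_self)
  also have "\<dots> = L2_inner f f - L2_inner f g - (L2_inner g f - L2_inner g g)"
    using assms by (simp add: L2_inner_diff_left L2_inner_diff_right)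
  finally have "(L2_norm (\<lambda>t. f t - g t))\<^sup>2
      = Re (L2_inner f f - L2_inner f g - (L2_inner g f - L2_inner g g))"
    by (metis Re_complex_of_real)
  moreover have "Re (L2_inner g f) = Re (L2_inner f g)"
    by (metis L2_inner_cnj cnj.simps(1))
  ultimately show ?thesis
    by (simp add: L2_inner_self)
qed

lemma L2_norm_cmult: "L2_norm (\<lambda>t. c * f t) = cmod c * L2_norm f"
  by (simp add: L2_norm_def norm_mult power_mult_distrib real_sqrt_mult)

lemma L2_norm_minus_commute: "L2_norm (\<lambda>t. f t - g t) = L2_norm (\<lambda>t. g t - f t)"
  by (simp add: L2_norm_def norm_minus_commute)

text \<open>The squared norm of \<open>f - s * c * g\<close>, with \<open>c\<close> the inner
  product, is a nonnegative quadratic in the real number \<open>s\<close>. Functions stand for their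
  classes, so \<open>g\<close> may have norm zero without being zero, and that case is treated
  apart.\<close>

lemma L2_Cauchy_Schwarz:
  assumes "f \<in> L2" "g \<in> L2"
  shows "cmod (L2_inner f g) \<le> L2_norm f * L2_norm g"
proof -
  define c where "c = L2_inner f g"
  have quad: "0 \<le> (L2_norm f)\<^sup>2 - 2 * s * (cmod c)\<^sup>2 + s\<^sup>2 * (cmod c)\<^sup>2 * (L2_norm g)\<^sup>2" for s :: real
  proof -
    have "0 \<le> (L2_norm (\<lambda>t. f t - (complex_of_real s * c) * g t))\<^sup>2" by simp
    also have "\<dots> = (L2_norm f)\<^sup>2 - 2 * s * (cmod c)\<^sup>2 + s\<^sup>2 * (cmod c)\<^sup>2 * (L2_norm g)\<^sup>2"
      using assms by (subst L2_norm_diff_sq)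
        (auto simp: L2_inner_cmult_right L2_norm_cmult norm_mult power_mult_distrib c_def[symmetric]
           mult.assoc cmod_power2 power2_eq_square[of "Re c"] power2_eq_square[of "Im c"])
    finally show ?thesis .
  qed
  show ?thesis
  proof (cases "c = 0")
    case False
    then have pos: "(cmod c)\<^sup>2 > 0" by simp
    show ?thesis
    proof (cases "L2_norm g = 0")
      case True
      \<comment> \<open>Here the quadratic degenerates to a linear function of \<open>s\<close>, and
        this \<open>s\<close> gives it the value -1.\<close>
      with quad[of "((L2_norm f)\<^sup>2 + 1) / (2 * (cmod c)\<^sup>2)"] pos show ?thesis
        by (simp add: field_simps)
    next
      case False
      then have g: "L2_norm g > 0" using L2_norm_nonneg[of g] by linarith
      \<comment> \<open>The value \<open>1 / (L2_norm g)\<^sup>2\<close> of \<open>s\<close>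
        minimises the quadratic.\<close>
      have "0 \<le> (L2_norm f)\<^sup>2 - (cmod c)\<^sup>2 / (L2_norm g)\<^sup>2"
        using quad[of "1 / (L2_norm g)\<^sup>2"] g
        by (simp add: field_simps power2_eq_square)
      then have "(cmod c)\<^sup>2 \<le> (L2_norm f * L2_norm g)\<^sup>2"
        using g by (simp add: field_simps)
      then show ?thesis unfolding c_def
        by (rule power2_le_imp_le) (simp)
    qed
  qed (auto simp: c_def[symmetric])
qed

lemma L2_norm_triangle:
  assumes "f \<in> L2" "g \<in> L2"
  shows "L2_norm (\<lambda>t. f t + g t) \<le> L2_norm f + L2_norm g"
proof (rule power2_le_imp_le)
  have "(L2_norm (\<lambda>t. f t + g t))\<^sup>2 = (L2_norm (\<lambda>t. f t - (- g t)))\<^sup>2" by simp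
  also have "\<dots> = (L2_norm f)\<^sup>2 + 2 * Re (L2_inner f g) + (L2_norm g)\<^sup>2"
    using assms L2_inner_cmult_right[of f "-1" g] L2_norm_cmult[of "-1" g]
    by (subst L2_norm_diff_sq) auto
  also have "\<dots> \<le> (L2_norm f)\<^sup>2 + 2 * (L2_norm f * L2_norm g) + (L2_norm g)\<^sup>2"
    using L2_Cauchy_Schwarz[OF assms] complex_Re_le_cmod[of "L2_inner f g"] by linarith
  finally show "(L2_norm (\<lambda>t. f t + g t))\<^sup>2 \<le> (L2_norm f + L2_norm g)\<^sup>2"
    by (simp add: power2_sum)
qed simp

lemma L2_norm_diff_triangle:
  assumes "f \<in> L2" "g \<in> L2" "h \<in> L2"
  shows "L2_norm (\<lambda>t. f t - h t) \<le> L2_norm (\<lambda>t. f t - g t) + L2_norm (\<lambda>t. g t - h t)"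
  using L2_norm_triangle[of "\<lambda>t. f t - g t" "\<lambda>t. g t - h t"] assms by simp

lemma L2_norm_reverse_triangle:
  assumes "f \<in> L2" "g \<in> L2"
  shows "\<bar>L2_norm f - L2_norm g\<bar> \<le> L2_norm (\<lambda>t. f t - g t)"
  using L2_norm_diff_triangle[of f g "\<lambda>t. 0"] L2_norm_diff_triangle[of g f "\<lambda>t. 0"]
    L2_norm_minus_commute[of f g] assms by auto

lemma L2_norm_mono:
  assumes "f \<in> borel_measurable borel" "g \<in> L2" "\<And>t. cmod (f t) \<le> cmod (g t)"
  shows "L2_norm f \<le> L2_norm g"
  unfolding L2_norm_def
  using L2_integrable[OF L2_dominated[OF assms]] L2_integrable[OF assms(2)] assms(3)
  by (auto intro!: real_sqrt_le_mono integral_mono power_mono)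

lemma L2_norm_tendsto:
  assumes "\<And>k. f k \<in> L2" "g \<in> L2" "(\<lambda>k. L2_norm (\<lambda>t. f k t - g t)) \<longlonglongrightarrow> 0"
  shows "(\<lambda>k. L2_norm (f k)) \<longlonglongrightarrow> L2_norm g"
proof (rule LIM_zero_cancel, rule Lim_null_comparison[OF _ assms(3)])
  show "\<forall>\<^sub>F k in sequentially. norm (L2_norm (f k) - L2_norm g) \<le> L2_norm (\<lambda>t. f k t - g t)"
    using L2_norm_reverse_triangle[OF assms(1,2)] by auto
qed

lemma L2_inner_tendsto:
  assumes "\<And>k. f k \<in> L2" "g \<in> L2" "h \<in> L2" "(\<lambda>k. L2_norm (\<lambda>t. f k t - g t)) \<longlonglongrightarrow> 0"
  shows "(\<lambda>k. L2_inner (f k) h) \<longlonglongrightarrow> L2_inner g h"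
proof (rule LIM_zero_cancel, rule Lim_null_comparison)
  show "(\<lambda>k. L2_norm (\<lambda>t. f k t - g t) * L2_norm h) \<longlonglongrightarrow> 0"
    using tendsto_mult_right[OF assms(4), of "L2_norm h"] by simp
  show "\<forall>\<^sub>F k in sequentially. norm (L2_inner (f k) h - L2_inner g h)
      \<le> L2_norm (\<lambda>t. f k t - g t) * L2_norm h"
    using assms L2_Cauchy_Schwarz[OF L2_diff[OF assms(1) assms(2)] assms(3)]
    by (auto simp: L2_inner_diff_left)
qed

lemma L2_inner_tendsto_right:
  assumes "\<And>k. f k \<in> L2" "g \<in> L2" "h \<in> L2" "(\<lambda>k. L2_norm (\<lambda>t. f k t - g t)) \<longlonglongrightarrow> 0"
  shows "(\<lambda>k. L2_inner h (f k)) \<longlonglongrightarrow> L2_inner h g"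
  using tendsto_cnj[OF L2_inner_tendsto[OF assms]] by (simp add: L2_inner_cnj)

lemma L2_tendsto_iff:
  assumes "\<And>k. f k \<in> L2" "g \<in> L2"
  shows "L2_tendsto f g \<longleftrightarrow> (\<lambda>k. L2_norm (\<lambda>t. f k t - g t)) \<longlonglongrightarrow> 0"
proof -
  have "L2_tendsto f g \<longleftrightarrow> (\<lambda>k. ennreal ((L2_norm (\<lambda>t. f k t - g t))\<^sup>2)) \<longlonglongrightarrow> ennreal 0"
    unfolding L2_tendsto_def using assms by (subst L2_nn_integral) auto
  also have "\<dots> \<longleftrightarrow> (\<lambda>k. (L2_norm (\<lambda>t. f k t - g t))\<^sup>2) \<longlonglongrightarrow> 0"
    by (subst tendsto_ennreal_iff) auto
  also have "\<dots> \<longleftrightarrow> (\<lambda>k. L2_norm (\<lambda>t. f k t - g t)) \<longlonglongrightarrow> 0"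
    by (rule power_tendsto_0_iff) simp
  finally show ?thesis .
qed

lemma L2_dominated_convergence:
  assumes "\<And>k. f k \<in> borel_measurable borel" "g \<in> borel_measurable borel" "w \<in> L2"
    and "\<And>k t. cmod (f k t) \<le> cmod (w t)" and "\<And>t. (\<lambda>k. f k t) \<longlonglongrightarrow> g t"
  shows "(\<lambda>k. L2_norm (\<lambda>t. f k t - g t)) \<longlonglongrightarrow> 0"
proof -
  have gw: "cmod (g t) \<le> cmod (w t)" for t
    by (rule LIMSEQ_le_const2[OF tendsto_norm[OF assms(5)]]) (use assms(4) in auto)
  have "(\<lambda>k. \<integral>t. (cmod (f k t - g t))\<^sup>2 \<partial>lborel) \<longlonglongrightarrow> (\<integral>t. 0 \<partial>(lborel :: (real^2) measure))"
  proof (rule integral_dominated_convergence)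
    show "integrable lborel (\<lambda>t. (2 * cmod (w t))\<^sup>2)"
      using L2_integrable[OF assms(3)] by (simp add: power_mult_distrib)
    show "AE x in lborel. (\<lambda>i. (cmod (f i x - g x))\<^sup>2) \<longlonglongrightarrow> 0"
    proof (rule AE_I2)
      fix x show "(\<lambda>i. (cmod (f i x - g x))\<^sup>2) \<longlonglongrightarrow> 0"
        using tendsto_power[OF tendsto_norm[OF LIM_zero[OF assms(5)[of x]]], of 2] by simp
    qed
    show "AE x in lborel. norm ((cmod (f i x - g x))\<^sup>2) \<le> (2 * cmod (w x))\<^sup>2" for i
    proof (rule AE_I2)
      fix x
      have "cmod (f i x - g x) \<le> 2 * cmod (w x)"
        using norm_triangle_ineq4[of "f i x" "g x"] gw[of x] assms(4)[of i x] by simp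
      then have "(cmod (f i x - g x))\<^sup>2 \<le> (2 * cmod (w x))\<^sup>2"
        by (intro power_mono) auto
      then show "norm ((cmod (f i x - g x))\<^sup>2) \<le> (2 * cmod (w x))\<^sup>2"
        by simp
    qed
  qed (use assms in auto)
  then show ?thesis
    unfolding L2_norm_def using tendsto_real_sqrt by fastforce
qed

lemma L2_truncate_tendsto:
  assumes "f \<in> L2"
  shows "(\<lambda>k. L2_norm (\<lambda>t. f t * indicator (cball 0 (real k)) t - f t)) \<longlonglongrightarrow> 0"
proof (rule L2_dominated_convergence[OF _ _ assms])
  fix t :: "real^2"
  obtain N :: nat where "norm t \<le> real N" using real_arch_simple by blast
  then have "\<forall>\<^sub>F k in sequentially. f t * indicator (cball 0 (real k)) t = f t"
    by (auto simp: eventually_sequentially intro!: exI[of _ N])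
  then show "(\<lambda>k. f t * indicator (cball 0 (real k)) t) \<longlonglongrightarrow> f t"
    by (rule tendsto_eventually)
next
  have [measurable]: "f \<in> borel_measurable borel" by (rule L2_measurable[OF assms])
  show "f \<in> borel_measurable borel" by simp
  show "(\<lambda>t. f t * indicator (cball 0 (real k)) t) \<in> borel_measurable borel" for k
    by (rule L2_measurable[OF L2_indicator[OF assms]]) auto
qed (auto split: split_indicator)

lemma L2_bounded_support_integrable:
  assumes "f \<in> L2" "\<And>t. t \<notin> cball 0 R \<Longrightarrow> f t = 0"
  shows "integrable lborel f"
proof -
  have "integrable lborel (\<lambda>t. f t * (1 * indicator (cball 0 R) t))"
    using assms(1) emeasure_bounded_finite[of "cball (0::real^2) R"]
    by (intro L2_mult_integrable L2_indicator_const) auto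
  moreover have "(\<lambda>t. f t * (1 * indicator (cball 0 R) t)) = f"
    using assms(2) by (auto split: split_indicator)
  ultimately show ?thesis by simp
qed

section \<open>Fatou's lemma and completeness\<close>

text \<open>Serves limits that are only known almost everywhere: it yields membership in
  \<open>L2\<close> without convergence in norm. A bound from some index on suffices, which is what
  Cauchy sequences provide.\<close>

lemma L2_Fatou:
  assumes F: "\<And>m. F m \<in> L2" and f: "f \<in> borel_measurable borel"
    and lim: "AE t in lborel. (\<lambda>m. F m t) \<longlonglongrightarrow> f t"
    and bound: "\<And>m. m \<ge> N \<Longrightarrow> L2_norm (F m) \<le> c"
  shows "f \<in> L2" "L2_norm f \<le> c"
proof -
  have [measurable]: "F m \<in> borel_measurable borel" for m using F by (rule L2_measurable)
  have c: "0 \<le> c" using bound[of N] L2_norm_nonneg[of "F N"] by linarith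
  have "(\<integral>\<^sup>+t. ennreal ((cmod (f t))\<^sup>2) \<partial>lborel)
      = (\<integral>\<^sup>+t. liminf (\<lambda>m. ennreal ((cmod (F m t))\<^sup>2)) \<partial>lborel)"
  proof (rule nn_integral_cong_AE, use lim in eventually_elim)
    case (elim t)
    have "(\<lambda>m. ennreal ((cmod (F m t))\<^sup>2)) \<longlonglongrightarrow> ennreal ((cmod (f t))\<^sup>2)"
      using elim by (intro tendsto_intros tendsto_ennrealI)
    then show ?case by (intro lim_imp_Liminf[symmetric]) auto
  qed
  also have "\<dots> \<le> liminf (\<lambda>m. \<integral>\<^sup>+t. ennreal ((cmod (F m t))\<^sup>2) \<partial>lborel)"
    by (rule nn_integral_liminf) simp
  also have "\<dots> = liminf (\<lambda>m. ennreal ((L2_norm (F m))\<^sup>2))"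
    using F by (simp add: L2_nn_integral)
  also have "\<dots> \<le> liminf (\<lambda>m. ennreal (c\<^sup>2))"
    using bound by (intro Liminf_mono eventually_sequentiallyI[of N] ennreal_leI power_mono) auto
  also have "\<dots> = ennreal (c\<^sup>2)" by (simp add: Liminf_const)
  finally show "f \<in> L2" "L2_norm f \<le> c" using L2_nn_norm_le[OF f c] by auto
qed

text \<open>Riesz-Fischer. Along a subsequence the increments have norm at most
  \<open>(1/4)^k\<close>; even after multiplying their squares by \<open>4^k\<close> the integrals
  are summable. Hence almost everywhere the weighted squares stay bounded, the increments are
  dominated by a geometric series of ratio 1/2, and the subsequence converges. Fatou's lemma then
  compares the limit with every late member of the whole sequence.\<close>

lemma L2_complete:
  assumes F: "\<And>k. F k \<in> L2"
    and Cauchy: "\<And>e. e > 0 \<Longrightarrow> \<exists>N. \<forall>m\<ge>N. \<forall>n\<ge>N. L2_norm (\<lambda>t. F m t - F n t) < e"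
  obtains f where "f \<in> L2" "(\<lambda>k. L2_norm (\<lambda>t. F k t - f t)) \<longlonglongrightarrow> 0"
proof -
  have "\<exists>r. strict_mono (r :: nat \<Rightarrow> nat) \<and>
      (\<forall>k. \<forall>m\<ge>r k. \<forall>n\<ge>r k. L2_norm (\<lambda>t. F m t - F n t) < (1/4)^k)"
  proof -
    have "\<forall>k. \<exists>N. \<forall>m\<ge>N. \<forall>n\<ge>N. L2_norm (\<lambda>t. F m t - F n t) < (1/4)^k"
      using Cauchy by auto
    then obtain M where M: "\<And>k m n. m \<ge> M k \<Longrightarrow> n \<ge> M k \<Longrightarrow> L2_norm (\<lambda>t. F m t - F n t) < (1/4)^k"
      by metis
    \<comment> \<open>The sum dominates \<open>M k\<close>, and the extra \<open>k\<close> makes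
      \<open>r\<close> strictly increasing.\<close>
    define r where "r k = k + (\<Sum>i\<le>k. M i)" for k
    have "M k \<le> r k" for k
      unfolding r_def by (simp add: member_le_sum trans_le_add2)
    moreover have "strict_mono r"
      by (rule strict_monoI_Suc) (simp add: r_def)
    ultimately show ?thesis using M by (meson order_trans)
  qed
  then obtain r :: "nat \<Rightarrow> nat" where r: "strict_mono r"
    and small: "\<And>k m n. m \<ge> r k \<Longrightarrow> n \<ge> r k \<Longrightarrow> L2_norm (\<lambda>t. F m t - F n t) < (1/4)^k"
    by blast
  define G where "G k = F (r k)" for k
  have G: "G k \<in> L2" for k using F by (simp add: G_def)
  have [measurable]: "G k \<in> borel_measurable borel" for k using G by (rule L2_measurable)
  define D where "D k t = G (Suc k) t - G k t" for k t
  have D: "D k \<in> L2" for k unfolding D_def using G by auto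
  have [measurable]: "D k \<in> borel_measurable borel" for k using D by (rule L2_measurable)
  have Dn: "L2_norm (D k) \<le> (1/4)^k" for k
    using small[of k "r (Suc k)" "r k"] r unfolding D_def G_def
    by (auto simp: strict_mono_less_eq intro: less_imp_le)
  have "(\<integral>\<^sup>+t. (\<Sum>k. ennreal (4^k * (cmod (D k t))\<^sup>2)) \<partial>lborel)
      = (\<Sum>k. \<integral>\<^sup>+t. ennreal (4^k * (cmod (D k t))\<^sup>2) \<partial>lborel)"
    by (rule nn_integral_suminf) simp
  also have "\<dots> = (\<Sum>k. ennreal (4^k * (L2_norm (D k))\<^sup>2))"
    by (simp add: ennreal_mult' nn_integral_cmult L2_nn_integral[OF D])
  also have "\<dots> \<le> (\<Sum>k. ennreal ((1/4)^k))"
  proof (rule suminf_le)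
    fix k
    have "4^k * (L2_norm (D k))\<^sup>2 \<le> 4^k * ((1/4)^k)\<^sup>2"
      using Dn by (intro mult_left_mono power_mono) auto
    also have "\<dots> = (1/4::real)^k"
      by (simp add: power2_eq_square flip: power_mult_distrib)
    finally show "ennreal (4^k * (L2_norm (D k))\<^sup>2) \<le> ennreal ((1/4)^k)" by (rule ennreal_leI)
  qed auto
  also have "\<dots> < \<infinity>"
    by (subst suminf_ennreal2) (auto simp: summable_geometric)
  finally have fin: "(\<integral>\<^sup>+t. (\<Sum>k. ennreal (4^k * (cmod (D k t))\<^sup>2)) \<partial>lborel) \<noteq> \<infinity>" by simp
  have "AE t in lborel. (\<Sum>k. ennreal (4^k * (cmod (D k t))\<^sup>2)) \<noteq> \<infinity>"
    by (rule nn_integral_PInf_AE[OF _ fin]) measurable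
  then have conv: "AE t in lborel. convergent (\<lambda>k. G k t)"
  proof eventually_elim
    case (elim t)
    then have "summable (\<lambda>k. 4^k * (cmod (D k t))\<^sup>2)"
      by (intro summable_suminf_not_top) auto
    then have "Bseq (\<lambda>k. 4^k * (cmod (D k t))\<^sup>2)"
      by (intro convergent_imp_Bseq convergentI[OF summable_LIMSEQ_zero])
    then obtain C where C0: "0 < C" and C': "\<And>k. norm (4^k * (cmod (D k t))\<^sup>2) \<le> C"
      unfolding Bseq_def by blast
    have C: "4^k * (cmod (D k t))\<^sup>2 \<le> C" for k
      using C'[of k] by simp
    have "cmod (D k t) \<le> sqrt C * (1/2)^k" for k
    proof (rule power2_le_imp_le)
      have "4^k * (cmod (D k t))\<^sup>2 \<le> 4^k * (sqrt C * (1/2)^k)\<^sup>2"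
      proof -
        have "((1/2::real)^k)\<^sup>2 = (1/4)^k" "4^k * (1/4::real)^k = 1"
          by (simp_all add: power2_eq_square flip: power_mult_distrib)
        then show ?thesis
          using C[of k] C0 by (simp add: power_mult_distrib mult.left_commute)
      qed
      then show "(cmod (D k t))\<^sup>2 \<le> (sqrt C * (1/2)^k)\<^sup>2" by simp
    qed (use C0 in simp)
    then have "summable (\<lambda>k. D k t)"
      by (intro summable_comparison_test[OF _ summable_mult[OF summable_geometric[of "1/2"]], of _ "sqrt C"]) auto
    then have "convergent (\<lambda>n. \<Sum>k<n. D k t)" by (simp add: summable_iff_convergent)
    moreover have "(\<Sum>k<n. D k t) = G n t - G 0 t" for n
      unfolding D_def by (rule sum_lessThan_telescope)
    ultimately have "convergent (\<lambda>n. G n t - G 0 t)" by simp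
    then show ?case
      using convergent_add[of "\<lambda>n. G n t - G 0 t" "\<lambda>n. G 0 t"] by (simp add: convergent_const)
  qed
  define f where "f t = lim (\<lambda>k. G k t)" for t
  have [measurable]: "f \<in> borel_measurable borel"
    unfolding f_def by (rule borel_measurable_lim_metric) simp
  have lim: "AE t in lborel. (\<lambda>k. G k t) \<longlonglongrightarrow> f t"
    using conv by eventually_elim (simp add: f_def convergent_LIMSEQ_iff)
  have close: "(\<lambda>t. f t - F n t) \<in> L2 \<and> L2_norm (\<lambda>t. f t - F n t) \<le> (1/4)^k"
    if "n \<ge> r k" for n k
  proof -
    have [measurable]: "F n \<in> borel_measurable borel" using F by (rule L2_measurable)
    have "AE t in lborel. (\<lambda>m. G m t - F n t) \<longlonglongrightarrow> f t - F n t"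
      using lim by eventually_elim (intro tendsto_intros)
    moreover have "L2_norm (\<lambda>t. G m t - F n t) \<le> (1/4)^k" if "m \<ge> k" for m
      using small[of k "r m" n] \<open>n \<ge> r k\<close> that r
      by (auto simp: G_def strict_mono_less_eq intro: less_imp_le)
    moreover have "(\<lambda>t. G m t - F n t) \<in> L2" for m using G F by auto
    ultimately show ?thesis
      using L2_Fatou[of "\<lambda>m t. G m t - F n t" "\<lambda>t. f t - F n t" k "(1/4)^k"] by auto
  qed
  have "f \<in> L2"
    using L2_add[OF conjunct1[OF close[of 0 "r 0"]] F[of "r 0"]] by simp
  moreover have "(\<lambda>k. L2_norm (\<lambda>t. F k t - f t)) \<longlonglongrightarrow> 0"
  proof (rule LIMSEQ_I)
    fix e :: real assume "e > 0"
    obtain k where "(1/4::real)^k < e"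
      using \<open>e > 0\<close> real_arch_pow_inv[of e "1/4"] by auto
    then have "norm (L2_norm (\<lambda>t. F n t - f t) - 0) < e" if "n \<ge> r k" for n
      using close[OF that] by (simp add: L2_norm_minus_commute[of "F n"])
    then show "\<exists>no. \<forall>n\<ge>no. norm (L2_norm (\<lambda>t. F n t - f t) - 0) < e" by blast
  qed
  ultimately show thesis by (rule that)
qed

section \<open>Orthonormal systems and Parseval's identity\<close>

lemma L2_norm_orthonormal_sum:
  assumes "\<And>i. e i \<in> L2" "\<And>i j. L2_inner (e i) (e j) = (if i = j then 1 else 0)" "finite I"
  shows "(L2_norm (\<lambda>t. \<Sum>i\<in>I. a i * e i t))\<^sup>2 = (\<Sum>i\<in>I. (cmod (a i))\<^sup>2)"
proof -
  have "complex_of_real ((L2_norm (\<lambda>t. \<Sum>i\<in>I. a i * e i t))\<^sup>2)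
      = L2_inner (\<lambda>t. \<Sum>i\<in>I. a i * e i t) (\<lambda>t. \<Sum>i\<in>I. a i * e i t)"
    by (simp add: L2_inner_self)
  also have "\<dots> = (\<Sum>i\<in>I. a i * (\<Sum>j\<in>I. cnj (a j) * (if i = j then 1 else 0)))"
    using assms by (subst L2_inner_sum_left) (auto simp: L2_inner_sum_right intro!: L2_sum)
  also have "\<dots> = (\<Sum>i\<in>I. a i * cnj (a i))"
    using assms(3) by (intro sum.cong refl) (simp add: if_distrib[of "\<lambda>x. _ * x"] sum.delta' cong: if_cong)
  also have "\<dots> = complex_of_real (\<Sum>i\<in>I. (cmod (a i))\<^sup>2)"
    by (simp add: complex_norm_square del: of_real_power)
  finally show ?thesis by (simp only: of_real_eq_iff)
qed

text \<open>Completing the square in each coefficient. With \<open>a\<close> the Fourier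
  coefficients it gives Bessel's inequality; for other \<open>a\<close> it says that the Fourier
  coefficients approximate best.\<close>

lemma L2_orthonormal_approximation:
  assumes e: "\<And>i. e i \<in> L2" "\<And>i j. L2_inner (e i) (e j) = (if i = j then 1 else 0)"
    and "finite I" "F \<in> L2"
  shows "(L2_norm (\<lambda>t. F t - (\<Sum>i\<in>I. a i * e i t)))\<^sup>2
    = (L2_norm F)\<^sup>2 - (\<Sum>i\<in>I. (cmod (L2_inner F (e i)))\<^sup>2) + (\<Sum>i\<in>I. (cmod (L2_inner F (e i) - a i))\<^sup>2)"
proof -
  have *: "(cmod (c - b))\<^sup>2 = (cmod c)\<^sup>2 - 2 * Re (cnj b * c) + (cmod b)\<^sup>2" for b c :: complex
    unfolding cmod_power2 by (simp add: power2_eq_square algebra_simps)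
  have "(L2_norm (\<lambda>t. F t - (\<Sum>i\<in>I. a i * e i t)))\<^sup>2
    = (L2_norm F)\<^sup>2 - 2 * Re (\<Sum>i\<in>I. cnj (a i) * L2_inner F (e i)) + (\<Sum>i\<in>I. (cmod (a i))\<^sup>2)"
    using assms by (subst L2_norm_diff_sq) (auto simp: L2_inner_sum_right L2_norm_orthonormal_sum intro!: L2_sum)
  then show ?thesis
    unfolding * by (simp add: sum.distrib sum_subtractf sum_distrib_left)
qed

text \<open>Enlarging the index set from \<open>I\<close> to \<open>J\<close> only decreases the
  defect in Bessel's inequality, and at \<open>I\<close> the defect is at most the squared error of
  the given approximation.\<close>

lemma L2_Parseval:
  assumes e: "\<And>i. e i \<in> L2" "\<And>i j. L2_inner (e i) (e j) = (if i = j then 1 else 0)"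
    and F: "F \<in> L2"
    and dense: "\<And>\<epsilon>. \<epsilon> > 0 \<Longrightarrow> \<exists>I a. finite I \<and> L2_norm (\<lambda>t. F t - (\<Sum>i\<in>I. a i * e i t)) < \<epsilon>"
  shows "((\<lambda>i. (cmod (L2_inner F (e i)))\<^sup>2) has_sum (L2_norm F)\<^sup>2) UNIV"
  unfolding has_sum_def tendsto_iff eventually_finite_subsets_at_top
proof (intro allI impI)
  fix \<epsilon> :: real assume "\<epsilon> > 0"
  then obtain I a where I: "finite I" and lt: "L2_norm (\<lambda>t. F t - (\<Sum>i\<in>I. a i * e i t)) < sqrt \<epsilon>"
    using dense[of "sqrt \<epsilon>"] by auto
  let ?S = "\<lambda>J. \<Sum>i\<in>J. (cmod (L2_inner F (e i)))\<^sup>2"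
  have "dist (?S J) ((L2_norm F)\<^sup>2) < \<epsilon>" if J: "finite J" "I \<subseteq> J" for J
  proof -
    have "0 \<le> (L2_norm (\<lambda>t. F t - (\<Sum>i\<in>J. L2_inner F (e i) * e i t)))\<^sup>2" by simp
    also have "\<dots> = (L2_norm F)\<^sup>2 - ?S J"
      using J by (subst L2_orthonormal_approximation[OF e _ F]) auto
    finally have le: "?S J \<le> (L2_norm F)\<^sup>2" by simp
    have "(L2_norm F)\<^sup>2 - ?S J \<le> (L2_norm F)\<^sup>2 - ?S I"
      using J by (simp add: sum_mono2)
    also have "\<dots> \<le> (L2_norm (\<lambda>t. F t - (\<Sum>i\<in>I. a i * e i t)))\<^sup>2"
      using I by (subst L2_orthonormal_approximation[OF e _ F]) (auto intro: sum_nonneg)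
    also have "\<dots> < (sqrt \<epsilon>)\<^sup>2"
      using lt by (intro power_strict_mono) auto
    finally show ?thesis using le \<open>\<epsilon> > 0\<close> by (simp add: dist_real_def)
  qed
  then show "\<exists>X. finite X \<and> X \<subseteq> UNIV \<and> (\<forall>Y. finite Y \<and> X \<subseteq> Y \<and> Y \<subseteq> UNIV \<longrightarrow> dist (?S Y) ((L2_norm F)\<^sup>2) < \<epsilon>)"
    using I by blast
qed

section \<open>Extension from compactly supported functions\<close>

text \<open>This dense class is used on both sides of the Fourier transform: on the frequency side
  for the fine limit, on the time side for the coarse one.\<close>

definition L2_bounded :: "(real^2 \<Rightarrow> complex) set" where
  "L2_bounded = {f \<in> L2. \<exists>R. \<forall>t. t \<notin> cball 0 R \<longrightarrow> f t = 0}"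

lemma L2_bounded_imp_L2: "f \<in> L2_bounded \<Longrightarrow> f \<in> L2"
  by (simp add: L2_bounded_def)

lemma L2_bounded_dense:
  assumes "f \<in> L2" "\<epsilon> > 0"
  shows "\<exists>g\<in>L2_bounded. L2_norm (\<lambda>t. f t - g t) < \<epsilon>"
proof -
  obtain k where "norm (L2_norm (\<lambda>t. f t * indicator (cball 0 (real k)) t - f t)) < \<epsilon>"
    using LIMSEQ_D[OF L2_truncate_tendsto[OF assms(1)] assms(2)] by auto
  moreover have "(\<lambda>t. f t * indicator (cball 0 (real k)) t) \<in> L2_bounded"
    unfolding L2_bounded_def using assms(1)
    by (auto intro!: L2_indicator exI[of _ "real k"])
  ultimately show ?thesis
    by (intro bexI[of _ "\<lambda>t. f t * indicator (cball 0 (real k)) t"])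
      (auto simp: L2_norm_minus_commute[of f])
qed

text \<open>Two uses are served: \<open>k\<close> is a scale when energies converge, and a dummy
  when an exact identity is extended. Single coefficients are continuous, so Bessel's inequality on
  finite index sets survives approximation. The constants \<open>M k i\<close> carry no uniformity;
  that comes only from the Bessel bound, which makes the square root of the total energy 1-Lipschitz
  in \<open>F\<close> for every \<open>k\<close> and so lets the limit pass to the closure.\<close>

lemma
  fixes c :: "nat \<Rightarrow> 'i \<Rightarrow> (real^2 \<Rightarrow> complex) \<Rightarrow> complex"
  assumes lin: "\<And>k i F G. F \<in> L2 \<Longrightarrow> G \<in> L2 \<Longrightarrow> c k i (\<lambda>t. F t - G t) = c k i F - c k i G"
    and cont: "\<And>k i F. F \<in> L2 \<Longrightarrow> cmod (c k i F) \<le> M k i * L2_norm F"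
    and summ: "\<And>F k. F \<in> L2_bounded \<Longrightarrow> (\<lambda>i. (cmod (c k i F))\<^sup>2) summable_on UNIV"
    and bound: "\<And>F k. F \<in> L2_bounded \<Longrightarrow> (\<Sum>\<^sub>\<infinity>i. (cmod (c k i F))\<^sup>2) \<le> (L2_norm F)\<^sup>2"
    and F: "F \<in> L2"
  shows L2_Bessel_dense_summable: "(\<lambda>i. (cmod (c k i F))\<^sup>2) summable_on UNIV"
    and L2_Bessel_dense_tendsto:
      "(\<And>G. G \<in> L2_bounded \<Longrightarrow> (\<lambda>k. \<Sum>\<^sub>\<infinity>i. (cmod (c k i G))\<^sup>2) \<longlonglongrightarrow> (L2_norm G)\<^sup>2) \<Longrightarrow>
       (\<lambda>k. \<Sum>\<^sub>\<infinity>i. (cmod (c k i F))\<^sup>2) \<longlonglongrightarrow> (L2_norm F)\<^sup>2"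
proof -
  let ?S = "\<lambda>k F. \<Sum>\<^sub>\<infinity>i. (cmod (c k i F))\<^sup>2"
  have fin: "(\<Sum>i\<in>I. (cmod (c k i F))\<^sup>2) \<le> (L2_norm F)\<^sup>2" if I: "finite I" and F: "F \<in> L2" for I k F
  proof -
    have "\<forall>n. \<exists>g\<in>L2_bounded. L2_norm (\<lambda>t. F t - g t) < inverse (Suc n)"
      using L2_bounded_dense[OF F] by simp
    then obtain G where G: "\<And>n. G n \<in> L2_bounded" "\<And>n. L2_norm (\<lambda>t. F t - G n t) < inverse (Suc n)"
      by metis
    note G2 = L2_bounded_imp_L2[OF G(1)]
    have lim: "(\<lambda>n. L2_norm (\<lambda>t. G n t - F t)) \<longlonglongrightarrow> 0"
      by (rule Lim_null_comparison[OF _ LIMSEQ_inverse_real_of_nat])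
        (use G(2) in \<open>auto simp: L2_norm_minus_commute[of "G _"] intro!: always_eventually less_imp_le\<close>)
    have "(\<lambda>n. c k i (G n)) \<longlonglongrightarrow> c k i F" for i
    proof (rule LIM_zero_cancel, rule Lim_null_comparison)
      show "\<forall>\<^sub>F n in sequentially. norm (c k i (G n) - c k i F) \<le> M k i * L2_norm (\<lambda>t. G n t - F t)"
        using cont[OF L2_diff[OF G2 F], of k i] lin[OF G2 F] by (auto intro: always_eventually)
      show "(\<lambda>n. M k i * L2_norm (\<lambda>t. G n t - F t)) \<longlonglongrightarrow> 0"
        using tendsto_mult_right_zero[OF lim] by simp
    qed
    then have "(\<lambda>n. \<Sum>i\<in>I. (cmod (c k i (G n)))\<^sup>2) \<longlonglongrightarrow> (\<Sum>i\<in>I. (cmod (c k i F))\<^sup>2)"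
      by (intro tendsto_intros)
    moreover have "(\<lambda>n. (L2_norm (G n))\<^sup>2) \<longlonglongrightarrow> (L2_norm F)\<^sup>2"
      by (intro tendsto_intros L2_norm_tendsto G2 F lim)
    moreover have "(\<Sum>i\<in>I. (cmod (c k i (G n)))\<^sup>2) \<le> (L2_norm (G n))\<^sup>2" for n
      by (rule order_trans[OF finite_sum_le_infsum[OF summ[OF G(1)] I] bound[OF G(1)]]) auto
    ultimately show ?thesis by (meson LIMSEQ_le)
  qed
  have summ': "(\<lambda>i. (cmod (c k i F))\<^sup>2) summable_on UNIV" if "F \<in> L2" for k F
    using fin[OF _ that, of _ k] by (intro nonneg_bdd_above_summable_on bdd_aboveI[of _ "(L2_norm F)\<^sup>2"]) auto
  have bound': "?S k F \<le> (L2_norm F)\<^sup>2" if "F \<in> L2" for k F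
    using fin[OF _ that, of _ k] by (intro infsum_le_finite_sums summ'[OF that]) auto
  show "(\<lambda>i. (cmod (c k i F))\<^sup>2) summable_on UNIV"
    by (rule summ'[OF F])
  have S0: "0 \<le> ?S k F" for k F by (rule infsum_nonneg) simp
  \<comment> \<open>Minkowski's inequality for finite sums, the difference term being absorbed by
    Bessel's inequality.\<close>
  have tri: "sqrt (?S k G) \<le> sqrt (?S k F) + L2_norm (\<lambda>t. F t - G t)" if F: "F \<in> L2" and G: "G \<in> L2" for k F G
  proof -
    have "?S k G \<le> (sqrt (?S k F) + L2_norm (\<lambda>t. F t - G t))\<^sup>2"
    proof (rule infsum_le_finite_sums[OF summ'[OF G]])
      fix I :: "'i set" assume I: "finite I"
      have "sqrt (\<Sum>i\<in>I. (cmod (c k i G))\<^sup>2) = L2_set (\<lambda>i. cmod (c k i G)) I"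
        by (simp add: L2_set_def)
      also have "\<dots> \<le> L2_set (\<lambda>i. cmod (c k i F) + cmod (c k i (\<lambda>t. F t - G t))) I"
      proof (rule L2_set_mono)
        fix i
        show "cmod (c k i G) \<le> cmod (c k i F) + cmod (c k i (\<lambda>t. F t - G t))"
          using norm_triangle_ineq4[of "c k i F" "c k i F - c k i G"] by (simp add: lin[OF F G])
      qed simp
      also have "\<dots> \<le> L2_set (\<lambda>i. cmod (c k i F)) I + L2_set (\<lambda>i. cmod (c k i (\<lambda>t. F t - G t))) I"
        by (rule L2_set_triangle_ineq)
      also have "L2_set (\<lambda>i. cmod (c k i F)) I \<le> sqrt (?S k F)"
        unfolding L2_set_def by (intro real_sqrt_le_mono finite_sum_le_infsum summ' F I) auto
      also have "L2_set (\<lambda>i. cmod (c k i (\<lambda>t. F t - G t))) I \<le> L2_norm (\<lambda>t. F t - G t)"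
        unfolding L2_set_def using fin[OF I L2_diff[OF F G], of k] by (simp add: real_le_lsqrt)
      finally have "sqrt (\<Sum>i\<in>I. (cmod (c k i G))\<^sup>2) \<le> sqrt (?S k F) + L2_norm (\<lambda>t. F t - G t)" by simp
      then show "(\<Sum>i\<in>I. (cmod (c k i G))\<^sup>2) \<le> (sqrt (?S k F) + L2_norm (\<lambda>t. F t - G t))\<^sup>2"
        by (rule sqrt_le_D)
    qed
    then show ?thesis
      using S0 by (intro real_le_lsqrt) auto
  qed
  assume lim: "\<And>G. G \<in> L2_bounded \<Longrightarrow> (\<lambda>k. ?S k G) \<longlonglongrightarrow> (L2_norm G)\<^sup>2"
  have "(\<lambda>k. sqrt (?S k F)) \<longlonglongrightarrow> L2_norm F"
  proof (rule LIMSEQ_I)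
    fix r :: real assume "r > 0"
    obtain G where G: "G \<in> L2_bounded" "L2_norm (\<lambda>t. F t - G t) < r/3"
      using L2_bounded_dense[OF F, of "r/3"] \<open>r > 0\<close> by auto
    note G2 = L2_bounded_imp_L2[OF G(1)]
    have "(\<lambda>k. sqrt (?S k G)) \<longlonglongrightarrow> sqrt ((L2_norm G)\<^sup>2)"
      by (intro tendsto_intros lim G)
    then obtain no where no: "\<And>k. k \<ge> no \<Longrightarrow> \<bar>sqrt (?S k G) - L2_norm G\<bar> < r/3"
      using LIMSEQ_D[of "\<lambda>k. sqrt (?S k G)" "L2_norm G" "r/3"] \<open>r > 0\<close> by auto
    have "norm (sqrt (?S k F) - L2_norm F) < r" if "k \<ge> no" for k
    proof -
      have "sqrt (?S k F) \<le> L2_norm F"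
        using bound'[OF F, of k] S0[of k F] by (simp add: real_le_lsqrt)
      moreover have "L2_norm F < sqrt (?S k F) + r"
        using tri[OF F G2, of k] no[OF that] G(2) L2_norm_reverse_triangle[OF F G2] by linarith
      ultimately show ?thesis by simp
    qed
    then show "\<exists>no. \<forall>k\<ge>no. norm (sqrt (?S k F) - L2_norm F) < r" by blast
  qed
  from tendsto_power[OF this, of 2] show "(\<lambda>k. ?S k F) \<longlonglongrightarrow> (L2_norm F)\<^sup>2"
    using S0[of _ F] by simp
qed

section \<open>Fourier series on the torus\<close>

lemma rvec_nth [simp]: "rvec n $ i = of_int (n $ i)"
  by (simp add: rvec_def)

lemma rvec_add: "rvec (m + n) = rvec m + rvec n"
  by (simp add: vec_eq_iff)

lemma rvec_minus: "rvec (- n) = - rvec n"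
  by (simp add: vec_eq_iff)

lemma rvec_zero [simp]: "rvec 0 = 0"
  by (simp add: vec_eq_iff)

definition character :: "int^2 \<Rightarrow> real^2 \<Rightarrow> complex" where
  "character n x = exp (\<i> * complex_of_real (rvec n \<bullet> x))"

lemma cmod_character [simp]: "cmod (character n x) = 1"
  by (simp add: character_def)

lemma character_mult: "character m x * character n x = character (m + n) x"
  by (simp add: character_def rvec_add inner_add_left distrib_left flip: exp_add)

lemma cnj_character: "cnj (character n x) = character (- n) x"
  by (simp add: character_def rvec_minus exp_cnj)

lemma character_zero [simp]: "character 0 x = 1"
  by (simp add: character_def)

lemma continuous_on_character [continuous_intros]: "continuous_on S (character n)"
  unfolding character_def by (intro continuous_intros)

lemma borel_measurable_character [measurable]: "character n \<in> borel_measurable borel"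
  by (rule borel_measurable_continuous_onI[OF continuous_on_character])

section \<open>Orthonormality of the characters on a period cell\<close>

text \<open>Open, so that a function vanishing off it is zero on the whole boundary and hence takes
  equal values at points identified on the torus.\<close>

definition torus_cell :: "(real^2) set" where
  "torus_cell = box (\<chi> i. - pi) (\<chi> i. pi)"

lemma mem_torus_cell: "x \<in> torus_cell \<longleftrightarrow> (\<forall>i. - pi < x $ i \<and> x $ i < pi)"
  by (simp add: torus_cell_def mem_box_cart)

lemma open_torus_cell [simp]: "open torus_cell"
  unfolding torus_cell_def by (rule open_box)

lemma sets_torus_cell [measurable, simp]: "torus_cell \<in> sets borel"
  by simp

lemma bounded_torus_cell: "bounded torus_cell"
  by (simp add: torus_cell_def)

lemma emeasure_torus_cell: "emeasure lborel torus_cell < \<infinity>"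
  by (rule emeasure_bounded_finite[OF bounded_torus_cell])

lemma character_torus_L2 [simp, intro]: "(\<lambda>x. c * (character n x * indicator torus_cell x)) \<in> L2"
proof (rule L2_dominated)
  show "(\<lambda>x. c * indicator torus_cell x) \<in> L2"
    using emeasure_torus_cell by (intro L2_indicator_const) auto
qed (auto simp: norm_mult)

lemma lborel_integral_prod:
  fixes u :: "'n::finite \<Rightarrow> real \<Rightarrow> complex"
  assumes u: "\<And>i. integrable lborel (u i)"
  shows "(\<integral>x. (\<Prod>i\<in>UNIV. u i ((x :: real^'n) $ i)) \<partial>lborel) = (\<Prod>i\<in>UNIV. \<integral>t. u i t \<partial>lborel)"
proof -
  \<comment> \<open>Lebesgue measure on a Euclidean space is a product over basis vectors, so the
    factors are reindexed from coordinates to basis vectors.\<close>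
  define v where "v b = u (SOME i. b = (axis i 1 :: real^'n))" for b
  have v: "v (axis i 1) = u i" for i
    unfolding v_def by (simp add: axis_eq_axis)
  have Basis: "(Basis :: (real^'n) set) = (\<lambda>i. axis i 1) ` UNIV"
    by (auto simp: Basis_vec_def)
  have inj: "inj (\<lambda>i. axis i 1 :: real^'n)"
    by (auto simp: inj_on_def axis_eq_axis)
  interpret product_sigma_finite "\<lambda>b :: real^'n. lborel :: real measure"
    by standard
  have [measurable]: "u i \<in> borel_measurable borel" for i using u[of i] by auto
  have vm [measurable]: "v b \<in> borel_measurable borel" for b by (simp add: v_def)
  have "(\<integral>x. (\<Prod>i\<in>UNIV. u i ((x :: real^'n) $ i)) \<partial>lborel)
      = (\<integral>x. (\<Prod>b\<in>Basis. v b (x \<bullet> b)) \<partial>(lborel :: (real^'n) measure))"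
    unfolding Basis by (simp add: prod.reindex[OF inj] v cart_eq_inner_axis)
  also have "\<dots> = (\<integral>f. (\<Prod>b\<in>Basis. v b ((\<Sum>b\<in>Basis. f b *\<^sub>R b) \<bullet> b))
        \<partial>(\<Pi>\<^sub>M b\<in>(Basis :: (real^'n) set). lborel))"
    by (subst lborel_eq, subst integral_distr) auto
  also have "\<dots> = (\<integral>f. (\<Prod>b\<in>Basis. v b (f b)) \<partial>(\<Pi>\<^sub>M b\<in>(Basis :: (real^'n) set). lborel))"
    by (intro Bochner_Integration.integral_cong refl prod.cong) simp
  also have "\<dots> = (\<Prod>b\<in>(Basis :: (real^'n) set). \<integral>t. v b t \<partial>lborel)"
    by (rule product_integral_prod) (auto simp: v_def u)
  also have "\<dots> = (\<Prod>i\<in>UNIV. \<integral>t. u i t \<partial>lborel)"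
    unfolding Basis by (simp add: prod.reindex[OF inj] v)
  finally show ?thesis .
qed

lemma integral_exp_circle:
  fixes m :: int
  defines "u \<equiv> \<lambda>t. exp (\<i> * complex_of_real (of_int m * t)) * indicator {- pi <..< pi} t"
  shows "integrable lborel u" "integral\<^sup>L lborel u = (if m = 0 then 2 * pi else 0)"
proof -
  let ?f = "\<lambda>t. exp (\<i> * complex_of_real (of_int m * t))"
  \<comment> \<open>The fundamental theorem of calculus is applied on the closed interval; the two
    endpoints form a null set.\<close>
  let ?w = "\<lambda>t. indicator {- pi .. pi} t *\<^sub>R ?f t"
  have AE: "AE t in lborel. ?w t = u t"
    using AE_lborel_singleton[of pi] AE_lborel_singleton[of "-pi"]
    by eventually_elim (auto simp: u_def split: split_indicator)
  have cont: "continuous_on {- pi .. pi} ?f" by (intro continuous_intros)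
  have um: "u \<in> borel_measurable lborel"
    unfolding u_def
    by (intro borel_measurable_times borel_measurable_indicator)
      (simp_all add: borel_measurable_continuous_onI continuous_intros)
  have wi: "integrable lborel ?w"
    using borel_integrable_atLeastAtMost'[OF cont] by (simp add: set_integrable_def)
  show "integrable lborel u"
    by (rule integrable_cong_AE_imp[OF wi um]) (use AE in eventually_elim, simp)
  have "integral\<^sup>L lborel u = integral\<^sup>L lborel ?w"
    using um borel_measurable_integrable[OF wi] AE by (intro integral_cong_AE) auto
  also have "\<dots> = (if m = 0 then 2 * pi else 0)"
  proof (cases "m = 0")
    case True
    then show ?thesis by (simp add: scaleR_conv_of_real)
  next
    case False
    let ?F = "\<lambda>t. ?f t / (\<i> * of_int m)"
    have "integral\<^sup>L lborel ?w = ?F pi - ?F (- pi)"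
    proof (rule integral_FTC_Icc[OF _ _ cont])
      fix x :: real
      show "(?F has_vector_derivative ?f x) (at x within {- pi .. pi})"
      proof -
        have "((\<lambda>z. exp (\<i> * (of_int m * z)) / (\<i> * of_int m)) has_field_derivative
            exp (\<i> * (of_int m * complex_of_real x))) (at (complex_of_real x))"
          using False by (auto intro!: derivative_eq_intros simp: field_simps)
        from has_vector_derivative_real_field[OF this] show ?thesis by simp
      qed
    qed simp
    also have "?f pi = ?f (- pi)"
    proof -
      have "?f pi = ?f (- pi) * exp (2 * of_int m * pi * \<i>)"
        unfolding exp_add[symmetric] by (rule arg_cong[of _ _ exp]) (simp add: algebra_simps)
      also have "exp (2 * of_int m * pi * \<i>) = 1"
        by (rule exp_integer_2pi) simp
      finally show ?thesis by simp
    qed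
    then have "?F pi - ?F (- pi) = 0" by simp
    finally show ?thesis using False by simp
  qed
  finally show "integral\<^sup>L lborel u = (if m = 0 then 2 * pi else 0)" .
qed

lemma integral_character_torus:
  "(\<integral>x. character n x * indicator torus_cell x \<partial>lborel) = (if n = 0 then (2 * pi)\<^sup>2 else 0)"
proof -
  let ?u = "\<lambda>i t. exp (\<i> * complex_of_real (of_int (n $ i) * t)) * indicator {- pi <..< pi} t"
  have "character n x * indicator torus_cell x = (\<Prod>i\<in>UNIV. ?u i (x $ i))" for x :: "real^2"
    unfolding prod.distrib
    by (simp add: character_def inner_vec_def exp_add distrib_left mem_torus_cell indicator_def UNIV_2 forall_2)
  then have "(\<integral>x. character n x * indicator torus_cell x \<partial>lborel) = (\<Prod>i\<in>UNIV. integral\<^sup>L lborel (?u i))"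
    using lborel_integral_prod[of ?u] integral_exp_circle(1) by simp
  also have "\<dots> = (\<Prod>i\<in>UNIV. if n $ i = 0 then 2 * complex_of_real pi else 0)"
    unfolding integral_exp_circle(2) by (intro prod.cong) auto
  also have "\<dots> = (if n = 0 then (2 * pi)\<^sup>2 else 0)"
    by (auto simp: UNIV_2 vec_eq_iff forall_2 power2_eq_square)
  finally show ?thesis .
qed

definition torus_basis :: "int^2 \<Rightarrow> real^2 \<Rightarrow> complex" where
  "torus_basis n x = complex_of_real (1 / (2 * pi)) * (character n x * indicator torus_cell x)"

lemma torus_basis_L2 [simp]: "torus_basis n \<in> L2"
  unfolding torus_basis_def by (rule character_torus_L2)

lemma torus_basis_orthonormal: "L2_inner (torus_basis m) (torus_basis n) = (if m = n then 1 else 0)"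
proof -
  have "L2_inner (torus_basis m) (torus_basis n)
      = complex_of_real ((1 / (2 * pi))\<^sup>2) * (\<integral>x. character (m - n) x * indicator torus_cell x \<partial>lborel)"
    unfolding L2_inner_def torus_basis_def integral_mult_right_zero[symmetric]
    by (intro Bochner_Integration.integral_cong refl)
      (auto simp: cnj_character character_mult power2_eq_square split: split_indicator)
  also have "\<dots> = (if m = n then 1 else 0)"
    unfolding integral_character_torus by (simp add: power2_eq_square field_simps)
  finally show ?thesis .
qed

section \<open>Density of trigonometric polynomials\<close>

inductive trig_poly :: "(real^2 \<Rightarrow> complex) \<Rightarrow> bool" where
  trig_poly_monom: "trig_poly (\<lambda>x. c * character n x)"
| trig_poly_add: "trig_poly p \<Longrightarrow> trig_poly q \<Longrightarrow> trig_poly (\<lambda>x. p x + q x)"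

lemma trig_poly_const: "trig_poly (\<lambda>x. c)"
  using trig_poly_monom[of c 0] by simp

lemma trig_poly_mult:
  assumes "trig_poly p" "trig_poly q"
  shows "trig_poly (\<lambda>x. p x * q x)"
  using assms
proof (induction p rule: trig_poly.induct)
  case (trig_poly_monom c m)
  from trig_poly_monom show ?case
  proof (induction q rule: trig_poly.induct)
    case (trig_poly_monom d n)
    have "(\<lambda>x. c * character m x * (d * character n x)) = (\<lambda>x. (c * d) * character (m + n) x)"
      by (simp add: mult.assoc mult.left_commute flip: character_mult)
    then show ?case by (simp add: trig_poly.trig_poly_monom)
  next
    case (trig_poly_add p q)
    then show ?case by (simp add: distrib_left trig_poly.trig_poly_add)
  qed
next
  case (trig_poly_add p1 p2)
  then show ?case by (simp add: distrib_right trig_poly.trig_poly_add)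
qed

lemma trig_poly_cmult: "trig_poly p \<Longrightarrow> trig_poly (\<lambda>x. c * p x)"
  by (rule trig_poly_mult[OF trig_poly_const])

lemma trig_poly_expand:
  assumes "trig_poly p"
  shows "\<exists>I a. finite I \<and> (\<forall>x. p x = (\<Sum>n\<in>I. a n * character n x))"
  using assms
proof (induction p rule: trig_poly.induct)
  case (trig_poly_monom c n)
  show ?case by (rule exI[of _ "{n}"], rule exI[of _ "\<lambda>_. c"]) simp
next
  case (trig_poly_add p q)
  then obtain I a J b where IJ: "finite I" "finite J"
    and pq: "\<And>x. p x = (\<Sum>n\<in>I. a n * character n x)" "\<And>x. q x = (\<Sum>n\<in>J. b n * character n x)"
    by blast
  let ?c = "\<lambda>n. (if n \<in> I then a n else 0) + (if n \<in> J then b n else 0)"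
  have eq: "p x + q x = (\<Sum>n\<in>I \<union> J. ?c n * character n x)" for x
  proof -
    have "p x = (\<Sum>n\<in>I \<union> J. (if n \<in> I then a n else 0) * character n x)"
      unfolding pq using IJ by (intro sum.mono_neutral_cong_left) auto
    moreover have "q x = (\<Sum>n\<in>I \<union> J. (if n \<in> J then b n else 0) * character n x)"
      unfolding pq using IJ by (intro sum.mono_neutral_cong_left) auto
    ultimately show ?thesis by (simp add: sum.distrib distrib_right)
  qed
  show ?case
    by (rule exI[of _ "I \<union> J"], rule exI[of _ ?c]) (use IJ eq in simp)
qed

lemma trig_poly_cis: "trig_poly (\<lambda>x. cis (x $ i))" "trig_poly (\<lambda>x. cnj (cis (x $ i)))"
proof -
  have *: "rvec (axis i 1) \<bullet> x = x $ i" for x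
  proof -
    have "rvec (axis i 1) = axis i 1" by (simp add: vec_eq_iff axis_def)
    then show ?thesis by (simp add: inner_commute[of _ x] inner_axis)
  qed
  have c: "cis (x $ i) = character (axis i 1) x" for x
    by (simp add: character_def * cis_conv_exp)
  show "trig_poly (\<lambda>x. cis (x $ i))"
    using trig_poly_monom[of 1 "axis i 1"] by (simp add: c)
  show "trig_poly (\<lambda>x. cnj (cis (x $ i)))"
    using trig_poly_monom[of 1 "- axis i 1"] by (simp add: c cnj_character)
qed

text \<open>The real and imaginary parts of \<open>cis (x $ i)\<close> are combinations of it and
  its conjugate, and real linear maps on pairs of complex numbers are combinations of these four
  parts; sums and products follow by induction.\<close>

lemma trig_poly_polynomial_function:
  fixes g :: "complex \<times> complex \<Rightarrow> real"
  assumes "real_polynomial_function g"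
  shows "trig_poly (\<lambda>x. complex_of_real (g (cis (x $ 1), cis (x $ 2))))"
  using assms
proof (induction g rule: real_polynomial_function.induct)
  case (linear f)
  have Re: "trig_poly (\<lambda>x. complex_of_real (Re (cis (x $ i))))"
   and Im: "trig_poly (\<lambda>x. complex_of_real (Im (cis (x $ i))))" for i :: 2
  proof -
    have "complex_of_real (Re z) = (1/2) * z + (1/2) * cnj z"
      "complex_of_real (Im z) = (- \<i>/2) * z + (\<i>/2) * cnj z" for z
      by (auto simp: complex_eq_iff)
    then show "trig_poly (\<lambda>x. complex_of_real (Re (cis (x $ i))))"
      "trig_poly (\<lambda>x. complex_of_real (Im (cis (x $ i))))"
      by (auto simp only: intro!: trig_poly_add trig_poly_cmult trig_poly_cis)
  qed
  have lin: "linear f" using linear by (rule bounded_linear.linear)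
  have f: "f (z, w) = f (1, 0) * Re z + (f (\<i>, 0) * Im z + (f (0, 1) * Re w + f (0, \<i>) * Im w))" for z w
  proof -
    have "(z, w) = Re z *\<^sub>R (1, 0) + (Im z *\<^sub>R (\<i>, 0) + (Re w *\<^sub>R (0, 1) + Im w *\<^sub>R (0, \<i>)))"
      by (simp add: complex_eq_iff)
    then have "f (z, w) = f (Re z *\<^sub>R (1, 0) + (Im z *\<^sub>R (\<i>, 0) + (Re w *\<^sub>R (0, 1) + Im w *\<^sub>R (0, \<i>))))"
      by (rule arg_cong[of _ _ f])
    also have "\<dots> = Re z *\<^sub>R f (1, 0) + (Im z *\<^sub>R f (\<i>, 0) + (Re w *\<^sub>R f (0, 1) + Im w *\<^sub>R f (0, \<i>)))"
      by (simp only: linear_add[OF lin] linear_scale[OF lin])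
    finally show ?thesis by (simp add: mult.commute)
  qed
  have "complex_of_real (f (cis (x $ 1), cis (x $ 2)))
      = of_real (f (1, 0)) * of_real (Re (cis (x $ 1))) + (of_real (f (\<i>, 0)) * of_real (Im (cis (x $ 1)))
        + (of_real (f (0, 1)) * of_real (Re (cis (x $ 2))) + of_real (f (0, \<i>)) * of_real (Im (cis (x $ 2)))))" for x :: "real^2"
    by (subst f) (simp only: of_real_add of_real_mult)
  then show ?case
    by (simp only:) (intro trig_poly_add trig_poly_cmult Re Im)
next
  case (const c)
  show ?case by (rule trig_poly_const)
next
  case (add f g)
  then show ?case by (simp add: trig_poly_add)
next
  case (mult f g)
  then show ?case by (simp add: trig_poly_mult)
qed

text \<open>\<open>E\<close> wraps the closed square onto the product of two circles, a compact set
  where Stone-Weierstrass supplies real polynomials in the four real coordinates. Pulled back along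
  \<open>E\<close> they are trigonometric.\<close>

lemma trig_poly_uniform_approx:
  fixes f :: "real^2 \<Rightarrow> real"
  assumes cont: "continuous_on UNIV f" and zero: "\<And>x. x \<notin> torus_cell \<Longrightarrow> f x = 0" and "\<epsilon> > 0"
  obtains p where "trig_poly p" "\<And>x. x \<in> torus_cell \<Longrightarrow> cmod (complex_of_real (f x) - p x) < \<epsilon>"
proof -
  let ?S = "sphere (0::complex) 1 \<times> sphere (0::complex) 1"
  let ?K = "cbox (\<chi> i. - pi) (\<chi> i. pi) :: (real^2) set"
  define E where "E x = (cis (x $ 1), cis (x $ 2))" for x :: "real^2"
  define F where "F zw = f (vector [Arg (fst zw), Arg (snd zw)])" for zw
  have FE: "F (E x) = f x" if "x \<in> ?K" for x
  proof (cases "\<forall>i. x $ i \<noteq> - pi")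
    case True
    then have "- pi < x $ i \<and> x $ i \<le> pi" for i
      using that by (auto simp: mem_box_cart less_le)
    then have "Arg (cis (x $ i)) = x $ i" for i
      by (intro Arg_cis) auto
    then have "vector [Arg (fst (E x)), Arg (snd (E x))] = x"
      by (simp add: E_def vec_eq_iff forall_2)
    then show ?thesis by (simp add: F_def)
  next
    \<comment> \<open>On a face \<open>x $ i = - pi\<close> the argument jumps to \<open>pi\<close>,
      so \<open>F\<close> looks at the opposite face; \<open>f\<close> vanishes on both.\<close>
    case False
    then obtain i where i: "x $ i = - pi" by blast
    have "Arg (cis (- pi)) = pi"
      by (simp add: Arg_eq_pi)
    then have "(vector [Arg (fst (E x)), Arg (snd (E x))] :: real^2) $ i = pi"
      using i exhaust_2[of i] by (auto simp: E_def)
    then have "\<not> (vector [Arg (fst (E x)), Arg (snd (E x))] :: real^2) $ i < pi" by simp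
    then have "vector [Arg (fst (E x)), Arg (snd (E x))] \<notin> torus_cell"
      unfolding mem_torus_cell by blast
    moreover have "\<not> - pi < x $ i" using i by simp
    then have "x \<notin> torus_cell" unfolding mem_torus_cell by blast
    ultimately show ?thesis by (simp add: F_def zero)
  qed
  have ES: "E ` ?K = ?S"
  proof (intro equalityI subsetI)
    fix zw assume zw: "zw \<in> ?S"
    let ?x = "vector [Arg (fst zw), Arg (snd zw)] :: real^2"
    have "?x \<in> ?K"
      using mpi_less_Arg Arg_le_pi by (auto simp: mem_box_cart forall_2 less_imp_le)
    moreover have "cis (Arg z) = z" if "cmod z = 1" for z
      using cis_Arg[of z] that by (cases "z = 0") (auto simp: sgn_eq)
    then have "zw = E ?x"
      using zw by (auto simp: E_def prod_eq_iff)
    ultimately show "zw \<in> E ` ?K" by (rule rev_image_eqI)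
  qed (auto simp: E_def)
  have contE: "continuous_on A E" for A
    unfolding E_def cis_conv_exp by (intro continuous_intros)
  \<comment> \<open>The argument is discontinuous, so continuity of \<open>F\<close> is not
    inherited from its formula. It holds because the torus is a quotient of the square: a closed
    preimage under \<open>F\<close> is the image under \<open>E\<close> of a compact set.\<close>
  have contF: "continuous_on ?S F"
  proof (subst continuous_on_closed_vimage)
    show "closed ?S" by (intro closed_Times closed_sphere)
    show "\<forall>B. closed B \<longrightarrow> closed (F -` B \<inter> ?S)"
    proof (intro allI impI)
      fix B :: "real set" assume "closed B"
      have "F -` B \<inter> ?S = E ` (f -` B \<inter> ?K)"
      proof (intro equalityI subsetI)
        fix y assume "y \<in> F -` B \<inter> ?S"
        then obtain x where "x \<in> ?K" "y = E x" "F y \<in> B" unfolding ES[symmetric] by blast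
        then show "y \<in> E ` (f -` B \<inter> ?K)" by (intro image_eqI[of _ _ x]) (auto simp: FE)
      next
        fix y assume "y \<in> E ` (f -` B \<inter> ?K)"
        then obtain x where "x \<in> ?K" "y = E x" "f x \<in> B" by blast
        then show "y \<in> F -` B \<inter> ?S" unfolding ES[symmetric] by (auto simp: FE)
      qed
      moreover have "compact (f -` B \<inter> ?K)"
        using \<open>closed B\<close> cont continuous_on_closed_vimage[of UNIV f]
        by (intro closed_Int_compact compact_cbox) simp
      ultimately show "closed (F -` B \<inter> ?S)"
        by (simp add: compact_imp_closed compact_continuous_image[OF contE])
    qed
  qed
  have "compact ?S" by (intro compact_Times compact_sphere)
  from Stone_Weierstrass_real_polynomial_function[OF this contF \<open>\<epsilon> > 0\<close>]
  obtain g where g: "real_polynomial_function g" "\<And>x. x \<in> ?S \<Longrightarrow> \<bar>F x - g x\<bar> < \<epsilon>" by blast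
  show thesis
  proof (rule that[OF trig_poly_polynomial_function[OF g(1)]])
    fix x assume "x \<in> torus_cell"
    then have "x \<in> ?K" by (auto simp: mem_torus_cell mem_box_cart less_imp_le)
    then have "F (E x) = f x" "E x \<in> ?S"
      unfolding ES[symmetric] by (rule FE, rule imageI)
    with g(2)[of "E x"] have "\<bar>f x - g (E x)\<bar> < \<epsilon>" by simp
    then show "cmod (complex_of_real (f x) - complex_of_real (g (cis (x $ 1), cis (x $ 2)))) < \<epsilon>"
      unfolding E_def of_real_diff[symmetric] norm_of_real .
  qed
qed

definition trig_approximable :: "(real^2 \<Rightarrow> complex) \<Rightarrow> bool" where
  "trig_approximable F \<longleftrightarrow> F \<in> L2 \<and>
     (\<forall>\<epsilon>>0. \<exists>p. trig_poly p \<and> L2_norm (\<lambda>x. F x - p x * indicator torus_cell x) < \<epsilon>)"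

lemma trig_poly_torus_L2:
  assumes "trig_poly p"
  shows "(\<lambda>x. p x * indicator torus_cell x) \<in> L2"
  using assms
proof (induction p rule: trig_poly.induct)
  case (trig_poly_monom c n)
  show ?case using character_torus_L2[of c n] by (simp add: mult.assoc)
next
  case (trig_poly_add p q)
  then show ?case by (simp add: distrib_right)
qed

lemma trig_approximable_limit:
  assumes "F \<in> L2" "\<And>\<epsilon>. \<epsilon> > 0 \<Longrightarrow> \<exists>G. trig_approximable G \<and> L2_norm (\<lambda>x. F x - G x) < \<epsilon>"
  shows "trig_approximable F"
  unfolding trig_approximable_def
proof (intro conjI allI impI)
  fix \<epsilon> :: real assume "\<epsilon> > 0"
  then obtain G where G: "trig_approximable G" "L2_norm (\<lambda>x. F x - G x) < \<epsilon> / 2"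
    using assms(2)[of "\<epsilon>/2"] by auto
  then obtain p where p: "trig_poly p" "L2_norm (\<lambda>x. G x - p x * indicator torus_cell x) < \<epsilon> / 2"
    using \<open>\<epsilon> > 0\<close> unfolding trig_approximable_def by (meson half_gt_zero)
  have "L2_norm (\<lambda>x. F x - p x * indicator torus_cell x) < \<epsilon>"
    using L2_norm_diff_triangle[OF assms(1) _ trig_poly_torus_L2[OF p(1)], of G] G p
    by (auto simp: trig_approximable_def)
  with p(1) show "\<exists>p. trig_poly p \<and> L2_norm (\<lambda>x. F x - p x * indicator torus_cell x) < \<epsilon>" by blast
qed (rule assms(1))

lemma trig_approximable_add:
  assumes F: "trig_approximable F" and G: "trig_approximable G"
  shows "trig_approximable (\<lambda>x. F x + G x)"
  unfolding trig_approximable_def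
proof (intro conjI allI impI)
  show "(\<lambda>x. F x + G x) \<in> L2" using assms by (auto simp: trig_approximable_def)
  fix \<epsilon> :: real assume "\<epsilon> > 0"
  then have "\<epsilon> / 2 > 0" by simp
  with F obtain p where p: "trig_poly p" "L2_norm (\<lambda>x. F x - p x * indicator torus_cell x) < \<epsilon> / 2"
    unfolding trig_approximable_def by blast
  from G \<open>\<epsilon>/2 > 0\<close> obtain q where q: "trig_poly q" "L2_norm (\<lambda>x. G x - q x * indicator torus_cell x) < \<epsilon> / 2"
    unfolding trig_approximable_def by blast
  have "L2_norm (\<lambda>x. (F x - p x * indicator torus_cell x) + (G x - q x * indicator torus_cell x))
      \<le> L2_norm (\<lambda>x. F x - p x * indicator torus_cell x) + L2_norm (\<lambda>x. G x - q x * indicator torus_cell x)"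
    using assms p(1) q(1) by (intro L2_norm_triangle L2_diff trig_poly_torus_L2) (auto simp: trig_approximable_def)
  then have "L2_norm (\<lambda>x. (F x + G x) - (p x + q x) * indicator torus_cell x) < \<epsilon>"
    using p(2) q(2) by (simp add: algebra_simps)
  then show "\<exists>p. trig_poly p \<and> L2_norm (\<lambda>x. F x + G x - p x * indicator torus_cell x) < \<epsilon>"
    using trig_poly_add[OF p(1) q(1)] by blast
qed

lemma trig_approximable_cmult:
  assumes F: "trig_approximable F"
  shows "trig_approximable (\<lambda>x. c * F x)"
  unfolding trig_approximable_def
proof (intro conjI allI impI)
  show "(\<lambda>x. c * F x) \<in> L2" using assms by (auto simp: trig_approximable_def)
  fix \<epsilon> :: real assume "\<epsilon> > 0"
  then have "\<epsilon> / (cmod c + 1) > 0" by (simp add: add_nonneg_pos)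
  with F obtain p where p: "trig_poly p"
      "L2_norm (\<lambda>x. F x - p x * indicator torus_cell x) < \<epsilon> / (cmod c + 1)"
    unfolding trig_approximable_def by blast
  have "L2_norm (\<lambda>x. c * F x - (c * p x) * indicator torus_cell x)
      = cmod c * L2_norm (\<lambda>x. F x - p x * indicator torus_cell x)"
    by (subst L2_norm_cmult[symmetric]) (simp add: algebra_simps)
  also have "\<dots> \<le> (cmod c + 1) * L2_norm (\<lambda>x. F x - p x * indicator torus_cell x)"
    by (intro mult_right_mono) auto
  also have "\<dots> < \<epsilon>"
    using p(2) by (simp add: pos_less_divide_eq add_nonneg_pos mult.commute)
  finally show "\<exists>p. trig_poly p \<and> L2_norm (\<lambda>x. c * F x - p x * indicator torus_cell x) < \<epsilon>"
    using trig_poly_cmult[OF p(1)] by blast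
qed

lemma trig_approximable_zero: "trig_approximable (\<lambda>x. 0)"
  unfolding trig_approximable_def
  by (auto intro!: exI[of _ "\<lambda>x. 0"] trig_poly_const simp: L2_norm_def)

lemma trig_approximable_sum:
  "(\<And>i. i \<in> I \<Longrightarrow> trig_approximable (F i)) \<Longrightarrow> trig_approximable (\<lambda>x. \<Sum>i\<in>I. F i x)"
  by (induction I rule: infinite_finite_induct) (auto intro: trig_approximable_zero trig_approximable_add)

lemma L2_norm_indicator:
  assumes "S \<in> sets borel" "emeasure lborel S < \<infinity>"
  shows "L2_norm (indicator S) = sqrt (measure lborel S)"
proof -
  have "(\<lambda>x. (cmod (indicator S x))\<^sup>2) = indicator S"
    by (auto split: split_indicator)
  then show ?thesis using assms by (simp add: L2_norm_def)
qed

lemma L2_norm_uniform_bound: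
  assumes "F \<in> borel_measurable borel" "0 \<le> \<delta>"
    and "\<And>x. x \<in> torus_cell \<Longrightarrow> cmod (F x) \<le> \<delta>" "\<And>x. x \<notin> torus_cell \<Longrightarrow> F x = 0"
  shows "F \<in> L2" "L2_norm F \<le> \<delta> * sqrt (measure lborel torus_cell)"
proof -
  have L: "(\<lambda>x. complex_of_real \<delta> * indicator torus_cell x) \<in> L2"
    using emeasure_torus_cell by (intro L2_indicator_const) auto
  have *: "cmod (F x) \<le> cmod (complex_of_real \<delta> * indicator torus_cell x)" for x
    using assms by (cases "x \<in> torus_cell") auto
  show "F \<in> L2" by (rule L2_dominated[OF assms(1) L *])
  have "L2_norm F \<le> L2_norm (\<lambda>x. complex_of_real \<delta> * indicator torus_cell x)"
    by (rule L2_norm_mono[OF assms(1) L *])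
  also have "\<dots> = \<delta> * sqrt (measure lborel torus_cell)"
    using assms(2) emeasure_torus_cell by (subst L2_norm_cmult) (simp add: L2_norm_indicator)
  finally show "L2_norm F \<le> \<delta> * sqrt (measure lborel torus_cell)" .
qed

lemma trig_approximable_continuous:
  fixes f :: "real^2 \<Rightarrow> real"
  assumes cont: "continuous_on UNIV f" and zero: "\<And>x. x \<notin> torus_cell \<Longrightarrow> f x = 0"
    and bound: "\<And>x. \<bar>f x\<bar> \<le> 1"
  shows "trig_approximable (\<lambda>x. complex_of_real (f x))"
  unfolding trig_approximable_def
proof (intro conjI allI impI)
  have [measurable]: "f \<in> borel_measurable borel"
    by (rule borel_measurable_continuous_onI[OF cont])
  show L: "(\<lambda>x. complex_of_real (f x)) \<in> L2"
    by (rule L2_norm_uniform_bound(1)[of _ 1]) (use zero bound in auto)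
  fix \<epsilon> :: real assume "\<epsilon> > 0"
  define \<delta> where "\<delta> = \<epsilon> / (sqrt (measure lborel torus_cell) + 1)"
  have d: "\<delta> > 0" using \<open>\<epsilon> > 0\<close> by (simp add: \<delta>_def add_nonneg_pos)
  obtain p where p: "trig_poly p" "\<And>x. x \<in> torus_cell \<Longrightarrow> cmod (complex_of_real (f x) - p x) < \<delta>"
    using trig_poly_uniform_approx[OF cont zero d] by blast
  have "L2_norm (\<lambda>x. complex_of_real (f x) - p x * indicator torus_cell x) \<le> \<delta> * sqrt (measure lborel torus_cell)"
  proof (rule L2_norm_uniform_bound(2))
    show "(\<lambda>x. complex_of_real (f x) - p x * indicator torus_cell x) \<in> borel_measurable borel"
      using L trig_poly_torus_L2[OF p(1)] by (intro L2_measurable L2_diff)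
  qed (use p(2) d zero in \<open>auto intro: less_imp_le\<close>)
  also have "\<dots> < \<delta> * (sqrt (measure lborel torus_cell) + 1)"
    using d by simp
  also have "\<dots> = \<epsilon>" by (simp add: \<delta>_def add_nonneg_eq_0_iff)
  finally show "\<exists>p. trig_poly p \<and> L2_norm (\<lambda>x. complex_of_real (f x) - p x * indicator torus_cell x) < \<epsilon>"
    using p(1) by blast
qed

lemma trig_approximable_open:
  assumes "open U" "U \<subseteq> torus_cell"
  shows "trig_approximable (indicator U)"
proof (rule trig_approximable_limit)
  have Um: "emeasure lborel U < \<infinity>"
    using emeasure_mono[OF assms(2), of lborel] emeasure_torus_cell by (auto intro: le_less_trans)
  show L: "indicator U \<in> L2"
    using L2_indicator_const[of U 1] Um assms(1) by simp
  \<comment> \<open>These functions tend to the indicator of \<open>U\<close>: a positive distance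
    to the closed complement is eventually multiplied beyond 1.\<close>
  define f where "f k x = min 1 (real k * infdist x (- U))" for k x
  have contf: "continuous_on UNIV (f k)" for k
    unfolding f_def by (intro continuous_intros)
  have fzero: "f k x = 0" if "x \<notin> U" for k x
    using that by (simp add: f_def infdist_zero)
  have fbound: "\<bar>f k x\<bar> \<le> 1" for k x
    by (simp add: f_def infdist_nonneg)
  have [measurable]: "f k \<in> borel_measurable borel" for k
    by (rule borel_measurable_continuous_onI[OF contf])
  have "(\<lambda>k. L2_norm (\<lambda>x. complex_of_real (f k x) - indicator U x)) \<longlonglongrightarrow> 0"
  proof (rule L2_dominated_convergence[OF _ _ L])
    show "cmod (complex_of_real (f k x)) \<le> cmod (indicator U x)" for k x
      using fbound fzero by (auto split: split_indicator)
    fix x show "(\<lambda>k. complex_of_real (f k x)) \<longlonglongrightarrow> indicator U x"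
    proof (cases "x \<in> U")
      case True
      \<comment> \<open>The distance to the empty set is 0 by convention, so the complement has to
        be nonempty; boundedness of the cell ensures it.\<close>
      have "- U \<noteq> {}" using assms(2) bounded_torus_cell bounded_subset not_bounded_UNIV by (metis compl_bot_eq double_compl)
      then have pos: "infdist x (- U) > 0"
        using True assms(1) by (intro infdist_pos_not_in_closed) auto
      then obtain N :: nat where N: "1 / infdist x (- U) \<le> real N" using real_arch_simple by blast
      have "f k x = 1" if "k \<ge> N" for k
      proof -
        have "1 / infdist x (- U) \<le> real k" using N that by linarith
        then have "1 \<le> real k * infdist x (- U)" using pos by (simp add: pos_divide_le_eq)
        then show ?thesis by (simp add: f_def)
      qed
      then show ?thesis using True
        by (intro tendsto_eventually eventually_sequentiallyI[of N]) auto
    qed (simp add: fzero)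
  qed (use assms in auto)
  fix \<epsilon> :: real assume "\<epsilon> > 0"
  from LIMSEQ_D[OF \<open>_ \<longlonglongrightarrow> 0\<close> this]
  obtain k where k: "L2_norm (\<lambda>x. complex_of_real (f k x) - indicator U x) < \<epsilon>" by auto
  have "trig_approximable (\<lambda>x. complex_of_real (f k x))"
    using assms(2) fzero by (intro trig_approximable_continuous contf fbound) blast
  then show "\<exists>G. trig_approximable G \<and> L2_norm (\<lambda>x. indicator U x - G x) < \<epsilon>"
    using k by (auto simp: L2_norm_minus_commute[of "indicator U"])
qed

lemma trig_approximable_borel:
  assumes S: "S \<in> sets borel" "S \<subseteq> torus_cell"
  shows "trig_approximable (indicator S)"
proof (rule trig_approximable_limit)
  have fin: "emeasure lborel T < \<infinity>" if "T \<subseteq> torus_cell" for T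
    using emeasure_mono[OF that, of lborel] emeasure_torus_cell by (auto intro: le_less_trans)
  show "indicator S \<in> L2"
    using L2_indicator_const[of S 1] fin[OF S(2)] S(1) by simp
  fix \<epsilon> :: real assume "\<epsilon> > 0"
  then obtain U where U: "open U" "S \<subseteq> U" "emeasure lborel (U - S) < ennreal (\<epsilon>\<^sup>2)"
    using outer_regular_lborel[OF S(1), of "\<epsilon>\<^sup>2"] by auto
  \<comment> \<open>The open set given by outer regularity may leave the cell. Cutting it back keeps
    it open and still containing \<open>S\<close>.\<close>
  let ?V = "U \<inter> torus_cell"
  have V: "open ?V" "S \<subseteq> ?V" using U S by auto
  have "emeasure lborel (?V - S) \<le> emeasure lborel (U - S)"
    using U S by (intro emeasure_mono) auto
  also have "\<dots> < ennreal (\<epsilon>\<^sup>2)" by (rule U(3))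
  finally have "emeasure lborel (?V - S) < ennreal (\<epsilon>\<^sup>2)" .
  moreover have f: "emeasure lborel (?V - S) < \<infinity>" by (rule fin) auto
  ultimately have m: "measure lborel (?V - S) < \<epsilon>\<^sup>2"
    by (subst (asm) emeasure_eq_ennreal_measure) (auto simp: ennreal_less_iff)
  have "L2_norm (\<lambda>x. indicator S x - indicator ?V x) = L2_norm (\<lambda>x. indicator ?V x - indicator S x)"
    by (rule L2_norm_minus_commute)
  also have "(\<lambda>x. indicator ?V x - indicator S x) = (indicator (?V - S) :: _ \<Rightarrow> complex)"
    using V(2) by (auto simp: fun_eq_iff split: split_indicator)
  also have "L2_norm \<dots> = sqrt (measure lborel (?V - S))"
    using V S f by (intro L2_norm_indicator) auto
  also have "\<dots> < \<epsilon>"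
    using m \<open>\<epsilon> > 0\<close> by (simp add: real_less_lsqrt)
  finally show "\<exists>G. trig_approximable G \<and> L2_norm (\<lambda>x. indicator S x - G x) < \<epsilon>"
    using trig_approximable_open[OF V(1)] by auto
qed

text \<open>Last rung of a ladder: continuous functions vanishing off the cell, indicators of open
  sets, indicators of Borel sets, simple functions, and finally limits of simple functions dominated
  by \<open>2 * F\<close>.\<close>

lemma trig_approximable_L2:
  assumes F: "F \<in> L2" and zero: "\<And>x. x \<notin> torus_cell \<Longrightarrow> F x = 0"
  shows "trig_approximable F"
proof (rule trig_approximable_limit[OF F])
  have [measurable]: "F \<in> borel_measurable borel" using F by (rule L2_measurable)
  obtain s where s: "\<And>i. simple_function lborel (s i)" "\<And>x. (\<lambda>i. s i x) \<longlonglongrightarrow> F x"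
      "\<And>i x. dist (s i x) 0 \<le> 2 * dist (F x) 0"
    using borel_measurable_implies_sequence_metric[of F lborel 0] by auto
  have sm [measurable]: "s i \<in> borel_measurable borel" for i
    using borel_measurable_simple_function[OF s(1)[of i]] by simp
  have "(\<lambda>i. L2_norm (\<lambda>x. s i x - F x)) \<longlonglongrightarrow> 0"
    by (rule L2_dominated_convergence[of _ _ "\<lambda>x. 2 * F x"]) (use s(2,3) F in \<open>auto simp: norm_mult\<close>)
  moreover have "trig_approximable (s i)" for i
  proof -
    have szero: "s i x = 0" if "x \<notin> torus_cell" for x
      using s(3)[of i x] zero[OF that] by simp
    have fin: "finite (range (s i))"
      using s(1)[of i] by (simp add: simple_function_def)
    have "s i x = (\<Sum>y\<in>range (s i) - {0}. y * indicator (s i -` {y}) x)" for x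
    proof -
      have "(\<Sum>y\<in>range (s i) - {0}. y * indicator (s i -` {y}) x)
          = (\<Sum>y\<in>range (s i) - {0}. if y = s i x then y else 0)"
        by (intro sum.cong) (auto split: split_indicator)
      also have "\<dots> = s i x" using fin by (simp add: sum.delta')
      finally show ?thesis by simp
    qed
    then have "s i = (\<lambda>x. \<Sum>y\<in>range (s i) - {0}. y * indicator (s i -` {y}) x)" by blast
    moreover have "trig_approximable (\<lambda>x. \<Sum>y\<in>range (s i) - {0}. y * indicator (s i -` {y}) x)"
    proof (intro trig_approximable_sum trig_approximable_cmult trig_approximable_borel)
      fix y assume "y \<in> range (s i) - {0}"
      then show "s i -` {y} \<subseteq> torus_cell" using szero by force
      show "s i -` {y} \<in> sets borel" using measurable_sets_borel[OF sm, of "{y}"] by auto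
    qed
    ultimately show ?thesis by simp
  qed
  ultimately show "\<exists>G. trig_approximable G \<and> L2_norm (\<lambda>x. F x - G x) < \<epsilon>" if "\<epsilon> > 0" for \<epsilon>
    using LIMSEQ_D[OF _ that] L2_norm_minus_commute[of F] by fastforce
qed

theorem torus_Parseval:
  assumes F: "F \<in> L2" and zero: "\<And>x. x \<notin> torus_cell \<Longrightarrow> F x = 0"
  shows "((\<lambda>n. (cmod (\<integral>x. F x * character n x \<partial>lborel))\<^sup>2) has_sum (2 * pi * L2_norm F)\<^sup>2) UNIV"
proof -
  have "((\<lambda>n. (cmod (L2_inner F (torus_basis n)))\<^sup>2) has_sum (L2_norm F)\<^sup>2) UNIV"
  proof (rule L2_Parseval[OF torus_basis_L2 torus_basis_orthonormal F])
    fix \<epsilon> :: real assume "\<epsilon> > 0"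
    then obtain p where p: "trig_poly p" "L2_norm (\<lambda>x. F x - p x * indicator torus_cell x) < \<epsilon>"
      using trig_approximable_L2[OF assms] unfolding trig_approximable_def by blast
    obtain I a where I: "finite I" "\<And>x. p x = (\<Sum>n\<in>I. a n * character n x)"
      using trig_poly_expand[OF p(1)] by blast
    have "p x * indicator torus_cell x = (\<Sum>n\<in>I. (2 * pi * a n) * torus_basis n x)" for x
      by (simp add: I(2) torus_basis_def sum_distrib_right mult.assoc)
    with p(2) I(1) show "\<exists>I a. finite I \<and> L2_norm (\<lambda>t. F t - (\<Sum>n\<in>I. a n * torus_basis n t)) < \<epsilon>"
      by (intro exI[of _ I] exI[of _ "\<lambda>n. 2 * pi * a n"]) simp
  qed
  \<comment> \<open>The inner product conjugates its second argument; reflecting the index produces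
    the integral against \<open>character n\<close> itself.\<close>
  from has_sum_reindex_bij_betw[of uminus UNIV UNIV, THEN iffD2, OF _ this]
  have "((\<lambda>n. (cmod (L2_inner F (torus_basis (- n))))\<^sup>2) has_sum (L2_norm F)\<^sup>2) UNIV"
    by (auto intro: bij_uminus)
  moreover have "L2_inner F (torus_basis (- n)) = (\<integral>x. F x * character n x \<partial>lborel) / (2 * pi)" for n
  proof -
    have "L2_inner F (torus_basis (- n)) = (\<integral>x. F x * character n x / (2 * pi) \<partial>lborel)"
      unfolding L2_inner_def
      by (intro Bochner_Integration.integral_cong refl)
        (use zero in \<open>auto simp: torus_basis_def cnj_character split: split_indicator\<close>)
    then show ?thesis by simp
  qed
  ultimately have "((\<lambda>n. (cmod (\<integral>x. F x * character n x \<partial>lborel) / (2 * pi))\<^sup>2) has_sum (L2_norm F)\<^sup>2) UNIV"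
    by (simp add: norm_divide norm_mult)
  from has_sum_cmult_right[OF this, of "(2 * pi)\<^sup>2"]
  show ?thesis by (simp add: power_divide power_mult_distrib)
qed

section \<open>Change of variables and periodization\<close>

lemma matrix_inv_inverse:
  fixes M :: "real^'n^'n"
  assumes "det M \<noteq> 0"
  shows "M ** matrix_inv M = mat 1" "matrix_inv M ** M = mat 1"
proof -
  have "\<exists>N. M ** N = mat 1 \<and> N ** M = mat 1"
    using assms by (simp add: invertible_det_nz[symmetric] invertible_def)
  from someI_ex[OF this] show "M ** matrix_inv M = mat 1" "matrix_inv M ** M = mat 1"
    unfolding matrix_inv_def by auto
qed

lemma matrix_mult_matrix_inv:
  fixes M :: "real^'n^'n"
  assumes "det M \<noteq> 0"
  shows "M *v (matrix_inv M *v x) = x" "matrix_inv M *v (M *v x) = x"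
  using matrix_inv_inverse[OF assms] by (simp_all add: matrix_vector_mul_assoc)

lemma borel_measurable_matrix_vector_mult [measurable]: "(*v) (M :: real^2^2) \<in> borel_measurable borel"
  by (intro borel_measurable_continuous_onI linear_continuous_on matrix_vector_mul_linear[THEN linear_conv_bounded_linear[THEN iffD1]])

text \<open>Lebesgue measure is determined by its values on boxes, and the preimage of a box under
  \<open>M\<close> is its image under the inverse, whose volume is divided by
  \<open>\<bar>det M\<bar>\<close>. All change of variable rules below are read off from this
  equality of measures.\<close>

lemma lborel_density_matrix:
  fixes M :: "real^2^2"
  assumes "det M \<noteq> 0"
  shows "lborel = density (distr lborel borel ((*v) M)) (\<lambda>_. ennreal \<bar>det M\<bar>)"
proof (rule lborel_eqI)
  fix l u :: "real^2" assume lu: "\<And>b. b \<in> Basis \<Longrightarrow> l \<bullet> b \<le> u \<bullet> b"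
  let ?N = "matrix_inv M"
  have pre: "(*v) M -` box l u = (*v) ?N ` box l u"
    by (auto simp: matrix_mult_matrix_inv[OF assms] intro!: image_eqI[where x="M *v _"])
  have "det (?N ** M) = 1"
    using assms by (simp add: matrix_inv_inverse)
  then have detN: "\<bar>det ?N\<bar> = 1 / \<bar>det M\<bar>"
    using assms by (simp add: det_mul abs_mult[symmetric] field_simps)
  have bounded: "bounded ((*v) ?N ` box l u)"
    by (intro bounded_linear_image bounded_box) (simp add: linear_linear[symmetric])
  have bs: "(*v) ?N ` box l u \<in> sets borel"
    unfolding pre[symmetric] using measurable_sets_borel[OF borel_measurable_matrix_vector_mult, of "box l u" M] by simp
  have "emeasure (density (distr lborel borel ((*v) M)) (\<lambda>_. ennreal \<bar>det M\<bar>)) (box l u)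
      = ennreal \<bar>det M\<bar> * emeasure lborel ((*v) ?N ` box l u)"
    by (simp add: emeasure_density_const emeasure_distr pre)
  also have "emeasure lborel ((*v) ?N ` box l u) = ennreal (measure lebesgue ((*v) ?N ` box l u))"
    using emeasure_bounded_finite[OF bounded] bs
    by (subst emeasure_eq_ennreal_measure) (auto simp: measure_completion)
  also have "measure lebesgue ((*v) ?N ` box l u) = \<bar>det ?N\<bar> * measure lebesgue (box l u)"
    by (subst measure_linear_image) auto
  also have "ennreal \<bar>det M\<bar> * ennreal (\<bar>det ?N\<bar> * measure lebesgue (box l u)) = ennreal (measure lborel (box l u))"
    unfolding detN using assms by (simp add: measure_completion flip: ennreal_mult)
  also have "\<dots> = (\<Prod>b\<in>Basis. (u - l) \<bullet> b)"
    using lu by (simp add: measure_lborel_box_eq)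
  finally show "emeasure (density (distr lborel borel ((*v) M)) (\<lambda>_. ennreal \<bar>det M\<bar>)) (box l u)
      = (\<Prod>b\<in>Basis. (u - l) \<bullet> b)" .
qed simp

lemma nn_integral_matrix:
  fixes M :: "real^2^2"
  assumes "det M \<noteq> 0" and [measurable]: "u \<in> borel_measurable borel"
  shows "(\<integral>\<^sup>+x. u x \<partial>lborel) = ennreal \<bar>det M\<bar> * (\<integral>\<^sup>+x. u (M *v x) \<partial>lborel)"
  by (subst lborel_density_matrix[OF assms(1)])
    (simp add: nn_integral_density nn_integral_distr nn_integral_cmult)

lemma integrable_matrix:
  fixes M :: "real^2^2" and u :: "real^2 \<Rightarrow> 'a::{banach, second_countable_topology}"
  assumes "det M \<noteq> 0" and [measurable]: "u \<in> borel_measurable borel"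
  shows "integrable lborel u \<longleftrightarrow> integrable lborel (\<lambda>x. u (M *v x))"
proof -
  have "(\<lambda>x. u (M *v x)) \<in> borel_measurable borel" by measurable
  then show ?thesis
    using assms nn_integral_matrix[OF assms(1), of "\<lambda>x. ennreal (norm (u x))"]
    by (auto simp: integrable_iff_bounded ennreal_mult_less_top)
qed

lemma integral_matrix:
  fixes M :: "real^2^2" and u :: "real^2 \<Rightarrow> complex"
  assumes "det M \<noteq> 0" and [measurable]: "u \<in> borel_measurable borel"
  shows "(\<integral>x. u x \<partial>lborel) = \<bar>det M\<bar> * (\<integral>x. u (M *v x) \<partial>lborel)"
  by (subst lborel_density_matrix[OF assms(1)])
    (simp add: integral_density integral_distr scaleR_conv_of_real)

lemma nn_integral_translate:
  fixes c :: "'a::euclidean_space"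
  assumes [measurable]: "u \<in> borel_measurable borel"
  shows "(\<integral>\<^sup>+x. u (x + c) \<partial>lborel) = (\<integral>\<^sup>+x. u x \<partial>lborel)"
proof -
  have "(\<integral>\<^sup>+x. u x \<partial>lborel) = (\<integral>\<^sup>+x. u x \<partial>distr lborel borel ((+) c))"
    by (simp add: lborel_distr_plus)
  also have "\<dots> = (\<integral>\<^sup>+x. u (c + x) \<partial>lborel)"
    by (rule nn_integral_distr) auto
  finally show ?thesis by (simp add: add.commute)
qed

lemma integral_translate:
  fixes c :: "'a::euclidean_space" and u :: "'a \<Rightarrow> complex"
  assumes [measurable]: "u \<in> borel_measurable borel"
  shows "(\<integral>x. u (x + c) \<partial>lborel) = (\<integral>x. u x \<partial>lborel)"
proof -
  have "(\<integral>x. u x \<partial>lborel) = (\<integral>x. u x \<partial>distr lborel borel ((+) c))"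
    by (simp add: lborel_distr_plus)
  also have "\<dots> = (\<integral>x. u (c + x) \<partial>lborel)"
    by (rule integral_distr) auto
  finally show ?thesis by (simp add: add.commute)
qed

section \<open>Periodization over the integer lattice\<close>

text \<open>Half-open, so that its integer translates tile the plane exactly; centred, so that it
  contains a neighbourhood of the origin.\<close>

definition unit_cell :: "(real^2) set" where
  "unit_cell = {x. \<forall>i. - (1/2) \<le> x $ i \<and> x $ i < 1/2}"

lemma sets_unit_cell [measurable, simp]: "unit_cell \<in> sets borel"
proof -
  have "unit_cell = {x \<in> space borel. - (1/2) \<le> x $ 1 \<and> x $ 1 < 1/2 \<and> - (1/2) \<le> x $ 2 \<and> x $ 2 < 1/2}"
    by (auto simp: unit_cell_def forall_2)
  also have "\<dots> \<in> sets borel" by measurable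
  finally show ?thesis .
qed

lemma emeasure_unit_cell: "emeasure lborel unit_cell = 1"
proof (rule antisym)
  let ?a = "\<chi> i. - (1/2) :: real^2" and ?b = "\<chi> i. 1/2 :: real^2"
  have B: "(\<Prod>b\<in>Basis. (?b - ?a) \<bullet> b) = 1"
    by (intro prod.neutral) (auto simp: Basis_vec_def inner_axis)
  have le: "\<And>b. b \<in> Basis \<Longrightarrow> ?a \<bullet> b \<le> ?b \<bullet> b"
    by (auto simp: Basis_vec_def inner_axis)
  have "emeasure lborel unit_cell \<le> emeasure lborel (cbox ?a ?b)"
    by (rule emeasure_mono) (auto simp: unit_cell_def mem_box_cart less_imp_le)
  also have "\<dots> = 1" using emeasure_lborel_cbox[OF le] B by simp
  finally show "emeasure lborel unit_cell \<le> 1" .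
  have "1 = emeasure lborel (box ?a ?b)" using emeasure_lborel_box[OF le] B by simp
  also have "\<dots> \<le> emeasure lborel unit_cell"
    by (rule emeasure_mono) (auto simp: unit_cell_def mem_box_cart less_imp_le)
  finally show "1 \<le> emeasure lborel unit_cell" .
qed

lemma unit_cell_translate_iff:
  "t - rvec l \<in> unit_cell \<longleftrightarrow> l = (\<chi> i. \<lfloor>t $ i + 1/2\<rfloor>)"
proof -
  have "- (1/2) \<le> x - of_int m \<and> x - of_int m < 1/2 \<longleftrightarrow> m = \<lfloor>x + 1/2\<rfloor>" for x :: real and m :: int
    by linarith
  then show ?thesis by (simp add: unit_cell_def vec_eq_iff)
qed

lemma nn_integral_periodize:
  fixes u :: "real^2 \<Rightarrow> ennreal"
  assumes [measurable]: "u \<in> borel_measurable borel"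
  shows "(\<integral>\<^sup>+t. u t \<partial>lborel)
    = (\<integral>\<^sup>+t. (\<integral>\<^sup>+l. u (t + rvec l) \<partial>count_space UNIV) * indicator unit_cell t \<partial>lborel)"
proof -
  have "(\<integral>\<^sup>+t. (\<integral>\<^sup>+l. u (t + rvec l) \<partial>count_space UNIV) * indicator unit_cell t \<partial>lborel)
      = (\<integral>\<^sup>+t. (\<integral>\<^sup>+l. u (t + rvec l) * indicator unit_cell t \<partial>count_space UNIV) \<partial>lborel)"
    by (simp add: nn_integral_multc)
  also have "\<dots> = (\<integral>\<^sup>+l. (\<integral>\<^sup>+t. u (t + rvec l) * indicator unit_cell t \<partial>lborel) \<partial>count_space UNIV)"
    by (rule nn_integral_count_space_nn_integral) auto
  also have "\<dots> = (\<integral>\<^sup>+l. (\<integral>\<^sup>+t. u t * indicator unit_cell (t - rvec l) \<partial>lborel) \<partial>count_space UNIV)"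
  proof (rule nn_integral_cong)
    fix l
    show "(\<integral>\<^sup>+t. u (t + rvec l) * indicator unit_cell t \<partial>lborel)
        = (\<integral>\<^sup>+t. u t * indicator unit_cell (t - rvec l) \<partial>lborel)"
      using nn_integral_translate[of "\<lambda>t. u t * indicator unit_cell (t - rvec l)" "rvec l"] by simp
  qed
  also have "\<dots> = (\<integral>\<^sup>+t. (\<integral>\<^sup>+l. u t * indicator unit_cell (t - rvec l) \<partial>count_space UNIV) \<partial>lborel)"
    by (rule nn_integral_count_space_nn_integral[symmetric]) auto
  also have "\<dots> = (\<integral>\<^sup>+t. u t \<partial>lborel)"
  proof (rule nn_integral_cong)
    fix t
    have "(\<integral>\<^sup>+l. u t * indicator unit_cell (t - rvec l) \<partial>count_space UNIV)
        = (\<integral>\<^sup>+l. u t * indicator {\<chi> i. \<lfloor>t $ i + 1/2\<rfloor>} l \<partial>count_space UNIV)"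
      by (intro nn_integral_cong) (simp add: indicator_def unit_cell_translate_iff)
    also have "\<dots> = u t"
      by (simp add: nn_integral_cmult_indicator)
    finally show "(\<integral>\<^sup>+l. u t * indicator unit_cell (t - rvec l) \<partial>count_space UNIV) = u t" .
  qed
  finally show ?thesis by simp
qed

lemma nn_integral_count_space_has_sum:
  assumes "(f has_sum S) UNIV" "\<And>i. 0 \<le> f i"
  shows "(\<integral>\<^sup>+i. ennreal (f i) \<partial>count_space UNIV) = ennreal S"
proof -
  have "Infinite_Sum.abs_summable_on f UNIV"
    using assms by (auto simp: summable_on_def)
  then have "Infinite_Set_Sum.abs_summable_on f UNIV"
    by (rule abs_summable_equivalent[THEN iffD1])
  then show ?thesis
    using assms by (subst nn_integral_conv_infsetsum) (auto simp: infsetsum_infsum infsumI)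
qed

section \<open>The Fourier transform\<close>

lemma cmod_exp_ii [simp]: "cmod (exp (- (\<i> * complex_of_real r))) = 1"
  by (simp add: norm_exp_eq_Re)

lemma fourier_kernel_measurable [measurable]:
  fixes s :: "real^2"
  shows "(\<lambda>t. exp (- (\<i> * complex_of_real (s \<bullet> t)))) \<in> borel_measurable borel"
  by (intro borel_measurable_continuous_onI continuous_intros)

lemma fourier_kernel_pair_measurable:
  "(\<lambda>p :: (real^2) \<times> (real^2). exp (- (\<i> * complex_of_real (fst p \<bullet> snd p)))) \<in> borel_measurable (lborel \<Otimes>\<^sub>M lborel)"
  "(\<lambda>p :: (real^2) \<times> (real^2). exp (- (\<i> * complex_of_real (fst p \<bullet> snd p)))) \<in> borel_measurable (borel \<Otimes>\<^sub>M lborel)"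
proof -
  have *: "(\<lambda>p :: (real^2) \<times> (real^2). exp (- (\<i> * complex_of_real (fst p \<bullet> snd p)))) \<in> borel_measurable (borel \<Otimes>\<^sub>M borel)"
    unfolding borel_prod by (intro borel_measurable_continuous_onI continuous_intros)
  show "(\<lambda>p :: (real^2) \<times> (real^2). exp (- (\<i> * complex_of_real (fst p \<bullet> snd p)))) \<in> borel_measurable (lborel \<Otimes>\<^sub>M lborel)"
    using * measurable_cong_sets[OF sets_pair_measure_cong[OF sets_lborel sets_lborel] refl] by blast
  show "(\<lambda>p :: (real^2) \<times> (real^2). exp (- (\<i> * complex_of_real (fst p \<bullet> snd p)))) \<in> borel_measurable (borel \<Otimes>\<^sub>M lborel)"
    using * measurable_cong_sets[OF sets_pair_measure_cong[OF refl sets_lborel] refl] by blast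
qed

lemma fourier_integrable:
  fixes s :: "real^2"
  assumes "integrable lborel f"
  shows "integrable lborel (\<lambda>t. exp (- (\<i> * complex_of_real (s \<bullet> t))) * f t)"
proof (rule Bochner_Integration.integrable_bound[OF assms])
  show "(\<lambda>t. exp (- (\<i> * complex_of_real (s \<bullet> t))) * f t) \<in> borel_measurable lborel"
    using borel_measurable_integrable[OF assms] by simp
qed (simp add: norm_mult)

lemma fourier_measurable [measurable]:
  assumes "f \<in> borel_measurable borel"
  shows "fourier_integral f \<in> borel_measurable borel"
proof -
  have [measurable]: "f \<in> borel_measurable lborel" using assms by simp
  note fourier_kernel_pair_measurable(2)[measurable]
  have "(\<lambda>s. \<integral>t. exp (- (\<i> * complex_of_real (s \<bullet> t))) * f t \<partial>lborel) \<in> borel_measurable borel"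
    by (rule lborel.borel_measurable_lebesgue_integral) (simp add: split_beta')
  then show ?thesis
    unfolding fourier_integral_def by (intro borel_measurable_times) auto
qed

lemma fourier_diff:
  assumes "integrable lborel f" "integrable lborel g"
  shows "fourier_integral (\<lambda>t. f t - g t) s = fourier_integral f s - fourier_integral g s"
  using fourier_integrable[OF assms(1), of s] fourier_integrable[OF assms(2), of s]
  by (simp add: fourier_integral_def right_diff_distrib)

lemma fourier_cmult: "fourier_integral (\<lambda>t. c * f t) s = c * fourier_integral f s"
  by (simp add: fourier_integral_def mult.left_commute[of _ c])

text \<open>Fubini, since the kernel is symmetric in its two variables. It supplies the duality on
  which inversion rests.\<close>

lemma fourier_mult_formula:
  assumes u: "integrable lborel u" and w: "integrable lborel w"
  shows "(\<integral>s. fourier_integral u s * w s \<partial>lborel) = (\<integral>t. u t * fourier_integral w t \<partial>lborel)"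
proof -
  let ?k = "\<lambda>s t. exp (- (\<i> * complex_of_real ((s :: real^2) \<bullet> t)))"
  have um [measurable]: "u \<in> borel_measurable lborel" and wm [measurable]: "w \<in> borel_measurable lborel"
    using u w by auto
  note fourier_kernel_pair_measurable(1)[measurable]
  have "integrable (lborel \<Otimes>\<^sub>M lborel) (\<lambda>p. ?k (fst p) (snd p) * (w (fst p) * u (snd p)))"
  proof (rule Bochner_Integration.integrable_bound)
    show "integrable (lborel \<Otimes>\<^sub>M lborel) (\<lambda>(s, t). w s * u t)"
      using u w by (intro lborel_pair.Fubini_integrable)
        (auto simp: norm_mult split_beta')
    show "(\<lambda>p. ?k (fst p) (snd p) * (w (fst p) * u (snd p))) \<in> borel_measurable (lborel \<Otimes>\<^sub>M lborel)"
      by measurable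
  qed (auto simp: norm_mult)
  then have int: "integrable (lborel \<Otimes>\<^sub>M lborel) (\<lambda>(s, t). ?k s t * (w s * u t))"
    by (simp add: split_beta')
  have "(\<integral>s. fourier_integral u s * w s \<partial>lborel)
      = (1 / (2 * pi)) * (\<integral>s. (\<integral>t. ?k s t * (w s * u t) \<partial>lborel) \<partial>lborel)"
    by (simp add: fourier_integral_def mult.assoc mult.left_commute mult.commute flip: integral_mult_right_zero integral_mult_left_zero)
  also have "(\<integral>s. (\<integral>t. ?k s t * (w s * u t) \<partial>lborel) \<partial>lborel)
      = (\<integral>t. (\<integral>s. ?k s t * (w s * u t) \<partial>lborel) \<partial>lborel)"
    by (rule lborel_pair.Fubini_integral[OF int, symmetric])
  also have "(1 / (2 * pi)) * \<dots> = (\<integral>t. u t * fourier_integral w t \<partial>lborel)"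
    by (simp add: fourier_integral_def inner_commute mult.assoc mult.left_commute mult.commute flip: integral_mult_right_zero integral_mult_left_zero)
  finally show ?thesis .
qed

section \<open>Plancherel's theorem\<close>

text \<open>The sum over \<open>\<theta> + rvec l\<close> is the same for every
  \<open>\<theta>\<close>, as modulation leaves the norm of \<open>f\<close> unchanged; averaging
  over a cell of area 1 returns this constant. A support of side \<open>2 * pi\<close> matches
  frequencies of spacing 1.\<close>

lemma fourier_torus_Plancherel:
  assumes f: "f \<in> L2" and zero: "\<And>x. x \<notin> torus_cell \<Longrightarrow> f x = 0"
  shows "(\<integral>\<^sup>+s. ennreal ((cmod (fourier_integral f s))\<^sup>2) \<partial>lborel) = ennreal ((L2_norm f)\<^sup>2)"
proof -
  have [measurable]: "f \<in> borel_measurable borel" using f by (rule L2_measurable)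
  have shift: "((\<lambda>l. (cmod (fourier_integral f (\<theta> + rvec l)))\<^sup>2) has_sum (L2_norm f)\<^sup>2) UNIV" for \<theta>
  proof -
    define F where "F t = exp (- (\<i> * complex_of_real (\<theta> \<bullet> t))) * f t" for t
    have "F \<in> borel_measurable borel" unfolding F_def by measurable
    then have F: "F \<in> L2"
      by (rule L2_dominated[OF _ f]) (auto simp: F_def norm_mult)
    have "L2_norm F = L2_norm f" by (simp add: L2_norm_def F_def norm_mult)
    moreover have "((\<lambda>n. (cmod (\<integral>x. F x * character n x \<partial>lborel))\<^sup>2) has_sum (2 * pi * L2_norm F)\<^sup>2) UNIV"
      by (rule torus_Parseval[OF F]) (simp add: F_def zero)
    ultimately have "((\<lambda>n. (cmod (\<integral>x. F x * character n x \<partial>lborel))\<^sup>2) has_sum (2 * pi * L2_norm f)\<^sup>2) UNIV"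
      by simp
    from has_sum_reindex_bij_betw[of uminus UNIV UNIV, THEN iffD2, OF _ this]
    have "((\<lambda>n. (cmod (\<integral>x. F x * character (- n) x \<partial>lborel))\<^sup>2) has_sum (2 * pi * L2_norm f)\<^sup>2) UNIV"
      by (auto intro: bij_uminus)
    moreover have "fourier_integral f (\<theta> + rvec l) = 1 / (2 * pi) * (\<integral>x. F x * character (- l) x \<partial>lborel)" for l
    proof -
      have e: "exp (- (\<i> * complex_of_real (a + b)))
          = exp (- (\<i> * complex_of_real a)) * exp (- (\<i> * complex_of_real b))" for a b
        unfolding exp_add[symmetric] by (simp add: algebra_simps)
      have "exp (- (\<i> * complex_of_real ((\<theta> + rvec l) \<bullet> x))) * f x = F x * character (- l) x" for x
        unfolding inner_add_left e by (simp add: F_def character_def rvec_minus)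
      then show ?thesis unfolding fourier_integral_def by simp
    qed
    ultimately have "((\<lambda>n. (2 * pi)\<^sup>2 * (cmod (fourier_integral f (\<theta> + rvec n)))\<^sup>2) has_sum (2 * pi * L2_norm f)\<^sup>2) UNIV"
      by (simp add: norm_mult norm_divide power_mult_distrib power_divide)
    from has_sum_cmult_right[OF this, of "1 / (2 * pi)\<^sup>2"] show ?thesis
      by (simp add: power_mult_distrib)
  qed
  have "(\<integral>\<^sup>+s. ennreal ((cmod (fourier_integral f s))\<^sup>2) \<partial>lborel)
      = (\<integral>\<^sup>+\<theta>. (\<integral>\<^sup>+l. ennreal ((cmod (fourier_integral f (\<theta> + rvec l)))\<^sup>2) \<partial>count_space UNIV) * indicator unit_cell \<theta> \<partial>lborel)"
    by (rule nn_integral_periodize) measurable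
  also have "\<dots> = (\<integral>\<^sup>+\<theta>. ennreal ((L2_norm f)\<^sup>2) * indicator unit_cell (\<theta> :: real^2) \<partial>lborel)"
    using nn_integral_count_space_has_sum[OF shift] by simp
  also have "\<dots> = ennreal ((L2_norm f)\<^sup>2)"
    by (simp add: nn_integral_cmult_indicator emeasure_unit_cell)
  finally show ?thesis .
qed

lemma fourier_scale:
  fixes \<rho> :: real
  assumes "f \<in> borel_measurable borel" "\<rho> > 0"
  shows "fourier_integral f s = \<rho>\<^sup>2 * fourier_integral (\<lambda>t. f (\<rho> *\<^sub>R t)) (\<rho> *\<^sub>R s)"
proof -
  have d: "det (mat \<rho> :: real^2^2) = \<rho>\<^sup>2"
    by (simp add: det_2 mat_def power2_eq_square)
  have m: "mat \<rho> *v x = \<rho> *\<^sub>R x" for x :: "real^2"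
    by (simp add: vec_eq_iff matrix_vector_mult_def mat_def if_distrib[of "\<lambda>x. x * _"] cong: if_cong)
  have "(\<integral>t. exp (- (\<i> * complex_of_real (s \<bullet> t))) * f t \<partial>lborel)
      = \<bar>det (mat \<rho> :: real^2^2)\<bar> * (\<integral>t. exp (- (\<i> * complex_of_real (s \<bullet> (mat \<rho> *v t)))) * f (mat \<rho> *v t) \<partial>lborel)"
    using assms by (intro integral_matrix) (auto simp: d)
  then show ?thesis
    unfolding fourier_integral_def d m using assms(2) by simp
qed

lemma fourier_bounded_Plancherel:
  assumes f: "f \<in> L2_bounded"
  shows "fourier_integral f \<in> L2" "L2_norm (fourier_integral f) = L2_norm f"
proof -
  obtain R where R: "\<And>t. t \<notin> cball 0 R \<Longrightarrow> f t = 0" and fL: "f \<in> L2"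
    using f by (auto simp: L2_bounded_def)
  have [measurable]: "f \<in> borel_measurable borel" using fL by (rule L2_measurable)
  \<comment> \<open>Rescaling by this factor puts the support inside the unit ball, which lies in
    the period cell because \<open>pi > 1\<close>; the absolute value keeps the factor positive
    whatever the sign of \<open>R\<close>.\<close>
  define \<rho> where "\<rho> = \<bar>R\<bar> + 1"
  have \<rho>: "\<rho> > 0" "R < \<rho>" by (auto simp: \<rho>_def)
  let ?M = "mat \<rho> :: real^2^2"
  have d: "det ?M = \<rho>\<^sup>2"
    by (simp add: det_2 mat_def power2_eq_square)
  have m: "?M *v x = \<rho> *\<^sub>R x" for x :: "real^2"
    by (simp add: vec_eq_iff matrix_vector_mult_def mat_def if_distrib[of "\<lambda>x. x * _"] cong: if_cong)
  define g where "g t = f (\<rho> *\<^sub>R t)" for t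
  have [measurable]: "g \<in> borel_measurable borel" unfolding g_def by measurable
  have nng: "(\<integral>\<^sup>+t. ennreal ((cmod (f t))\<^sup>2) \<partial>lborel) = ennreal (\<rho>\<^sup>2) * (\<integral>\<^sup>+t. ennreal ((cmod (g t))\<^sup>2) \<partial>lborel)"
    using nn_integral_matrix[of ?M "\<lambda>t. ennreal ((cmod (f t))\<^sup>2)"] \<rho> by (simp add: d m g_def)
  have g: "g \<in> L2"
  proof (rule L2I_nn_integral)
    have "ennreal (\<rho>\<^sup>2) * (\<integral>\<^sup>+t. ennreal ((cmod (g t))\<^sup>2) \<partial>lborel) < \<infinity>"
      unfolding nng[symmetric] L2_nn_integral[OF fL] by simp
    then show "(\<integral>\<^sup>+t. ennreal ((cmod (g t))\<^sup>2) \<partial>lborel) < \<infinity>"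
      using \<rho> by (auto simp: ennreal_mult_less_top)
  qed simp
  have gz: "g x = 0" if "x \<notin> torus_cell" for x
  proof -
    have "\<exists>i. \<not> (- pi < x $ i \<and> x $ i < pi)" using that unfolding mem_torus_cell by simp
    then obtain i where "\<not> (- pi < x $ i \<and> x $ i < pi)" ..
    then have "pi \<le> \<bar>x $ i\<bar>" by linarith
    also have "\<dots> \<le> norm x" by (rule component_le_norm_cart)
    finally have "1 < norm x" using pi_gt3 by linarith
    then have "\<rho> < \<rho> * norm x" using \<rho> by simp
    then have "\<not> \<rho> * norm x \<le> R" using \<rho> by linarith
    then have "\<rho> *\<^sub>R x \<notin> cball 0 R" using \<rho> unfolding mem_cball_0 norm_scaleR by simp
    then show ?thesis unfolding g_def by (rule R)
  qed
  let ?gh = "fourier_integral g"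
  have "(\<integral>\<^sup>+s. ennreal ((cmod (fourier_integral f s))\<^sup>2) \<partial>lborel)
      = ennreal (\<rho>^4) * (\<integral>\<^sup>+s. ennreal ((cmod (?gh (?M *v s)))\<^sup>2) \<partial>lborel)"
  proof -
    have "(cmod (fourier_integral f s))\<^sup>2 = \<rho>^4 * (cmod (?gh (?M *v s)))\<^sup>2" for s
      using fourier_scale[of f \<rho> s] \<rho>
      by (simp add: m g_def[abs_def] norm_mult power_mult_distrib norm_power flip: power_mult)
    then show ?thesis
      by (simp add: ennreal_mult nn_integral_cmult)
  qed
  also have "\<dots> = ennreal (\<rho>\<^sup>2) * (ennreal (\<rho>\<^sup>2) * (\<integral>\<^sup>+s. ennreal ((cmod (?gh (?M *v s)))\<^sup>2) \<partial>lborel))"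
    by (simp add: mult.assoc[symmetric] flip: ennreal_mult)
  also have "ennreal (\<rho>\<^sup>2) * (\<integral>\<^sup>+s. ennreal ((cmod (?gh (?M *v s)))\<^sup>2) \<partial>lborel)
      = (\<integral>\<^sup>+s. ennreal ((cmod (?gh s))\<^sup>2) \<partial>lborel)"
    using nn_integral_matrix[of ?M "\<lambda>s. ennreal ((cmod (?gh s))\<^sup>2)"] \<rho> by (simp add: d)
  also have "\<dots> = (\<integral>\<^sup>+t. ennreal ((cmod (g t))\<^sup>2) \<partial>lborel)"
    using fourier_torus_Plancherel[OF g gz] L2_nn_integral[OF g] by simp
  finally have eq: "(\<integral>\<^sup>+s. ennreal ((cmod (fourier_integral f s))\<^sup>2) \<partial>lborel) = ennreal ((L2_norm f)\<^sup>2)"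
    unfolding nng[symmetric] L2_nn_integral[OF fL] .
  show L: "fourier_integral f \<in> L2"
    by (rule L2I_nn_integral) (simp_all add: eq)
  show "L2_norm (fourier_integral f) = L2_norm f"
    using eq unfolding L2_nn_integral[OF L] by simp
qed

lemma L2_truncate_bounded:
  assumes "f \<in> L2"
  shows "(\<lambda>t. f t * indicator (cball 0 R) t) \<in> L2_bounded"
  unfolding L2_bounded_def using assms by (auto intro!: L2_indicator exI[of _ R])

lemma
  assumes f: "f \<in> L2" and fi: "integrable lborel f"
  shows fourier_L2: "fourier_integral f \<in> L2"
    and Plancherel: "L2_norm (fourier_integral f) = L2_norm f"
proof -
  have trunc: "fourier_integral f \<in> L2 \<and> L2_norm (fourier_integral f) \<le> L2_norm f"
    if f: "f \<in> L2" and fi: "integrable lborel f" for f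
  proof -
    have [measurable]: "f \<in> borel_measurable borel" using f by (rule L2_measurable)
    define F where "F k t = f t * indicator (cball 0 (real k)) t" for k t
    have F: "F k \<in> L2_bounded" for k
      unfolding F_def using f by (rule L2_truncate_bounded)
    have [measurable]: "F k \<in> borel_measurable borel" for k
      using L2_bounded_imp_L2[OF F] by (rule L2_measurable)
    have lim: "(\<lambda>k. fourier_integral (F k) s) \<longlonglongrightarrow> fourier_integral f s" for s
      unfolding fourier_integral_def
    proof (intro tendsto_mult_left integral_dominated_convergence[where w="\<lambda>t. cmod (f t)"] AE_I2)
      fix t :: "real^2"
      obtain N :: nat where "norm t \<le> real N" using real_arch_simple by blast
      then have "\<forall>\<^sub>F k in sequentially. F k t = f t"
        by (auto simp: eventually_sequentially F_def intro!: exI[of _ N])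
      then show "(\<lambda>k. F k t) \<longlonglongrightarrow> f t"
        by (rule tendsto_eventually)
      show "norm (exp (- (\<i> * complex_of_real (s \<bullet> t))) * F k t) \<le> cmod (f t)" for k
        by (auto simp: norm_mult F_def split: split_indicator)
    qed (use fi in auto)
    have le: "L2_norm (fourier_integral (F k)) \<le> L2_norm f" for k
      unfolding fourier_bounded_Plancherel(2)[OF F]
      by (rule L2_norm_mono[OF _ f]) (auto simp: F_def split: split_indicator)
    show ?thesis
      using L2_Fatou[of "\<lambda>k. fourier_integral (F k)" "fourier_integral f" 0 "L2_norm f"]
        fourier_bounded_Plancherel(1)[OF F] lim le by auto
  qed
  show "fourier_integral f \<in> L2" using trunc[OF f fi] by simp
  define F where "F k t = f t * indicator (cball 0 (real k)) t" for k t
  have F: "F k \<in> L2_bounded" for k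
    unfolding F_def using f by (rule L2_truncate_bounded)
  have FL: "F k \<in> L2" for k using F by (rule L2_bounded_imp_L2)
  have Fi: "integrable lborel (F k)" for k
    by (rule L2_bounded_support_integrable[where R="real k", OF FL]) (simp add: F_def)
  have conv: "(\<lambda>k. L2_norm (\<lambda>t. F k t - f t)) \<longlonglongrightarrow> 0"
    unfolding F_def by (rule L2_truncate_tendsto[OF f])
  have "(\<lambda>k. L2_norm (\<lambda>s. fourier_integral (F k) s - fourier_integral f s)) \<longlonglongrightarrow> 0"
  proof (rule Lim_null_comparison[OF _ conv], intro always_eventually allI)
    fix k
    have "(\<lambda>s. fourier_integral (F k) s - fourier_integral f s) = fourier_integral (\<lambda>t. F k t - f t)"
      using fourier_diff[OF Fi fi] by auto
    then show "norm (L2_norm (\<lambda>s. fourier_integral (F k) s - fourier_integral f s)) \<le> L2_norm (\<lambda>t. F k t - f t)"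
      using trunc[of "\<lambda>t. F k t - f t"] FL f Fi fi by auto
  qed
  then have "(\<lambda>k. L2_norm (fourier_integral (F k))) \<longlonglongrightarrow> L2_norm (fourier_integral f)"
    using trunc[OF f fi] fourier_bounded_Plancherel(1)[OF F] by (intro L2_norm_tendsto) auto
  moreover have "(\<lambda>k. L2_norm (F k)) \<longlonglongrightarrow> L2_norm f"
    by (rule L2_norm_tendsto[OF FL f conv])
  ultimately show "L2_norm (fourier_integral f) = L2_norm f"
    unfolding fourier_bounded_Plancherel(2)[OF F] by (rule LIMSEQ_unique)
qed

lemma L2_Re_inner:
  assumes "f \<in> L2" "g \<in> L2"
  shows "2 * Re (L2_inner f g) = (L2_norm f)\<^sup>2 + (L2_norm g)\<^sup>2 - (L2_norm (\<lambda>t. f t - g t))\<^sup>2"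
  using L2_norm_diff_sq[OF assms] by simp

lemma fourier_inner:
  assumes f: "f \<in> L2" "integrable lborel f" and g: "g \<in> L2" "integrable lborel g"
  shows "L2_inner (fourier_integral f) (fourier_integral g) = L2_inner f g"
proof -
  have Re: "Re (L2_inner (fourier_integral f) (fourier_integral g)) = Re (L2_inner f g)"
    if g: "g \<in> L2" "integrable lborel g" for g
  proof -
    have "(\<lambda>s. fourier_integral f s - fourier_integral g s) = fourier_integral (\<lambda>t. f t - g t)"
      using fourier_diff[OF f(2) g(2)] by auto
    then have "2 * Re (L2_inner (fourier_integral f) (fourier_integral g)) = 2 * Re (L2_inner f g)"
      using f g by (simp add: L2_Re_inner fourier_L2 Plancherel)
    then show ?thesis by simp
  qed
  have "Re (L2_inner (fourier_integral f) (fourier_integral (\<lambda>t. \<i> * g t))) = Re (L2_inner f (\<lambda>t. \<i> * g t))"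
    using g by (intro Re) auto
  moreover have "fourier_integral (\<lambda>t. \<i> * g t) = (\<lambda>s. \<i> * fourier_integral g s)"
    using fourier_cmult by auto
  ultimately have "Im (L2_inner (fourier_integral f) (fourier_integral g)) = Im (L2_inner f g)"
    by (simp add: L2_inner_cmult_right)
  with Re[OF g] show ?thesis by (simp add: complex_eq_iff)
qed

lemma has_L2_fourier_exists:
  assumes g: "g \<in> L2"
  shows "\<exists>f. has_L2_fourier f g"
proof -
  define G where "G k s = g s * indicator (cball 0 (real k)) s" for k s
  have G: "G k \<in> L2" for k
    unfolding G_def using L2_truncate_bounded[OF g] by (rule L2_bounded_imp_L2)
  have Gi: "integrable lborel (G k)" for k
    by (rule L2_bounded_support_integrable[where R="real k", OF G]) (simp add: G_def)
  have Gconv: "(\<lambda>k. L2_norm (\<lambda>s. G k s - g s)) \<longlonglongrightarrow> 0"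
    unfolding G_def by (rule L2_truncate_tendsto[OF g])
  define H where "H k t = cnj (fourier_integral (\<lambda>s. cnj (G k s)) t)" for k t
  have Gc: "(\<lambda>s. cnj (G k s)) \<in> L2" "integrable lborel (\<lambda>s. cnj (G k s))" for k
    using G Gi by auto
  have H: "H k \<in> L2" for k
    unfolding H_def using Gc fourier_L2 by auto
  have cnjn: "L2_norm (\<lambda>t. cnj (u t)) = L2_norm u" for u by (simp add: L2_norm_def)
  have Hdiff: "L2_norm (\<lambda>t. H m t - H n t) = L2_norm (\<lambda>s. G m s - G n s)" for m n
  proof -
    have "(\<lambda>t. H m t - H n t) = (\<lambda>t. cnj (fourier_integral (\<lambda>s. cnj (G m s) - cnj (G n s)) t))"
      using fourier_diff[OF Gc(2) Gc(2)] by (simp add: H_def)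
    then have "L2_norm (\<lambda>t. H m t - H n t) = L2_norm (\<lambda>s. cnj (G m s) - cnj (G n s))"
      using Gc by (simp add: cnjn Plancherel)
    also have "\<dots> = L2_norm (\<lambda>s. G m s - G n s)"
      using cnjn[of "\<lambda>s. G m s - G n s"] by simp
    finally show ?thesis .
  qed
  have Hn: "L2_norm (H k) = L2_norm (G k)" for k
    unfolding H_def cnjn Plancherel[OF Gc] ..
  obtain f where f: "f \<in> L2" and Hconv: "(\<lambda>k. L2_norm (\<lambda>t. H k t - f t)) \<longlonglongrightarrow> 0"
  proof (rule L2_complete[OF H])
    fix e :: real assume "e > 0"
    then obtain N where N: "\<And>k. k \<ge> N \<Longrightarrow> L2_norm (\<lambda>s. G k s - g s) < e / 2"
      using LIMSEQ_D[OF Gconv, of "e/2"] by auto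
    have "L2_norm (\<lambda>t. H m t - H n t) < e" if "m \<ge> N" "n \<ge> N" for m n
      unfolding Hdiff
      using L2_norm_diff_triangle[OF G g G, of m n] N[OF that(1)] N[OF that(2)]
        L2_norm_minus_commute[of "G n" g] by linarith
    then show "\<exists>N. \<forall>m\<ge>N. \<forall>n\<ge>N. L2_norm (\<lambda>t. H m t - H n t) < e" by blast
  qed
  define F where "F k t = f t * indicator (cball 0 (real k)) t" for k t
  have F: "F k \<in> L2" for k
    unfolding F_def using L2_truncate_bounded[OF f] by (rule L2_bounded_imp_L2)
  have Fi: "integrable lborel (F k)" for k
    by (rule L2_bounded_support_integrable[where R="real k", OF F]) (simp add: F_def)
  have Fconv: "(\<lambda>k. L2_norm (\<lambda>t. F k t - f t)) \<longlonglongrightarrow> 0"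
    unfolding F_def by (rule L2_truncate_tendsto[OF f])
  have nfg: "L2_norm f = L2_norm g"
    using L2_norm_tendsto[OF H f Hconv] L2_norm_tendsto[OF G g Gconv]
    unfolding Hn by (rule LIMSEQ_unique)
  have inner: "L2_inner (fourier_integral (F k)) g = complex_of_real ((L2_norm (F k))\<^sup>2)" for k
  proof -
    have "L2_inner (fourier_integral (F k)) (G m) = L2_inner (F k) (H m)" for m
      using fourier_mult_formula[OF Fi Gc(2), of k m] by (simp add: L2_inner_def H_def)
    then have "(\<lambda>m. L2_inner (F k) (H m)) \<longlonglongrightarrow> L2_inner (fourier_integral (F k)) g"
      using L2_inner_tendsto_right[OF G g fourier_L2[OF F Fi] Gconv, of k] by simp
    moreover have "(\<lambda>m. L2_inner (F k) (H m)) \<longlonglongrightarrow> L2_inner (F k) f"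
      by (rule L2_inner_tendsto_right[OF H f F Hconv])
    ultimately have "L2_inner (fourier_integral (F k)) g = L2_inner (F k) f"
      by (rule LIMSEQ_unique)
    also have "\<dots> = L2_inner (F k) (F k)"
      unfolding L2_inner_def F_def
      by (intro Bochner_Integration.integral_cong) (auto split: split_indicator)
    finally show ?thesis by (simp add: L2_inner_self)
  qed
  have "(\<lambda>k. sqrt ((L2_norm g)\<^sup>2 - (L2_norm (F k))\<^sup>2)) \<longlonglongrightarrow> sqrt ((L2_norm g)\<^sup>2 - (L2_norm g)\<^sup>2)"
    using L2_norm_tendsto[OF F f Fconv] unfolding nfg by (intro tendsto_intros)
  moreover have "L2_norm (\<lambda>s. fourier_integral (F k) s - g s) = sqrt ((L2_norm g)\<^sup>2 - (L2_norm (F k))\<^sup>2)" for k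
    using L2_norm_diff_sq[OF fourier_L2[OF F Fi] g, of k] Plancherel[OF F Fi, of k]
      real_sqrt_unique[OF _ L2_norm_nonneg]
    by (metis (no_types, lifting) L2_norm_nonneg Re_complex_of_real add.commute add_diff_eq diff_diff_eq2 inner
        mult_2 real_sqrt_unique add_diff_cancel_left')
  ultimately have "(\<lambda>k. L2_norm (\<lambda>s. fourier_integral (F k) s - g s)) \<longlonglongrightarrow> 0" by simp
  then have "has_L2_fourier f g"
    unfolding has_L2_fourier_def using f g F Fi Fconv fourier_L2[OF F Fi]
    by (auto intro!: exI[of _ F] simp: L2_tendsto_iff)
  then show ?thesis by (rule exI[of _ f])
qed

lemma has_L2_fourier_inner:
  assumes fg: "has_L2_fourier f g" and u: "u \<in> L2" "integrable lborel u"
  shows "L2_inner u f = L2_inner (fourier_integral u) g"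
proof -
  have f: "f \<in> L2" and g: "g \<in> L2" using fg by (auto simp: has_L2_fourier_def)
  obtain F where F: "\<And>k. F k \<in> L2" "\<And>k. integrable lborel (F k)"
    and conv: "L2_tendsto F f" "L2_tendsto (\<lambda>k. fourier_integral (F k)) g"
    using fg by (auto simp: has_L2_fourier_def)
  have "(\<lambda>k. L2_inner u (F k)) \<longlonglongrightarrow> L2_inner u f"
    using conv(1) unfolding L2_tendsto_iff[OF F(1) f] by (rule L2_inner_tendsto_right[OF F(1) f u(1)])
  moreover have "(\<lambda>k. L2_inner (fourier_integral u) (fourier_integral (F k))) \<longlonglongrightarrow> L2_inner (fourier_integral u) g"
    using conv(2) unfolding L2_tendsto_iff[OF fourier_L2[OF F] g]
    by (rule L2_inner_tendsto_right[OF fourier_L2[OF F] g fourier_L2[OF u]])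
  ultimately show ?thesis
    unfolding fourier_inner[OF u F] by (rule LIMSEQ_unique)
qed

lemma L2_fourier_inv: "g \<in> L2 \<Longrightarrow> has_L2_fourier (L2_fourier_inv g) g"
  unfolding L2_fourier_inv_def by (rule someI_ex[OF has_L2_fourier_exists])

section \<open>Expanding integer matrices\<close>

lemma rmat_nth [simp]: "rmat A $ i $ j = of_int (A $ i $ j)"
  by (simp add: rmat_def)

lemma rmat_transpose: "rmat (transpose A) = transpose (rmat A)"
  by (simp add: vec_eq_iff transpose_def)

lemma rvec_matrix_mult: "rvec (A *v n) = rmat A *v rvec n"
  by (simp add: vec_eq_iff matrix_vector_mult_def)

definition expanding :: "real^2^2 \<Rightarrow> bool" where
  "expanding M \<longleftrightarrow> (\<exists>c>0. \<forall>j x. c * sqrt 2 ^ j * norm x \<le> norm (((*v) M ^^ j) x))"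

lemma quadratic_form_nonneg:
  fixes a b c x y :: real
  assumes "0 < a" "b\<^sup>2 \<le> 4 * a * c"
  shows "0 \<le> a * x\<^sup>2 + b * x * y + c * y\<^sup>2"
proof -
  have "4 * a * (a * x\<^sup>2 + b * x * y + c * y\<^sup>2) = (2 * a * x + b * y)\<^sup>2 + (4 * a * c - b\<^sup>2) * y\<^sup>2"
    by (simp add: power2_eq_square algebra_simps)
  also have "\<dots> \<ge> 0" using assms by (intro add_nonneg_nonneg mult_nonneg_nonneg) auto
  finally show ?thesis using assms by (simp add: zero_le_mult_iff)
qed

lemma norm_sq_2: "(norm (x :: real^2))\<^sup>2 = (x $ 1)\<^sup>2 + (x $ 2)\<^sup>2"
  unfolding power2_norm_eq_inner by (simp add: inner_vec_def sum_2 power2_eq_square)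

text \<open>
  A matrix of determinant 2 with complex eigenvalues multiplies some definite quadratic form by 2,
  hence it is expanding although it need not increase the Euclidean norm.
\<close>

lemma expanding_quadratic_form:
  fixes M :: "real^2^2" and a b c :: real
  defines "Q \<equiv> \<lambda>x :: real^2. a * (x $ 1)\<^sup>2 + b * (x $ 1) * (x $ 2) + c * (x $ 2)\<^sup>2"
  assumes Q: "\<And>x. Q (M *v x) = 2 * Q x"
    and lower: "a > 1/10" "b\<^sup>2 \<le> 4 * (a - 1/10) * (c - 1/10)"
    and upper: "a < 10" "b\<^sup>2 \<le> 4 * (10 - a) * (10 - c)"
  shows "expanding M"
  unfolding expanding_def
proof (intro exI[of _ "1/10"] conjI allI)
  fix j and x :: "real^2"
  have Qj: "Q (((*v) M ^^ j) x) = 2 ^ j * Q x"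
    by (induction j) (simp_all add: Q)
  have lo: "(norm y)\<^sup>2 / 10 \<le> Q y" for y
    using quadratic_form_nonneg[of "a - 1/10" b "c - 1/10" "y $ 1" "y $ 2"] lower
    unfolding norm_sq_2 Q_def by (simp add: algebra_simps)
  have up: "Q y \<le> 10 * (norm y)\<^sup>2" for y
    using quadratic_form_nonneg[of "10 - a" "- b" "10 - c" "y $ 1" "y $ 2"] upper
    unfolding norm_sq_2 Q_def by (simp add: algebra_simps)
  show "1/10 * sqrt 2 ^ j * norm x \<le> norm (((*v) M ^^ j) x)"
  proof (rule power2_le_imp_le)
    have "(1/10 * sqrt 2 ^ j * norm x)\<^sup>2 = 2 ^ j * ((norm x)\<^sup>2 / 10) / 10"
      by (simp add: power_mult_distrib power_divide power_even_eq[symmetric] flip: power_mult)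
        (simp add: power_mult mult.commute[of j])
    also have "\<dots> \<le> 2 ^ j * Q x / 10"
      by (intro divide_right_mono mult_left_mono lo) auto
    also have "\<dots> \<le> (norm (((*v) M ^^ j) x))\<^sup>2"
      using up[of "((*v) M ^^ j) x"] unfolding Qj by simp
    finally show "(1/10 * sqrt 2 ^ j * norm x)\<^sup>2 \<le> (norm (((*v) M ^^ j) x))\<^sup>2" .
  qed simp
qed simp

lemma expanding_inverse:
  assumes "expanding M" "det M \<noteq> 0"
  obtains C where "C > 0" "\<And>j x. norm (((*v) (matrix_inv M) ^^ j) x) \<le> C * (1 / sqrt 2) ^ j * norm x"
proof -
  obtain c where c: "c > 0" "\<And>j x. c * sqrt 2 ^ j * norm x \<le> norm (((*v) M ^^ j) x)"
    using assms(1) by (auto simp: expanding_def)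
  show thesis
  proof (rule that[of "1/c"])
    fix j x
    have inv: "((*v) M ^^ j) (((*v) (matrix_inv M) ^^ j) x) = x" for x
      by (induction j arbitrary: x) (simp_all add: funpow_swap1 matrix_mult_matrix_inv[OF assms(2)])
    show "norm (((*v) (matrix_inv M) ^^ j) x) \<le> 1/c * (1 / sqrt 2) ^ j * norm x"
      using c(2)[of j "((*v) (matrix_inv M) ^^ j) x"] c(1) unfolding inv
      by (simp add: field_simps)
  qed (use c in simp)
qed

lemma matrices_cases:
  assumes "A \<in> matrices_type1 \<union> matrices_type2"
  obtains "A = vector [vector [1, 1], vector [1, -1]]" | "A = vector [vector [1, -3], vector [1, -1]]"
    | "A = vector [vector [1, 1], vector [-1, 1]]" | "A = vector [vector [-1, -1], vector [1, -1]]"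
    | "A = vector [vector [-1, 2], vector [-2, 2]]" | "A = vector [vector [1, -2], vector [2, -2]]"
  using assms unfolding matrices_type1_def matrices_type2_def by blast

lemma det_matrices:
  assumes "A \<in> matrices_type1 \<union> matrices_type2"
  shows "\<bar>det (rmat A)\<bar> = 2"
  using assms by (cases rule: matrices_cases) (simp_all add: det_2)

lemma expanding_matrices:
  assumes "A \<in> matrices_type1 \<union> matrices_type2"
  shows "expanding (rmat A)" "expanding (rmat (transpose A))"
proof -
  note s = matrix_vector_mult_def sum_2 power2_eq_square algebra_simps transpose_def
  from assms show "expanding (rmat A)"
  proof (cases rule: matrices_cases)
    case 1 show ?thesis
      by (rule expanding_quadratic_form[where a=1 and b=0 and c=1]) (simp_all add: 1 s)
  next
    case 2 show ?thesis
      by (rule expanding_quadratic_form[where a=1 and b="-2" and c=3]) (simp_all add: 2 s)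
  next
    case 3 show ?thesis
      by (rule expanding_quadratic_form[where a=1 and b=0 and c=1]) (simp_all add: 3 s)
  next
    case 4 show ?thesis
      by (rule expanding_quadratic_form[where a=1 and b=0 and c=1]) (simp_all add: 4 s)
  next
    case 5 show ?thesis
      by (rule expanding_quadratic_form[where a=2 and b="-3" and c=2]) (simp_all add: 5 s)
  next
    case 6 show ?thesis
      by (rule expanding_quadratic_form[where a=2 and b="-3" and c=2]) (simp_all add: 6 s)
  qed
  from assms show "expanding (rmat (transpose A))"
  proof (cases rule: matrices_cases)
    case 1 show ?thesis
      by (rule expanding_quadratic_form[where a=1 and b=0 and c=1]) (simp_all add: 1 s)
  next
    case 2 show ?thesis
      by (rule expanding_quadratic_form[where a=3 and b=2 and c=1]) (simp_all add: 2 s)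
  next
    case 3 show ?thesis
      by (rule expanding_quadratic_form[where a=1 and b=0 and c=1]) (simp_all add: 3 s)
  next
    case 4 show ?thesis
      by (rule expanding_quadratic_form[where a=1 and b=0 and c=1]) (simp_all add: 4 s)
  next
    case 5 show ?thesis
      by (rule expanding_quadratic_form[where a=2 and b=3 and c=2]) (simp_all add: 5 s)
  next
    case 6 show ?thesis
      by (rule expanding_quadratic_form[where a=2 and b=3 and c=2]) (simp_all add: 6 s)
  qed
qed

lemma range_matrix_eqI:
  fixes M N :: "int^2^2"
  assumes MN: "\<And>n. M *v (N *v n) = 2 *s n" and even: "\<And>n. S n \<Longrightarrow> \<forall>i. even ((N *v n) $ i)"
    and S: "\<And>m. S (M *v m)"
  shows "range ((*v) M) = {n. S n}"
proof (intro equalityI subsetI)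
  fix n assume "n \<in> {n. S n}"
  define m where "m = (\<chi> i. (N *v n) $ i div 2)"
  have "N *v n = 2 *s m"
    using even \<open>n \<in> {n. S n}\<close> by (simp add: vec_eq_iff m_def)
  then have "M *v (2 *s m) = 2 *s n" using MN[of n] by simp
  moreover have "M *v (2 *s m) = 2 *s (M *v m)"
    by (simp add: vec_eq_iff matrix_vector_mult_def sum_2 algebra_simps)
  ultimately have "n = M *v m" by (simp add: vec_eq_iff)
  then show "n \<in> range ((*v) M)" by (rule range_eqI)
qed (use S in auto)

text \<open>All six lattices \<open>A\<int>\<^sup>2\<close> are invariant under transposition of \<open>A\<close>, being given by a parity condition.\<close>

lemma range_matrices_type1:
  assumes "A \<in> matrices_type1"
  shows "range ((*v) A) = {n. even (n $ 1 + n $ 2)}" "range ((*v) (transpose A)) = {n. even (n $ 1 + n $ 2)}"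
proof -
  note s = matrix_vector_mult_def sum_2 vec_eq_iff forall_2 transpose_def
  from assms show "range ((*v) A) = {n. even (n $ 1 + n $ 2)}"
    unfolding matrices_type1_def
  proof (elim insertE emptyE)
    assume A: "A = vector [vector [1, 1], vector [1, -1]]"
    show ?thesis
      by (rule range_matrix_eqI[where N="vector [vector [1, 1], vector [1, -1]]"]) (auto simp: A s)
  next
    assume A: "A = vector [vector [1, -3], vector [1, -1]]"
    show ?thesis
      by (rule range_matrix_eqI[where N="vector [vector [-1, 3], vector [-1, 1]]"]) (auto simp: A s)
  next
    assume A: "A = vector [vector [1, 1], vector [-1, 1]]"
    show ?thesis
      by (rule range_matrix_eqI[where N="vector [vector [1, -1], vector [1, 1]]"]) (auto simp: A s)
  next
    assume A: "A = vector [vector [-1, -1], vector [1, -1]]"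
    show ?thesis
      by (rule range_matrix_eqI[where N="vector [vector [-1, 1], vector [-1, -1]]"]) (auto simp: A s)
  qed
  from assms show "range ((*v) (transpose A)) = {n. even (n $ 1 + n $ 2)}"
    unfolding matrices_type1_def
  proof (elim insertE emptyE)
    assume A: "A = vector [vector [1, 1], vector [1, -1]]"
    show ?thesis
      by (rule range_matrix_eqI[where N="transpose (vector [vector [1, 1], vector [1, -1]])"]) (auto simp: A s)
  next
    assume A: "A = vector [vector [1, -3], vector [1, -1]]"
    show ?thesis
      by (rule range_matrix_eqI[where N="transpose (vector [vector [-1, 3], vector [-1, 1]])"]) (auto simp: A s)
  next
    assume A: "A = vector [vector [1, 1], vector [-1, 1]]"
    show ?thesis
      by (rule range_matrix_eqI[where N="transpose (vector [vector [1, -1], vector [1, 1]])"]) (auto simp: A s)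
  next
    assume A: "A = vector [vector [-1, -1], vector [1, -1]]"
    show ?thesis
      by (rule range_matrix_eqI[where N="transpose (vector [vector [-1, 1], vector [-1, -1]])"]) (auto simp: A s)
  qed
qed

lemma range_matrices_type2:
  assumes "A \<in> matrices_type2"
  shows "range ((*v) A) = {n. even (n $ 2)}" "range ((*v) (transpose A)) = {n. even (n $ 2)}"
proof -
  note s = matrix_vector_mult_def sum_2 vec_eq_iff forall_2 transpose_def
  from assms show "range ((*v) A) = {n. even (n $ 2)}"
    unfolding matrices_type2_def
  proof (elim insertE emptyE)
    assume A: "A = vector [vector [-1, 2], vector [-2, 2]]"
    show ?thesis
      by (rule range_matrix_eqI[where N="vector [vector [2, -2], vector [2, -1]]"]) (auto simp: A s)
  next
    assume A: "A = vector [vector [1, -2], vector [2, -2]]"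
    show ?thesis
      by (rule range_matrix_eqI[where N="vector [vector [-2, 2], vector [-2, 1]]"]) (auto simp: A s)
  qed
  from assms show "range ((*v) (transpose A)) = {n. even (n $ 2)}"
    unfolding matrices_type2_def
  proof (elim insertE emptyE)
    assume A: "A = vector [vector [-1, 2], vector [-2, 2]]"
    show ?thesis
      by (rule range_matrix_eqI[where N="transpose (vector [vector [2, -2], vector [2, -1]])"]) (auto simp: A s)
  next
    assume A: "A = vector [vector [1, -2], vector [2, -2]]"
    show ?thesis
      by (rule range_matrix_eqI[where N="transpose (vector [vector [-2, 2], vector [-2, 1]])"]) (auto simp: A s)
  qed
qed

section \<open>The filter and the scaling function\<close>

locale lawton_filter =
  fixes A :: "int^2^2" and h :: "int^2 \<Rightarrow> complex"
  assumes A: "A \<in> matrices_type1 \<union> matrices_type2"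
    and finitely_supported: "finitely_supported h"
    and lawton: "lawton A h"
begin

abbreviation B :: "real^2^2" where "B \<equiv> rmat (transpose A)"

definition supp :: "(int^2) set" where "supp = {n. h n \<noteq> 0}"

lemma finite_supp: "finite supp"
proof -
  obtain N :: nat where N: "\<And>n. \<not> (\<forall>i. - int N \<le> n $ i \<and> n $ i \<le> int N) \<Longrightarrow> h n = 0"
    using finitely_supported by (auto simp: finitely_supported_def)
  have "supp \<subseteq> (\<lambda>(a, b). vector [a, b]) ` ({- int N..int N} \<times> {- int N..int N})"
  proof
    fix n assume "n \<in> supp"
    then have "\<forall>i. - int N \<le> n $ i \<and> n $ i \<le> int N" using N by (auto simp: supp_def)
    moreover have "n = vector [n $ 1, n $ 2]" by (simp add: vec_eq_iff forall_2)
    ultimately show "n \<in> (\<lambda>(a, b). vector [a, b]) ` ({- int N..int N} \<times> {- int N..int N})"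
      by (intro image_eqI[of _ _ "(n $ 1, n $ 2)"]) auto
  qed
  then show ?thesis by (rule finite_subset) auto
qed

lemma h_outside_supp: "n \<notin> supp \<Longrightarrow> h n = 0"
  by (simp add: supp_def)

lemma infsum_supp: "(\<Sum>\<^sub>\<infinity>n. h n * f n) = (\<Sum>n\<in>supp. h n * f n)"
  by (subst infsum_cong_neutral[of supp UNIV _ "\<lambda>n. h n * f n"]) (auto simp: h_outside_supp finite_supp)

lemma sum_h: "(\<Sum>n\<in>supp. h n) = complex_of_real (sqrt 2)"
  using lawton infsum_supp[of "\<lambda>_. 1"] by (simp add: lawton_def)

lemma det_A: "\<bar>det (rmat A)\<bar> = 2" "det (rmat A) \<noteq> 0"
  using det_matrices[OF A] by auto

lemma det_B: "\<bar>det B\<bar> = 2" "det B \<noteq> 0"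
  using det_A by (auto simp: rmat_transpose det_transpose)

lemma A_mult_inj: "A *v m = A *v n \<longleftrightarrow> m = n"
proof
  assume "A *v m = A *v n"
  then have "rmat A *v rvec m = rmat A *v rvec n" by (simp flip: rvec_matrix_mult)
  then have "rvec m = rvec n" using matrix_mult_matrix_inv(2)[OF det_A(2)] by metis
  then show "m = n" by (simp add: vec_eq_iff)
qed simp

abbreviation lattice :: "(int^2) set" where "lattice \<equiv> range ((*v) A)"

lemma lattice_transpose: "range ((*v) (transpose A)) = lattice"
  using A range_matrices_type1 range_matrices_type2 by blast

lemma lattice_parity:
  obtains "lattice = {n. even (n $ 1 + n $ 2)}" "ell A = vector [1, 0]"
  | "lattice = {n. even (n $ 2)}" "ell A = vector [0, 1]"
proof (cases "A \<in> matrices_type1")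
  case True
  with range_matrices_type1[OF this] that(1) show ?thesis by (simp add: ell_def)
next
  case False
  with A range_matrices_type2[of A] that(2) show ?thesis by (simp add: ell_def)
qed

lemma lattice_diff_iff: "m - n \<in> lattice \<longleftrightarrow> (m \<in> lattice \<longleftrightarrow> n \<in> lattice)"
  by (cases rule: lattice_parity) auto

lemma ell_notin_lattice: "ell A \<notin> lattice"
  by (cases rule: lattice_parity) auto

lemma lawton_sum:
  "(\<Sum>n\<in>supp. h n * cnj (h (n + A *v k))) = (if k = 0 then 1 else 0)"
proof -
  have k: "A *v k \<in> range (\<lambda>n. transpose A *v n)"
    unfolding lattice_transpose by simp
  have "\<forall>k\<in>range (\<lambda>n. transpose A *v n). (\<Sum>n\<in>supp. h n * cnj (h (n + k))) = (if k = 0 then 1 else 0)"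
    using lawton unfolding lawton_def infsum_supp by (rule conjunct1)
  from bspec[OF this k] show ?thesis
    using A_mult_inj[of k 0] by simp
qed

lemma filter_m0_eq: "filter_m0 h t = (1 / sqrt 2) * (\<Sum>n\<in>supp. h n * character (- n) t)"
  unfolding filter_m0_def infsum_supp by (simp add: character_def rvec_minus)

lemma continuous_on_filter_m0 [continuous_intros]: "continuous_on X (filter_m0 h)"
  unfolding filter_m0_eq[abs_def] by (intro continuous_intros)

lemma borel_measurable_filter_m0 [measurable]: "filter_m0 h \<in> borel_measurable borel"
  by (rule borel_measurable_continuous_onI[OF continuous_on_filter_m0])

lemma filter_m0_near_0:
  obtains C where "C \<ge> 0" "\<And>t. cmod (filter_m0 h t - 1) \<le> C * norm t"
proof (rule that)
  let ?C = "(1 / sqrt 2) * (\<Sum>n\<in>supp. cmod (h n) * norm (rvec n))"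
  show "0 \<le> ?C" by (intro mult_nonneg_nonneg sum_nonneg) auto
  fix t :: "real^2"
  have "filter_m0 h t - 1 = (1 / sqrt 2) * (\<Sum>n\<in>supp. h n * (character (- n) t - 1))"
    unfolding filter_m0_eq right_diff_distrib sum_subtractf using sum_h
    by (simp add: right_diff_distrib flip: of_real_mult)
  also have "cmod \<dots> \<le> (1 / sqrt 2) * (\<Sum>n\<in>supp. cmod (h n) * (norm (rvec n) * norm t))"
    unfolding norm_mult
  proof (intro mult_mono order_trans[OF norm_sum] sum_mono)
    fix n
    have "cmod (character (- n) t - 1) \<le> \<bar>rvec (- n) \<bullet> t\<bar>"
      unfolding character_def dist_exp_i_1 using abs_sin_x_le_abs_x[of "rvec (- n) \<bullet> t / 2"] by simp
    also have "\<dots> \<le> norm (rvec n) * norm t"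
      using Cauchy_Schwarz_ineq2[of "rvec (- n)" t] by (simp add: rvec_minus)
    finally show "cmod (h n * (character (- n) t - 1)) \<le> cmod (h n) * (norm (rvec n) * norm t)"
      by (simp add: norm_mult mult_left_mono)
  qed (auto intro: sum_nonneg simp: norm_divide)
  finally show "cmod (filter_m0 h t - 1) \<le> ?C * norm t"
    by (simp add: sum_distrib_right mult.assoc)
qed

end

lemma prod_near_1:
  fixes z :: "nat \<Rightarrow> complex"
  shows "cmod (prod z I - 1) \<le> exp (\<Sum>i\<in>I. cmod (z i - 1)) - 1"
  using norm_prod_minus1_le_prod_minus1[of "\<lambda>i. z i - 1" I] prod_le_exp_sum[of I "\<lambda>i. cmod (z i - 1)"]
  by simp

context lawton_filter
begin

definition contract :: "nat \<Rightarrow> real^2 \<Rightarrow> real^2" where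
  "contract j = (*v) (matrix_inv B) ^^ j"

definition expand :: "nat \<Rightarrow> real^2 \<Rightarrow> real^2" where
  "expand j = (*v) B ^^ j"

lemma contract_0 [simp]: "contract 0 x = x"
  by (simp add: contract_def)

lemma expand_0 [simp]: "expand 0 x = x"
  by (simp add: expand_def)

lemma expand_Suc: "expand (Suc j) x = B *v expand j x"
  by (simp add: expand_def)

lemma expand_Suc': "expand (Suc j) x = expand j (B *v x)"
  by (simp add: expand_def funpow_swap1)

lemma contract_Suc: "contract (Suc j) x = matrix_inv B *v contract j x"
  by (simp add: contract_def)

lemma contract_Suc_B: "contract (Suc j) (B *v x) = contract j x"
  unfolding contract_def funpow_Suc_right by (simp add: matrix_mult_matrix_inv[OF det_B(2)])

lemma contract_expand: "i \<le> j \<Longrightarrow> contract i (expand j x) = expand (j - i) x"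
proof (induction i arbitrary: j)
  case (Suc i)
  then obtain j' where j: "j = Suc j'" by (cases j) auto
  show ?case unfolding j expand_Suc contract_Suc_B using Suc j by simp
qed simp

lemma borel_measurable_contract [measurable]: "contract j \<in> borel_measurable borel"
proof (induction j)
  case (Suc j)
  have "contract (Suc j) = (\<lambda>x. matrix_inv B *v contract j x)" by (auto simp: contract_Suc)
  with Suc show ?case by simp
qed (simp add: contract_def)

lemma borel_measurable_expand [measurable]: "expand j \<in> borel_measurable borel"
proof (induction j)
  case (Suc j)
  have "expand (Suc j) = (\<lambda>x. B *v expand j x)" by (auto simp: expand_Suc)
  with Suc show ?case by simp
qed (simp add: expand_def)

lemma contract_bound: "\<exists>C>0. \<forall>j x. norm (contract j x) \<le> C * (1 / sqrt 2) ^ j * norm x"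
proof (rule expanding_inverse[OF expanding_matrices(2)[OF A] det_B(2)])
  fix C :: real assume "C > 0" "\<And>j x. norm (((*v) (matrix_inv B) ^^ j) x) \<le> C * (1 / sqrt 2) ^ j * norm x"
  then show ?thesis unfolding contract_def by blast
qed

lemma contract_tendsto: "(\<lambda>j. contract j x) \<longlonglongrightarrow> 0"
proof -
  obtain C where C: "\<And>j x. norm (contract j x) \<le> C * (1 / sqrt 2) ^ j * norm x"
    using contract_bound by blast
  have "(\<lambda>j. (1 / sqrt 2) ^ j) \<longlonglongrightarrow> (0::real)"
    by (rule LIMSEQ_power_zero) (simp add: real_less_lsqrt)
  then have "(\<lambda>j. C * (1 / sqrt 2) ^ j * norm x) \<longlonglongrightarrow> 0"
    by (intro tendsto_mult_left_zero tendsto_mult_right_zero)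
  then show ?thesis by (rule Lim_null_comparison[rotated]) (simp add: C)
qed

lemma nn_integral_expand:
  assumes [measurable]: "u \<in> borel_measurable borel"
  shows "(\<integral>\<^sup>+x. u x \<partial>lborel) = 2 ^ j * (\<integral>\<^sup>+x. u (expand j x) \<partial>lborel)"
proof (induction j)
  case (Suc j)
  have "(\<integral>\<^sup>+x. u (expand j x) \<partial>lborel) = 2 * (\<integral>\<^sup>+x. u (expand (Suc j) x) \<partial>lborel)"
    unfolding expand_Suc' by (subst nn_integral_matrix[OF det_B(2)]) (simp_all add: det_B)
  with Suc show ?case by (simp add: mult_ac)
qed simp

definition scaling_prod :: "real^2 \<Rightarrow> complex" where
  "scaling_prod x = prodinf (\<lambda>j. filter_m0 h (contract (Suc j) x))"

lemma scaling_hat_eq: "scaling_hat A h x = (1 / (2 * pi)) * scaling_prod x"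
  by (simp add: scaling_hat_def scaling_prod_def contract_def rmat_transpose)

lemma filter_sum_bound:
  "\<exists>K\<ge>0. \<forall>x. summable (\<lambda>j. cmod (filter_m0 h (contract (Suc j) x) - 1)) \<and>
    (\<forall>n. (\<Sum>j<n. cmod (filter_m0 h (contract (Suc j) x) - 1)) \<le> K * norm x)"
proof -
  obtain C where C: "C > 0" "\<And>j x. norm (contract j x) \<le> C * (1 / sqrt 2) ^ j * norm x"
    using contract_bound by blast
  obtain L where L: "L \<ge> 0" "\<And>t. cmod (filter_m0 h t - 1) \<le> L * norm t"
    using filter_m0_near_0 by blast
  have le: "cmod (filter_m0 h (contract (Suc j) x) - 1) \<le> L * C * norm x * (1 / sqrt 2) ^ j" for j x
  proof -
    have "cmod (filter_m0 h (contract (Suc j) x) - 1) \<le> L * norm (contract (Suc j) x)" by (rule L(2))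
    also have "\<dots> \<le> L * (C * (1 / sqrt 2) ^ Suc j * norm x)"
      by (intro mult_left_mono C L)
    also have "\<dots> \<le> L * (C * (1 / sqrt 2) ^ j * norm x)"
      using C L by (intro mult_left_mono mult_right_mono power_decreasing) (auto simp: real_le_rsqrt)
    finally show ?thesis by (simp add: mult_ac)
  qed
  have geo: "summable (\<lambda>j. (1 / sqrt 2) ^ j)"
    by (rule summable_geometric) (simp add: real_less_lsqrt)
  have summ: "summable (\<lambda>j. cmod (filter_m0 h (contract (Suc j) x) - 1))" for x
    by (rule summable_comparison_test'[OF summable_mult[OF geo, of "L * C * norm x"], of 0]) (use le in auto)
  have "(\<Sum>j<n. cmod (filter_m0 h (contract (Suc j) x) - 1)) \<le> L * C * (\<Sum>j. (1 / sqrt 2) ^ j) * norm x" for x n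
  proof -
    have "(\<Sum>j<n. cmod (filter_m0 h (contract (Suc j) x) - 1)) \<le> (\<Sum>j<n. L * C * norm x * (1 / sqrt 2) ^ j)"
      by (intro sum_mono le)
    also have "\<dots> = L * C * norm x * (\<Sum>j<n. (1 / sqrt 2) ^ j)" by (simp add: sum_distrib_left)
    also have "\<dots> \<le> L * C * norm x * (\<Sum>j. (1 / sqrt 2) ^ j)"
      using C L geo by (intro mult_left_mono sum_le_suminf) auto
    finally show ?thesis by (simp add: mult_ac)
  qed
  moreover have "0 \<le> L * C * (\<Sum>j. (1 / sqrt 2) ^ j)"
    using C L geo by (intro mult_nonneg_nonneg suminf_nonneg) auto
  ultimately show ?thesis using summ by blast
qed

lemma scaling_prod_LIMSEQ:
  "(\<lambda>n. \<Prod>j<n. filter_m0 h (contract (Suc j) x)) \<longlonglongrightarrow> scaling_prod x"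
proof -
  have "summable (\<lambda>j. cmod (filter_m0 h (contract (Suc j) x) - 1))"
    using filter_sum_bound by blast
  then have "abs_convergent_prod (\<lambda>j. filter_m0 h (contract (Suc j) x))"
    by (rule summable_imp_abs_convergent_prod)
  then have "convergent_prod (\<lambda>j. filter_m0 h (contract (Suc j) x))"
    by (rule abs_convergent_prod_imp_convergent_prod)
  from convergent_prod_LIMSEQ[OF this] show ?thesis
    unfolding scaling_prod_def using LIMSEQ_lessThan_iff_atMost[of "prod (\<lambda>j. filter_m0 h (contract (Suc j) x))"] by blast
qed

lemma borel_measurable_scaling_prod [measurable]: "scaling_prod \<in> borel_measurable borel"
  by (rule borel_measurable_LIMSEQ_metric[OF _ scaling_prod_LIMSEQ]) measurable

lemma scaling_prod_refinement: "scaling_prod (B *v x) = filter_m0 h x * scaling_prod x"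
proof (rule LIMSEQ_unique)
  show "(\<lambda>n. \<Prod>j<Suc n. filter_m0 h (contract (Suc j) (B *v x))) \<longlonglongrightarrow> scaling_prod (B *v x)"
    using scaling_prod_LIMSEQ by (rule LIMSEQ_Suc)
  have "(\<Prod>j<Suc n. filter_m0 h (contract (Suc j) (B *v x)))
      = filter_m0 h x * (\<Prod>j<n. filter_m0 h (contract (Suc j) x))" for n
    unfolding prod.lessThan_Suc_shift contract_Suc_B by simp
  then show "(\<lambda>n. \<Prod>j<Suc n. filter_m0 h (contract (Suc j) (B *v x))) \<longlonglongrightarrow> filter_m0 h x * scaling_prod x"
    using tendsto_mult_left[OF scaling_prod_LIMSEQ, of "filter_m0 h x"] by simp
qed

lemma scaling_prod_near_0: "\<exists>K\<ge>0. \<forall>x. cmod (scaling_prod x - 1) \<le> exp (K * norm x) - 1"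
proof -
  obtain K where K: "K \<ge> 0" "\<And>x n. (\<Sum>j<n. cmod (filter_m0 h (contract (Suc j) x) - 1)) \<le> K * norm x"
    using filter_sum_bound by blast
  have "cmod (scaling_prod x - 1) \<le> exp (K * norm x) - 1" for x
  proof (rule LIMSEQ_le_const2)
    show "(\<lambda>n. cmod ((\<Prod>j<n. filter_m0 h (contract (Suc j) x)) - 1)) \<longlonglongrightarrow> cmod (scaling_prod x - 1)"
      by (intro tendsto_intros scaling_prod_LIMSEQ)
    have "cmod ((\<Prod>j<n. filter_m0 h (contract (Suc j) x)) - 1) \<le> exp (K * norm x) - 1" for n
      by (rule order_trans[OF prod_near_1]) (simp add: K(2))
    then show "\<exists>N. \<forall>n\<ge>N. cmod ((\<Prod>j<n. filter_m0 h (contract (Suc j) x)) - 1) \<le> exp (K * norm x) - 1" by blast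
  qed
  with K(1) show ?thesis by blast
qed

lemma scaling_prod_bound: "\<exists>K\<ge>0. \<forall>x. cmod (scaling_prod x) \<le> exp (K * norm x)"
proof -
  obtain K where K: "K \<ge> 0" "\<And>x. cmod (scaling_prod x - 1) \<le> exp (K * norm x) - 1"
    using scaling_prod_near_0 by blast
  have "cmod (scaling_prod x) \<le> exp (K * norm x)" for x
    using norm_triangle_ineq[of "scaling_prod x - 1" 1] K(2)[of x] by simp
  with K(1) show ?thesis by blast
qed

lemma scaling_prod_contract_tendsto: "(\<lambda>j. scaling_prod (contract j x)) \<longlonglongrightarrow> 1"
proof -
  obtain K where "K \<ge> 0" and K: "\<And>x. cmod (scaling_prod x - 1) \<le> exp (K * norm x) - 1"
    using scaling_prod_near_0 by blast
  have "(\<lambda>j. K * norm (contract j x)) \<longlonglongrightarrow> 0"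
    using tendsto_mult_right_zero[OF tendsto_norm_zero[OF contract_tendsto[of x]], of K] .
  from tendsto_diff[OF tendsto_exp[OF this] tendsto_const[of 1]]
  have "(\<lambda>j. exp (K * norm (contract j x)) - 1) \<longlonglongrightarrow> 0" by simp
  then have "(\<lambda>j. scaling_prod (contract j x) - 1) \<longlonglongrightarrow> 0"
    by (rule Lim_null_comparison[rotated]) (simp add: K)
  then show ?thesis by (rule LIM_zero_cancel)
qed

lemma character_expand: "character n (B *v x) = character (A *v n) x"
proof -
  have "rvec n \<bullet> (B *v x) = rvec (A *v n) \<bullet> x"
    by (simp add: inner_vec_def matrix_vector_mult_def sum_2 transpose_def algebra_simps)
  then show ?thesis by (simp add: character_def)
qed

lemma torus_basis_filter:
  "(1 / (2 * pi)) * (character (A *v m) x * (sqrt 2 * filter_m0 h x) * indicator torus_cell x)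
    = (\<Sum>p\<in>supp. h p * torus_basis (A *v m - p) x)"
  unfolding filter_m0_eq torus_basis_def
  by (simp add: sum_distrib_left sum_distrib_right mult_ac character_mult[symmetric] diff_conv_add_uminus
      del: add_uminus_conv_diff)

definition filtered_basis :: "int^2 \<Rightarrow> real^2 \<Rightarrow> complex" where
  "filtered_basis m x = (\<Sum>p\<in>supp. h p * torus_basis (A *v m - p) x)"

lemma filtered_basis_L2: "filtered_basis m \<in> L2"
  unfolding filtered_basis_def by (intro L2_sum L2_cmult torus_basis_L2)

text \<open>Lawton's equations say exactly that the products of the filter with the characters of the lattice are orthonormal.\<close>

lemma filtered_basis_orthonormal: "L2_inner (filtered_basis m) (filtered_basis n) = (if m = n then 1 else 0)"
proof -
  have "L2_inner (filtered_basis m) (filtered_basis n)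
      = (\<Sum>p\<in>supp. h p * (\<Sum>q\<in>supp. cnj (h q) * (if A *v m - p = A *v n - q then 1 else 0)))"
    unfolding filtered_basis_def[abs_def]
    by (subst L2_inner_sum_left)
      (auto simp: L2_inner_sum_right torus_basis_orthonormal intro!: L2_sum L2_cmult)
  also have "\<dots> = (\<Sum>p\<in>supp. h p * cnj (h (p + A *v (n - m))))"
  proof (rule sum.cong[OF refl], rule arg_cong[of _ _ "(*) _"])
    fix p
    have "(\<Sum>q\<in>supp. cnj (h q) * (if A *v m - p = A *v n - q then 1 else 0))
        = (\<Sum>q\<in>supp. if q = p + A *v (n - m) then cnj (h q) else 0)"
      by (intro sum.cong refl) (auto simp: matrix_vector_mult_diff_distrib algebra_simps)
    also have "\<dots> = cnj (h (p + A *v (n - m)))"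
      using finite_supp by (simp add: sum.delta h_outside_supp)
    finally show "(\<Sum>q\<in>supp. cnj (h q) * (if A *v m - p = A *v n - q then 1 else 0))
        = cnj (h (p + A *v (n - m)))" .
  qed
  also have "\<dots> = (if m = n then 1 else 0)"
    unfolding lawton_sum by auto
  finally show ?thesis .
qed

definition filter_prod :: "nat \<Rightarrow> real^2 \<Rightarrow> complex" where
  "filter_prod k x = (\<Prod>i<k. sqrt 2 * filter_m0 h (expand i x))"

lemma filter_prod_Suc: "filter_prod (Suc k) x = sqrt 2 * filter_m0 h x * filter_prod k (B *v x)"
  unfolding filter_prod_def prod.lessThan_Suc_shift expand_Suc' by simp

lemma trig_poly_sum:
  "finite I \<Longrightarrow> trig_poly (\<lambda>x. \<Sum>n\<in>I. a n * character (f n) x)"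
proof (induction I rule: finite_induct)
  case empty
  then show ?case using trig_poly_const[of 0] by simp
next
  case (insert n I)
  then show ?case using trig_poly_add[OF trig_poly_monom] by simp
qed

lemma filter_prod_trig:
  "trig_poly (filter_prod k) \<and> L2_norm (\<lambda>x. filter_prod k x * indicator torus_cell x) = 2 * pi"
proof (induction k)
  case 0
  have eq: "(\<lambda>x. filter_prod 0 x * indicator torus_cell x) = (\<lambda>x. (2 * pi) * torus_basis 0 x)"
    by (auto simp: filter_prod_def torus_basis_def)
  have "L2_norm (torus_basis 0) = 1"
    using L2_norm_orthonormal_sum[of torus_basis "{0}" "\<lambda>_. 1", OF torus_basis_L2 torus_basis_orthonormal]
    by (intro power2_eq_iff_nonneg[THEN iffD1, OF _ zero_le_one, of "L2_norm (torus_basis 0)"]) simp_all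
  then have "L2_norm (\<lambda>x. filter_prod 0 x * indicator torus_cell x) = 2 * pi"
    unfolding eq using L2_norm_cmult[of "2 * pi" "torus_basis 0"] by (simp add: norm_mult)
  moreover have "trig_poly (filter_prod 0)"
    using trig_poly_const[of 1] by (simp add: filter_prod_def[abs_def])
  ultimately show ?case by blast
next
  case (Suc k)
  then have "trig_poly (filter_prod k)" by simp
  from trig_poly_expand[OF this]
  obtain I a where I: "finite I" "\<And>x. filter_prod k x = (\<Sum>n\<in>I. a n * character n x)" by blast
  have step: "filter_prod (Suc k) x = sqrt 2 * filter_m0 h x * (\<Sum>n\<in>I. a n * character (A *v n) x)" for x
    unfolding filter_prod_Suc I(2) character_expand ..
  have "trig_poly (\<lambda>x. (sqrt 2 * ((1 / sqrt 2) * (\<Sum>n\<in>supp. h n * character (- n) x))) * (\<Sum>n\<in>I. a n * character (A *v n) x))"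
    by (intro trig_poly_mult trig_poly_const trig_poly_sum finite_supp I)
  then have trig: "trig_poly (filter_prod (Suc k))"
    unfolding step[abs_def] filter_m0_eq .
  have "(\<lambda>x. filter_prod (Suc k) x * indicator torus_cell x) = (\<lambda>x. \<Sum>n\<in>I. (2 * pi * a n) * filtered_basis n x)"
  proof
    fix x
    have "2 * pi * a n * filtered_basis n x = a n * character (A *v n) x * (sqrt 2 * filter_m0 h x) * indicator torus_cell x" for n
      unfolding filtered_basis_def torus_basis_filter[symmetric] by simp
    then have "(\<Sum>n\<in>I. (2 * pi * a n) * filtered_basis n x)
        = (\<Sum>n\<in>I. a n * character (A *v n) x * (sqrt 2 * filter_m0 h x) * indicator torus_cell x)"
      by (simp only:)
    also have "\<dots> = filter_prod (Suc k) x * indicator torus_cell x"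
      unfolding step by (simp add: sum_distrib_left sum_distrib_right mult_ac)
    finally show "filter_prod (Suc k) x * indicator torus_cell x = (\<Sum>n\<in>I. (2 * pi * a n) * filtered_basis n x)" ..
  qed
  then have "(L2_norm (\<lambda>x. filter_prod (Suc k) x * indicator torus_cell x))\<^sup>2 = (\<Sum>n\<in>I. (cmod (2 * pi * a n))\<^sup>2)"
    using L2_norm_orthonormal_sum[OF filtered_basis_L2 filtered_basis_orthonormal I(1)] by simp
  also have "\<dots> = (L2_norm (\<lambda>x. \<Sum>n\<in>I. (2 * pi * a n) * torus_basis n x))\<^sup>2"
    using L2_norm_orthonormal_sum[OF torus_basis_L2 torus_basis_orthonormal I(1)] by simp
  also have "(\<lambda>x. \<Sum>n\<in>I. (2 * pi * a n) * torus_basis n x) = (\<lambda>x. filter_prod k x * indicator torus_cell x)"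
    by (simp add: I(2) torus_basis_def sum_distrib_left sum_distrib_right mult_ac)
  finally have "L2_norm (\<lambda>x. filter_prod (Suc k) x * indicator torus_cell x)
      = L2_norm (\<lambda>x. filter_prod k x * indicator torus_cell x)"
    by (rule power2_eq_imp_eq) simp_all
  then have "L2_norm (\<lambda>x. filter_prod (Suc k) x * indicator torus_cell x) = 2 * pi"
    using Suc by simp
  with trig show ?case by blast
qed

lemma scaling_prod_L2: "scaling_prod \<in> L2"
proof -
  define F :: "nat \<Rightarrow> real^2 \<Rightarrow> complex" where
    "F k x = (\<Prod>j<k. filter_m0 h (contract (Suc j) x)) * indicator torus_cell (contract k x)" for k x
  have Fm [measurable]: "F k \<in> borel_measurable borel" for k
    unfolding F_def by measurable
  have Fn: "(\<integral>\<^sup>+x. ennreal ((cmod (F k x))\<^sup>2) \<partial>lborel) = ennreal ((2 * pi)\<^sup>2)" for k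
  proof -
    have L: "(\<lambda>x. filter_prod k x * indicator torus_cell x) \<in> L2"
      using filter_prod_trig by (intro trig_poly_torus_L2) blast
    have "2 ^ k * ennreal ((cmod (F k (expand k y)))\<^sup>2)
        = ennreal ((cmod (filter_prod k y * indicator torus_cell y))\<^sup>2)" for y
    proof -
      have "(\<Prod>j<k. filter_m0 h (contract (Suc j) (expand k y))) = (\<Prod>j<k. filter_m0 h (expand (k - Suc j) y))"
        by (intro prod.cong refl) (simp add: contract_expand)
      also have "\<dots> = (\<Prod>i<k. filter_m0 h (expand i y))"
        by (rule prod.nat_diff_reindex)
      finally have eq: "sqrt 2 ^ k * F k (expand k y) = filter_prod k y * indicator torus_cell y"
        by (simp add: F_def filter_prod_def prod.distrib contract_expand)
      have "(sqrt 2 ^ k)\<^sup>2 = 2 ^ k" by (induction k) (auto simp: power_mult_distrib)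
      then have "(cmod (filter_prod k y * indicator torus_cell y))\<^sup>2 = 2 ^ k * (cmod (F k (expand k y)))\<^sup>2"
        unfolding eq[symmetric] by (simp add: norm_mult norm_power power_mult_distrib)
      then show ?thesis by (simp add: ennreal_mult ennreal_power[symmetric])
    qed
    then have "2 ^ k * (\<integral>\<^sup>+y. ennreal ((cmod (F k (expand k y)))\<^sup>2) \<partial>lborel) = ennreal ((2 * pi)\<^sup>2)"
      using L2_nn_integral[OF L] filter_prod_trig[of k] by (simp flip: nn_integral_cmult)
    then show ?thesis
      by (subst nn_integral_expand[where j=k]) simp_all
  qed
  have F: "F k \<in> L2" "L2_norm (F k) \<le> 2 * pi" for k
    using L2_nn_norm_le[OF Fm[of k], of "2 * pi"] Fn by simp_all
  have lim: "(\<lambda>k. F k x) \<longlonglongrightarrow> scaling_prod x" for x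
  proof -
    have "0 \<in> torus_cell" by (simp add: mem_torus_cell)
    then have "\<forall>\<^sub>F k in sequentially. contract k x \<in> torus_cell"
      using topological_tendstoD[OF contract_tendsto open_torus_cell] by blast
    then have "\<forall>\<^sub>F k in sequentially. (\<Prod>j<k. filter_m0 h (contract (Suc j) x)) = F k x"
      by eventually_elim (simp add: F_def)
    with scaling_prod_LIMSEQ show ?thesis by (rule Lim_transform_eventually)
  qed
  show ?thesis
    by (rule L2_Fatou(1)[where F=F and N=0 and c="2 * pi", OF F(1) borel_measurable_scaling_prod AE_I2[OF lim] F(2)])
qed

lemma scaling_hat_L2: "scaling_hat A h \<in> L2"
  unfolding scaling_hat_eq[abs_def] using scaling_prod_L2 by (rule L2_cmult)

lemma scaling_function_fourier: "has_L2_fourier (scaling_function A h) (scaling_hat A h)"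
  unfolding scaling_function_def by (rule L2_fourier_inv[OF scaling_hat_L2])

lemma scaling_function_L2: "scaling_function A h \<in> L2"
  using scaling_function_fourier by (simp add: has_L2_fourier_def)

end

section \<open>The two-channel filter bank\<close>

context lawton_filter
begin

definition highpass :: "int^2 \<Rightarrow> complex" where
  "highpass n = (-1) ^ sigma A n * cnj (h (ell A - n))"

definition supp2 :: "(int^2) set" where
  "supp2 = supp \<union> (\<lambda>n. ell A - n) ` supp"

lemma finite_supp2: "finite supp2"
  by (simp add: supp2_def finite_supp)

lemma supp_subset_supp2: "supp \<subseteq> supp2"
  by (simp add: supp2_def)

lemma h_outside_supp2: "n \<notin> supp2 \<Longrightarrow> h n = 0"
  using supp_subset_supp2 h_outside_supp by blast

lemma highpass_outside_supp2: "n \<notin> supp2 \<Longrightarrow> highpass n = 0"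
proof -
  assume "n \<notin> supp2"
  then have "ell A - n \<notin> supp"
    unfolding supp2_def by (metis (no_types, lifting) UnI2 diff_diff_eq2 add_diff_cancel_left' image_eqI)
  then show ?thesis by (simp add: highpass_def h_outside_supp)
qed

definition gram :: "int^2 \<Rightarrow> int^2 \<Rightarrow> complex" where
  "gram a b = cnj (h a) * h b + cnj (highpass a) * highpass b"

lemma gram_outside: "b \<notin> supp2 \<Longrightarrow> gram a b = 0"
  by (simp add: gram_def h_outside_supp2 highpass_outside_supp2)

lemma highpass_mult:
  "cnj (highpass a) * highpass b
    = (if b - a \<in> lattice then 1 else -1) * (h (ell A - a) * cnj (h (ell A - b)))"
proof -
  have "(-1 :: complex) ^ sigma A a * (-1) ^ sigma A b = (if b - a \<in> lattice then 1 else -1)"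
    by (simp add: sigma_def lattice_diff_iff)
  then show ?thesis by (simp add: highpass_def mult_ac)
qed

lemma sum_supp2_h:
  assumes "\<And>a. a \<notin> supp \<Longrightarrow> f a = 0"
  shows "(\<Sum>a\<in>supp2. f a) = (\<Sum>a\<in>supp. f a)"
  by (rule sum.mono_neutral_right[OF finite_supp2 supp_subset_supp2]) (use assms in auto)

lemma gram_coset_sum:
  "(\<Sum>a\<in>supp2. if n - a \<in> lattice then gram a (a + d) else 0) = (if d = 0 then 1 else 0)"
proof -
  let ?P = "\<lambda>a. n - a \<in> lattice"
  let ?s = "(if d \<in> lattice then 1 else -1) :: complex"
  let ?f = "\<lambda>a. cnj (h a) * h (a + d)"
  have "(\<Sum>a\<in>supp2. if ?P a then gram a (a + d) else 0)
      = (\<Sum>a\<in>supp2. if ?P a then ?f a else 0)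
        + ?s * (\<Sum>a\<in>supp2. if ?P a then h (ell A - a) * cnj (h (ell A - a - d)) else 0)"
    unfolding sum_distrib_left sum.distrib[symmetric]
    by (intro sum.cong refl) (auto simp: gram_def highpass_mult algebra_simps)
  also have "(\<Sum>a\<in>supp2. if ?P a then h (ell A - a) * cnj (h (ell A - a - d)) else 0)
      = (\<Sum>a\<in>supp2. if ?P (ell A - a - d) then ?f a else 0)"
  proof -
    let ?F = "\<lambda>a. if ?P a then h (ell A - a) * cnj (h (ell A - a - d)) else 0"
    let ?G = "\<lambda>a. if ?P (ell A - a - d) then ?f a else 0"
    let ?j = "\<lambda>a. ell A - a - d"
    have FG: "?G (?j a) = ?F a" "?F (?j a) = ?G a" for a
      by (simp_all add: algebra_simps)
    have F: "a \<in> supp2" if "?F a \<noteq> 0" for a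
    proof -
      have "ell A - a \<in> supp" using that h_outside_supp by (auto split: if_splits)
      then have "ell A - (ell A - a) \<in> supp2" unfolding supp2_def by (intro UnI2 imageI)
      then show ?thesis by simp
    qed
    have G: "a \<in> supp2" if "?G a \<noteq> 0" for a
    proof -
      have "a \<in> supp" using that h_outside_supp by (auto split: if_splits)
      then show ?thesis using supp_subset_supp2 by blast
    qed
    show ?thesis
    proof (rule sum.reindex_bij_witness_not_neutral[where i="?j" and j="?j" and S'="{a \<in> supp2. ?F a = 0}" and T'="{a \<in> supp2. ?G a = 0}"])
      fix a assume a: "a \<in> supp2 - {a \<in> supp2. ?F a = 0}"
      then have nz: "?G (?j a) \<noteq> 0" unfolding FG(1) by simp
      show "?j a \<in> supp2 - {a \<in> supp2. ?G a = 0}"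
        using G[OF nz] nz by simp
    next
      fix a show "?G (?j a) = ?F a" by (rule FG(1))
    next
      fix b assume b: "b \<in> supp2 - {a \<in> supp2. ?G a = 0}"
      then have nz: "?F (?j b) \<noteq> 0" unfolding FG(2) by simp
      show "?j b \<in> supp2 - {a \<in> supp2. ?F a = 0}"
        using F[OF nz] nz by simp
    qed (use finite_supp2 in auto)
  qed
  also have "(\<Sum>a\<in>supp2. if ?P a then ?f a else 0) + ?s * \<dots> = (if d = 0 then 1 else 0)"
  proof (cases "d \<in> lattice")
    case False
    then have "?P (ell A - a - d) \<longleftrightarrow> ?P a" for a
      using ell_notin_lattice by (simp add: lattice_diff_iff)
    moreover have "d \<noteq> 0" using False by (metis matrix_vector_mult_0_right rangeI)
    ultimately show ?thesis using False by simp
  next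
    case True
    then have "?P (ell A - a - d) \<longleftrightarrow> \<not> ?P a" for a
      using ell_notin_lattice by (simp add: lattice_diff_iff)
    then have "(\<Sum>a\<in>supp2. if ?P a then ?f a else 0) + ?s * (\<Sum>a\<in>supp2. if ?P (ell A - a - d) then ?f a else 0)
        = (\<Sum>a\<in>supp2. ?f a)"
      using True by (simp add: sum.distrib[symmetric]) (intro sum.cong refl, auto)
    also have "\<dots> = (\<Sum>a\<in>supp. ?f a)"
      by (rule sum_supp2_h) (simp add: h_outside_supp)
    also have "\<dots> = cnj (\<Sum>a\<in>supp. h a * cnj (h (a + d)))"
      by (simp add: mult.commute)
    also have "\<dots> = (if d = 0 then 1 else 0)"
    proof -
      obtain k where k: "d = A *v k" using True by blast
      show ?thesis unfolding k lawton_sum using A_mult_inj[of k 0] by simp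
    qed
    finally show ?thesis .
  qed
  finally show ?thesis .
qed

lemma gram_pointwise:
  "(\<Sum>a\<in>supp2. \<Sum>b\<in>supp2. if n - a \<in> lattice then gram a b * x (b - a) else 0) = x 0"
proof -
  define D where "D = insert 0 ((\<lambda>(a, b). b - a) ` (supp2 \<times> supp2))"
  have D: "finite D" by (simp add: D_def finite_supp2)
  have inner: "(\<Sum>b\<in>supp2. gram a b * x (b - a)) = (\<Sum>d\<in>D. gram a (a + d) * x d)" if "a \<in> supp2" for a
  proof -
    have "(\<Sum>b\<in>supp2. gram a b * x (b - a)) = (\<Sum>d\<in>(\<lambda>b. b - a) ` supp2. gram a (a + d) * x d)"
      by (subst sum.reindex) (auto simp: inj_on_def)
    also have "\<dots> = (\<Sum>d\<in>D. gram a (a + d) * x d)"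
    proof (rule sum.mono_neutral_left[OF D])
      show "(\<lambda>b. b - a) ` supp2 \<subseteq> D" using that by (auto simp: D_def)
      show "\<forall>d\<in>D - (\<lambda>b. b - a) ` supp2. gram a (a + d) * x d = 0"
      proof
        fix d assume d: "d \<in> D - (\<lambda>b. b - a) ` supp2"
        have "a + d \<notin> supp2"
        proof
          assume "a + d \<in> supp2"
          then have "(a + d) - a \<in> (\<lambda>b. b - a) ` supp2" by (rule imageI)
          with d show False by simp
        qed
        then show "gram a (a + d) * x d = 0" by (simp add: gram_outside)
      qed
    qed
    finally show ?thesis .
  qed
  have "(\<Sum>a\<in>supp2. \<Sum>b\<in>supp2. if n - a \<in> lattice then gram a b * x (b - a) else 0)
      = (\<Sum>a\<in>supp2. if n - a \<in> lattice then (\<Sum>d\<in>D. gram a (a + d) * x d) else 0)"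
    by (intro sum.cong refl) (simp add: inner)
  also have "\<dots> = (\<Sum>a\<in>supp2. \<Sum>d\<in>D. x d * (if n - a \<in> lattice then gram a (a + d) else 0))"
    by (intro sum.cong refl) (auto simp: mult.commute)
  also have "\<dots> = (\<Sum>d\<in>D. x d * (\<Sum>a\<in>supp2. if n - a \<in> lattice then gram a (a + d) else 0))"
    unfolding sum_distrib_left by (rule sum.swap)
  also have "\<dots> = (\<Sum>d\<in>D. if d = 0 then x d else 0)"
    unfolding gram_coset_sum by (intro sum.cong) auto
  also have "\<dots> = x 0" using D by (simp add: D_def)
  finally show ?thesis .
qed

definition lowpass_coeff :: "(int^2 \<Rightarrow> complex) \<Rightarrow> int^2 \<Rightarrow> complex" where
  "lowpass_coeff c l = (\<Sum>a\<in>supp2. cnj (h a) * c (a + A *v l))"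

definition highpass_coeff :: "(int^2 \<Rightarrow> complex) \<Rightarrow> int^2 \<Rightarrow> complex" where
  "highpass_coeff c l = (\<Sum>a\<in>supp2. cnj (highpass a) * c (a + A *v l))"

lemma has_sum_sum:
  fixes f :: "'i \<Rightarrow> 'a \<Rightarrow> 'b::topological_comm_monoid_add"
  assumes "finite I" "\<And>i. i \<in> I \<Longrightarrow> (f i has_sum s i) X"
  shows "((\<lambda>x. \<Sum>i\<in>I. f i x) has_sum (\<Sum>i\<in>I. s i)) X"
  using assms by (induction I rule: finite_induct) (auto intro: has_sum_add)

lemma product_summable:
  fixes c d :: "'i \<Rightarrow> complex"
  assumes "(\<lambda>n. (cmod (c n))\<^sup>2) summable_on X" "(\<lambda>n. (cmod (d n))\<^sup>2) summable_on X"
  shows "(\<lambda>n. c n * cnj (d n)) summable_on X"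
proof (rule abs_summable_summable)
  have "(\<lambda>n. (cmod (c n))\<^sup>2 + (cmod (d n))\<^sup>2) summable_on X"
    using assms by (rule summable_on_add)
  moreover have "cmod (c n * cnj (d n)) \<le> (cmod (c n))\<^sup>2 + (cmod (d n))\<^sup>2" for n
    using sum_squares_bound[of "cmod (c n)" "cmod (d n)"]
      mult_nonneg_nonneg[OF norm_ge_zero[of "c n"] norm_ge_zero[of "d n"]]
    unfolding norm_mult complex_mod_cnj by linarith
  ultimately show "(\<lambda>n. norm (c n * cnj (d n))) summable_on X"
    by (intro Infinite_Sum.abs_summable_on_comparison_test'[of "\<lambda>n. (cmod (c n))\<^sup>2 + (cmod (d n))\<^sup>2"]) auto
qed

lemma filter_bank_has_sum:
  assumes c: "((\<lambda>n. (cmod (c n))\<^sup>2) has_sum S) UNIV"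
  shows
    "((\<lambda>l. (cmod (lowpass_coeff c l))\<^sup>2 + (cmod (highpass_coeff c l))\<^sup>2) has_sum S) UNIV"
proof -
  define r where "r a b n = (if n - a \<in> lattice then c n * cnj (c (n + b - a)) else 0)" for a b n
  have summ: "(\<lambda>n. c n * cnj (c (n + b - a))) summable_on X" for a b X
  proof -
    have "bij (\<lambda>n. n + (b - a))" by (rule bij_plus_right)
    then have "(\<lambda>n. (cmod (c (n + b - a)))\<^sup>2) summable_on UNIV"
      using summable_on_reindex_bij_betw[of "\<lambda>n. n + (b - a)" UNIV UNIV "\<lambda>n. (cmod (c n))\<^sup>2"] c
      by (simp add: summable_on_def add_diff_eq) blast
    then have "(\<lambda>n. c n * cnj (c (n + b - a))) summable_on UNIV"
      using c by (intro product_summable) (auto simp: summable_on_def)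
    then show ?thesis by (rule summable_on_subset_banach) simp
  qed
  define R where "R a b = (\<Sum>\<^sub>\<infinity>n\<in>{n. n - a \<in> lattice}. c n * cnj (c (n + b - a)))" for a b
  have r: "(r a b has_sum R a b) UNIV" for a b
    unfolding r_def R_def
    by (subst has_sum_cong_neutral[where S=UNIV and T="{n. n - a \<in> lattice}" and g="\<lambda>n. c n * cnj (c (n + b - a))"])
      (auto intro: has_sum_infsum summ)
  have bij: "bij_betw (\<lambda>l. a + A *v l) UNIV {n. n - a \<in> lattice}" for a
  proof (rule bij_betwI')
    show "(a + A *v l = a + A *v l') = (l = l')" for l l' by (simp add: A_mult_inj)
    fix n assume "n \<in> {n. n - a \<in> lattice}"
    then obtain l where "n - a = A *v l" by blast
    then have "n = a + A *v l" by (simp add: algebra_simps)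
    then show "\<exists>l\<in>UNIV. n = a + A *v l" by blast
  qed auto
  have R: "((\<lambda>l. c (a + A *v l) * cnj (c (b + A *v l))) has_sum R a b) UNIV" for a b
    using has_sum_reindex_bij_betw[OF bij[of a], of "\<lambda>n. c n * cnj (c (n + b - a))" "R a b"]
      has_sum_infsum[OF summ] by (simp add: R_def algebra_simps)
  let ?T = "\<Sum>a\<in>supp2. \<Sum>b\<in>supp2. gram a b * R a b"
  have "((\<lambda>n. \<Sum>a\<in>supp2. \<Sum>b\<in>supp2. gram a b * r a b n) has_sum ?T) UNIV"
    by (intro has_sum_sum has_sum_cmult_right r finite_supp2)
  moreover have "(\<Sum>a\<in>supp2. \<Sum>b\<in>supp2. gram a b * r a b n) = complex_of_real ((cmod (c n))\<^sup>2)" for n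
  proof -
    have "(\<Sum>a\<in>supp2. \<Sum>b\<in>supp2. gram a b * r a b n)
        = (\<Sum>a\<in>supp2. \<Sum>b\<in>supp2. if n - a \<in> lattice then gram a b * (c n * cnj (c (n + (b - a)))) else 0)"
      by (intro sum.cong refl) (simp add: r_def add_diff_eq)
    also have "\<dots> = c n * cnj (c (n + 0))"
      by (rule gram_pointwise)
    finally show ?thesis by (simp add: complex_norm_square del: of_real_power)
  qed
  ultimately have "((\<lambda>n. complex_of_real ((cmod (c n))\<^sup>2)) has_sum ?T) UNIV" by simp
  moreover have "((\<lambda>n. complex_of_real ((cmod (c n))\<^sup>2)) has_sum complex_of_real S) UNIV"
    using c by (rule has_sum_of_real)
  ultimately have T: "?T = complex_of_real S" by (rule has_sum_unique)
  have "((\<lambda>l. \<Sum>a\<in>supp2. \<Sum>b\<in>supp2. gram a b * (c (a + A *v l) * cnj (c (b + A *v l)))) has_sum ?T) UNIV"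
    by (intro has_sum_sum has_sum_cmult_right R finite_supp2)
  moreover have "(\<Sum>a\<in>supp2. \<Sum>b\<in>supp2. gram a b * (c (a + A *v l) * cnj (c (b + A *v l))))
      = complex_of_real ((cmod (lowpass_coeff c l))\<^sup>2 + (cmod (highpass_coeff c l))\<^sup>2)" for l
  proof -
    have "complex_of_real ((cmod (\<Sum>a\<in>supp2. cnj (q a) * c (a + A *v l)))\<^sup>2)
        = (\<Sum>a\<in>supp2. \<Sum>b\<in>supp2. cnj (q a) * q b * (c (a + A *v l) * cnj (c (b + A *v l))))" for q
      unfolding complex_norm_square cnj_sum sum_product
      by (intro sum.cong refl) simp
    then show ?thesis
      unfolding lowpass_coeff_def highpass_coeff_def of_real_add
      by (simp only: sum.distrib[symmetric]) (simp add: gram_def distrib_right)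
  qed
  ultimately have "((\<lambda>l. complex_of_real ((cmod (lowpass_coeff c l))\<^sup>2 + (cmod (highpass_coeff c l))\<^sup>2)) has_sum complex_of_real S) UNIV"
    unfolding T by simp
  then show ?thesis by (simp only: has_sum_of_real_iff)
qed

end

section \<open>Energy of the scaling coefficients\<close>

lemma borel_measurable_dilation [measurable]:
  assumes [measurable]: "f \<in> borel_measurable borel"
  shows "dilation M f \<in> borel_measurable borel"
  unfolding dilation_def[abs_def] by measurable

lemma borel_measurable_translation [measurable]:
  assumes [measurable]: "f \<in> borel_measurable borel"
  shows "translation l f \<in> borel_measurable borel"
  unfolding translation_def[abs_def] by measurable

lemma sqrt_2_mult: "complex_of_real (sqrt 2) * (complex_of_real (sqrt 2) * z) = 2 * z"
proof -
  have "complex_of_real (sqrt 2) * complex_of_real (sqrt 2) = 2"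
    by (simp flip: of_real_mult)
  then show ?thesis by (simp only: mult.assoc[symmetric])
qed

lemma dilation_inner:
  assumes "\<bar>det (rmat M)\<bar> = 2" and [measurable]: "f \<in> borel_measurable borel" "g \<in> borel_measurable borel"
  shows "L2_inner (dilation M f) (dilation M g) = L2_inner f g"
proof -
  have "det (rmat M) \<noteq> 0" using assms(1) by auto
  have "L2_inner f g = 2 * (\<integral>x. f (rmat M *v x) * cnj (g (rmat M *v x)) \<partial>lborel)"
    unfolding L2_inner_def by (subst integral_matrix[OF \<open>det (rmat M) \<noteq> 0\<close>]) (simp_all add: assms(1))
  also have "\<dots> = (\<integral>x. 2 * (f (rmat M *v x) * cnj (g (rmat M *v x))) \<partial>lborel)" by simp
  also have "\<dots> = L2_inner (dilation M f) (dilation M g)"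
  proof -
    have "2 * (a * cnj b) = (sqrt 2 * a) * cnj (sqrt 2 * b)" for a b :: complex
      by (simp add: mult.assoc mult.left_commute[of a] sqrt_2_mult)
    then show ?thesis unfolding L2_inner_def dilation_def by (simp only:)
  qed
  finally show ?thesis ..
qed

lemma dilation_integrable:
  assumes "\<bar>det (rmat M)\<bar> = 2" "integrable lborel f"
  shows "integrable lborel (dilation M f)"
proof -
  have d: "det (rmat M) \<noteq> 0" using assms(1) by auto
  have "f \<in> borel_measurable borel" using assms(2) by auto
  then have "integrable lborel (\<lambda>x. f (rmat M *v x))"
    using integrable_matrix[OF d] assms(2) by blast
  then show ?thesis unfolding dilation_def[abs_def] by simp
qed

lemma dilation_L2:
  assumes "\<bar>det (rmat M)\<bar> = 2" "f \<in> L2"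
  shows "dilation M f \<in> L2"
proof (rule L2I)
  have d: "det (rmat M) \<noteq> 0" using assms(1) by auto
  have [measurable]: "f \<in> borel_measurable borel" using assms(2) by (rule L2_measurable)
  show "dilation M f \<in> borel_measurable borel" by measurable
  have "integrable lborel (\<lambda>x. (cmod (f (rmat M *v x)))\<^sup>2)"
    using integrable_matrix[OF d, of "\<lambda>x. (cmod (f x))\<^sup>2"] L2_integrable[OF assms(2)] by simp
  then show "integrable lborel (\<lambda>x. (cmod (dilation M f x))\<^sup>2)"
    by (simp add: dilation_def norm_mult power_mult_distrib)
qed

lemma dilation_norm:
  assumes "\<bar>det (rmat M)\<bar> = 2" "f \<in> L2"
  shows "L2_norm (dilation M f) = L2_norm f"
proof -
  have "complex_of_real ((L2_norm (dilation M f))\<^sup>2) = complex_of_real ((L2_norm f)\<^sup>2)"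
    unfolding L2_inner_self[symmetric] by (rule dilation_inner[OF assms(1)]) (rule L2_measurable[OF assms(2)])+
  then show ?thesis by (simp only: of_real_eq_iff power2_eq_iff_nonneg L2_norm_nonneg)
qed

lemma translation_inner:
  assumes [measurable]: "f \<in> borel_measurable borel" "g \<in> borel_measurable borel"
  shows "L2_inner (translation l f) (translation l g) = L2_inner f g"
  unfolding L2_inner_def translation_def
  using integral_translate[of "\<lambda>t. f t * cnj (g t)" "- rvec l"] by simp

lemma translation_integrable:
  assumes "integrable lborel f"
  shows "integrable lborel (translation l f)"
proof (rule integrableI_bounded)
  have [measurable]: "f \<in> borel_measurable borel" using assms by auto
  show "translation l f \<in> borel_measurable lborel" by simp
  show "(\<integral>\<^sup>+t. ennreal (norm (translation l f t)) \<partial>lborel) < \<infinity>"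
    using nn_integral_translate[of "\<lambda>t. ennreal (norm (f t))" "- rvec l"] assms
    by (simp add: translation_def integrable_iff_bounded)
qed

lemma translation_L2:
  assumes "f \<in> L2"
  shows "translation l f \<in> L2"
proof (rule L2I_nn_integral)
  have [measurable]: "f \<in> borel_measurable borel" using assms by (rule L2_measurable)
  show "translation l f \<in> borel_measurable borel" by measurable
  show "(\<integral>\<^sup>+t. ennreal ((cmod (translation l f t))\<^sup>2) \<partial>lborel) < \<infinity>"
    using nn_integral_translate[of "\<lambda>t. ennreal ((cmod (f t))\<^sup>2)" "- rvec l"] L2_nn_integral[OF assms]
    by (simp add: translation_def)
qed

lemma translation_translation: "translation l (translation m f) = translation (l + m) f"
  by (simp add: fun_eq_iff translation_def rvec_add algebra_simps)

lemma translation_dilation: "translation l (dilation M f) = dilation M (translation (M *v l) f)"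
  by (simp add: fun_eq_iff translation_def dilation_def rvec_matrix_mult matrix_vector_mult_diff_distrib)

lemma fourier_translation:
  assumes [measurable]: "f \<in> borel_measurable borel"
  shows "fourier_integral (translation l f) s = character (- l) s * fourier_integral f s"
proof -
  let ?u = "\<lambda>t. exp (- (\<i> * complex_of_real (s \<bullet> (t + rvec l)))) * f t"
  have "(\<integral>t. exp (- (\<i> * complex_of_real (s \<bullet> t))) * translation l f t \<partial>lborel) = (\<integral>t. ?u (t + - rvec l) \<partial>lborel)"
    by (simp add: translation_def)
  also have "\<dots> = (\<integral>t. ?u t \<partial>lborel)"
    by (rule integral_translate) measurable
  also have "\<dots> = (\<integral>t. character (- l) s * (exp (- (\<i> * complex_of_real (s \<bullet> t))) * f t) \<partial>lborel)"
  proof (intro Bochner_Integration.integral_cong refl)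
    fix t
    have "exp (- (\<i> * complex_of_real (a + b)))
        = exp (- (\<i> * complex_of_real a)) * exp (- (\<i> * complex_of_real b))" for a b
      unfolding exp_add[symmetric] by (simp add: algebra_simps)
    then show "?u t = character (- l) s * (exp (- (\<i> * complex_of_real (s \<bullet> t))) * f t)"
      unfolding inner_add_right by (simp add: character_def rvec_minus inner_commute)
  qed
  finally show ?thesis by (simp add: fourier_integral_def)
qed

lemma fourier_dilation:
  assumes "\<bar>det (rmat M)\<bar> = 2" and [measurable]: "f \<in> borel_measurable borel"
  shows "dilation (transpose M) (fourier_integral (dilation M f)) = fourier_integral f"
proof
  fix s
  have d: "det (rmat M) \<noteq> 0" using assms(1) by auto
  have dot: "(rmat (transpose M) *v s) \<bullet> t = s \<bullet> (rmat M *v t)" for t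
    by (simp add: rmat_transpose inner_vec_def matrix_vector_mult_def sum_2 transpose_def algebra_simps)
  let ?c = "complex_of_real (1 / (2 * pi))"
  let ?I = "\<integral>t. exp (- (\<i> * complex_of_real (s \<bullet> (rmat M *v t)))) * f (rmat M *v t) \<partial>lborel"
  have "(\<integral>t. exp (- (\<i> * complex_of_real (s \<bullet> t))) * f t \<partial>lborel) = 2 * ?I"
    by (subst integral_matrix[OF d]) (simp_all add: assms(1))
  moreover have "(\<integral>t. exp (- (\<i> * complex_of_real ((rmat (transpose M) *v s) \<bullet> t))) * dilation M f t \<partial>lborel)
      = complex_of_real (sqrt 2) * ?I"
    unfolding dot dilation_def integral_mult_right_zero[symmetric]
    by (intro Bochner_Integration.integral_cong refl) (simp only: mult.left_commute)
  moreover have "complex_of_real (sqrt 2) * (?c * (complex_of_real (sqrt 2) * ?I)) = ?c * (2 * ?I)"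
    by (subst mult.left_commute) (simp only: sqrt_2_mult)
  ultimately show "dilation (transpose M) (fourier_integral (dilation M f)) s = fourier_integral f s"
    unfolding dilation_def[of "transpose M"] fourier_integral_def by (simp only:)
qed

context lawton_filter
begin

abbreviation \<phi> :: "real^2 \<Rightarrow> complex" where "\<phi> \<equiv> scaling_function A h"

definition scaling_hat_mod :: "int^2 \<Rightarrow> real^2 \<Rightarrow> complex" where
  "scaling_hat_mod l s = character (- l) s * scaling_hat A h s"

definition coeff :: "int^2 \<Rightarrow> (real^2 \<Rightarrow> complex) \<Rightarrow> complex" where
  "coeff l F = L2_inner F (scaling_hat_mod l)"

abbreviation E :: "(real^2 \<Rightarrow> complex) \<Rightarrow> real^2 \<Rightarrow> complex" where "E \<equiv> dilation (transpose A)"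

lemma scaling_hat_mod_L2: "scaling_hat_mod l \<in> L2"
proof (rule L2_dominated[OF _ scaling_hat_L2])
  have [measurable]: "scaling_hat A h \<in> borel_measurable borel" by (rule L2_measurable[OF scaling_hat_L2])
  show "scaling_hat_mod l \<in> borel_measurable borel" unfolding scaling_hat_mod_def by measurable
qed (simp add: scaling_hat_mod_def norm_mult)

lemma E_L2: "F \<in> L2 \<Longrightarrow> E F \<in> L2"
  by (rule dilation_L2[OF det_B(1)])

lemma E_pow_L2: "F \<in> L2 \<Longrightarrow> (E ^^ k) F \<in> L2"
  by (induction k) (simp_all add: E_L2)

lemma E_pow_norm: "F \<in> L2 \<Longrightarrow> L2_norm ((E ^^ k) F) = L2_norm F"
  by (induction k) (simp_all add: dilation_norm[OF det_B(1)] E_pow_L2)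

lemma E_pow_apply:
  fixes F :: "real^2 \<Rightarrow> complex"
  shows "(E ^^ k) F s = sqrt 2 ^ k * F (expand k s)"
proof (induction k arbitrary: s)
  case (Suc k)
  have "(E ^^ Suc k) F s = sqrt 2 * (E ^^ k) F (B *v s)" by (simp add: dilation_def)
  also have "\<dots> = sqrt 2 ^ Suc k * F (expand (Suc k) s)" unfolding Suc expand_Suc' by simp
  finally show ?case .
qed simp

lemma E_scaling_hat_mod: "E (scaling_hat_mod l) s = (\<Sum>a\<in>supp2. h a * scaling_hat_mod (a + A *v l) s)"
proof -
  have "(\<Sum>a\<in>supp2. h a * scaling_hat_mod (a + A *v l) s) = (\<Sum>a\<in>supp. h a * scaling_hat_mod (a + A *v l) s)"
    by (rule sum_supp2_h) (simp add: h_outside_supp)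
  also have "\<dots> = (\<Sum>a\<in>supp. h a * character (- a) s) * (character (- (A *v l)) s * scaling_hat A h s)"
  proof -
    have "character (- (a + b)) s = character (- a) s * character (- b) s" for a b
      by (simp add: character_mult)
    then show ?thesis
      unfolding scaling_hat_mod_def sum_distrib_right by (simp only: mult.assoc)
  qed
  also have "(\<Sum>a\<in>supp. h a * character (- a) s) = sqrt 2 * filter_m0 h s"
    unfolding filter_m0_eq by simp
  also have "\<dots> * (character (- (A *v l)) s * scaling_hat A h s) = E (scaling_hat_mod l) s"
  proof -
    have "A *v (- l) = - (A *v l)" by (simp add: vec_eq_iff matrix_vector_mult_def sum_negf)
    then show ?thesis
      by (simp add: dilation_def scaling_hat_mod_def character_expand scaling_hat_eq scaling_prod_refinement)
  qed
  finally show ?thesis ..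
qed

lemma coeff_refinement:
  assumes "F \<in> L2"
  shows "coeff l F = lowpass_coeff (\<lambda>m. coeff m (E F)) l"
proof -
  have "coeff l F = L2_inner (E F) (E (scaling_hat_mod l))"
    unfolding coeff_def using assms scaling_hat_mod_L2
    by (intro dilation_inner[OF det_B(1), symmetric] L2_measurable)
  also have "E (scaling_hat_mod l) = (\<lambda>s. \<Sum>a\<in>supp2. h a * scaling_hat_mod (a + A *v l) s)"
    using E_scaling_hat_mod by blast
  also have "L2_inner (E F) \<dots> = (\<Sum>a\<in>supp2. cnj (h a) * coeff (a + A *v l) (E F))"
    unfolding coeff_def using assms scaling_hat_mod_L2 by (intro L2_inner_sum_right E_L2)
  finally show ?thesis by (simp add: lowpass_coeff_def)
qed

lemma coeff_Parseval:
  assumes G: "G \<in> L2" and zero: "\<And>s. s \<notin> torus_cell \<Longrightarrow> G s = 0"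
  shows "((\<lambda>l. (cmod (coeff l G))\<^sup>2) has_sum (L2_norm (\<lambda>s. G s * scaling_prod s))\<^sup>2) UNIV"
proof -
  obtain K where K: "K \<ge> 0" "\<And>x. cmod (scaling_prod x) \<le> exp (K * norm x)"
    using scaling_prod_bound by blast
  obtain R where R: "\<And>x. x \<in> torus_cell \<Longrightarrow> norm x \<le> R"
    using bounded_torus_cell unfolding bounded_iff by blast
  have [measurable]: "G \<in> borel_measurable borel" by (rule L2_measurable[OF G])
  define H where "H s = G s * cnj (scaling_hat A h s)" for s
  have [measurable]: "scaling_hat A h \<in> borel_measurable borel" by (rule L2_measurable[OF scaling_hat_L2])
  have "H \<in> borel_measurable borel" unfolding H_def by measurable
  moreover have "(\<lambda>s. complex_of_real (exp (K * R)) * G s) \<in> L2" using G by (rule L2_cmult)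
  moreover have "cmod (H s) \<le> cmod (exp (K * R) * G s)" for s
  proof (cases "s \<in> torus_cell")
    case True
    have "cmod (scaling_hat A h s) \<le> 1 * exp (K * norm s)"
    proof -
      have "cmod (complex_of_real (1 / (2 * pi))) \<le> 1"
        unfolding norm_of_real using pi_gt3 by (simp add: field_simps)
      then show ?thesis
        unfolding scaling_hat_eq norm_mult by (intro mult_mono K) auto
    qed
    also have "\<dots> \<le> exp (K * R)"
      using R[OF True] K by (simp add: mult_left_mono)
    finally show ?thesis
      by (simp add: H_def norm_mult mult.commute mult_left_mono)
  qed (simp add: H_def zero)
  ultimately have "H \<in> L2" by (rule L2_dominated)
  then have "((\<lambda>n. (cmod (\<integral>x. H x * character n x \<partial>lborel))\<^sup>2) has_sum (2 * pi * L2_norm H)\<^sup>2) UNIV"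
    by (rule torus_Parseval) (simp add: H_def zero)
  moreover have "(\<integral>x. H x * character n x \<partial>lborel) = coeff n G" for n
    unfolding coeff_def L2_inner_def
    by (intro Bochner_Integration.integral_cong refl) (simp add: H_def scaling_hat_mod_def cnj_character)
  moreover have "2 * pi * L2_norm H = L2_norm (\<lambda>s. G s * scaling_prod s)"
  proof -
    have "2 * pi * L2_norm H = L2_norm (\<lambda>s. (2 * pi) * H s)"
      using L2_norm_cmult[of "2 * pi" H] by (simp add: norm_mult)
    also have "\<dots> = L2_norm (\<lambda>s. G s * scaling_prod s)"
    proof -
      have "cmod (2 * pi * H s) = cmod (G s * scaling_prod s)" for s
        by (simp add: H_def scaling_hat_eq norm_mult norm_divide)
      then show ?thesis unfolding L2_norm_def by (simp only:)
    qed
    finally show ?thesis .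
  qed
  ultimately show ?thesis by simp
qed

lemma E_pow_bounded_support:
  assumes "\<And>s. s \<notin> cball 0 R \<Longrightarrow> F s = (0 :: complex)" "C > 0"
    and C: "\<forall>j x. norm (contract j x) \<le> C * (1 / sqrt 2) ^ j * norm x"
    and nz: "(E ^^ k) F s \<noteq> 0"
  shows "norm s \<le> C * (1 / sqrt 2) ^ k * R"
proof -
  have "F (expand k s) \<noteq> 0" using nz unfolding E_pow_apply by simp
  then have "expand k s \<in> cball 0 R" using assms(1) by blast
  then have "norm (expand k s) \<le> R" by simp
  have "norm s = norm (contract k (expand k s))" by (simp add: contract_expand)
  also have "\<dots> \<le> C * (1 / sqrt 2) ^ k * norm (expand k s)" using C by simp
  also have "\<dots> \<le> C * (1 / sqrt 2) ^ k * R"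
    using \<open>norm (expand k s) \<le> R\<close> \<open>C > 0\<close> by (intro mult_left_mono) auto
  finally show ?thesis .
qed

lemma E_L2_bounded:
  assumes "F \<in> L2_bounded"
  shows "E F \<in> L2_bounded"
proof -
  obtain R where R: "\<And>s. s \<notin> cball 0 R \<Longrightarrow> F s = 0" and F: "F \<in> L2"
    using assms by (auto simp: L2_bounded_def)
  obtain C where C: "C > 0" "\<forall>j x. norm (contract j x) \<le> C * (1 / sqrt 2) ^ j * norm x"
    using contract_bound by blast
  have "E F s = 0" if "s \<notin> cball 0 (C * (1 / sqrt 2) ^ 1 * R)" for s
    using E_pow_bounded_support[where F=F and R=R and C=C and k=1 and s=s, OF R C] that by auto
  then show ?thesis
    unfolding L2_bounded_def using E_L2[OF F] by blast
qed

lemma E_pow_L2_bounded: "F \<in> L2_bounded \<Longrightarrow> (E ^^ k) F \<in> L2_bounded"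
  by (induction k) (simp_all add: E_L2_bounded)

lemma scaling_prod_contract_bound:
  "\<exists>M\<ge>0. \<forall>k s. norm s \<le> R \<longrightarrow> cmod (scaling_prod (contract k s)) \<le> M"
proof -
  obtain C where C: "C > 0" "\<forall>j x. norm (contract j x) \<le> C * (1 / sqrt 2) ^ j * norm x"
    using contract_bound by blast
  obtain K where K: "K \<ge> 0" "\<forall>x. cmod (scaling_prod x) \<le> exp (K * norm x)"
    using scaling_prod_bound by blast
  have "cmod (scaling_prod (contract k s)) \<le> exp (K * (C * 1 * R))" if "norm s \<le> R" for k s
  proof -
    have "norm (contract k s) \<le> C * (1 / sqrt 2) ^ k * norm s" using C(2) by simp
    also have "\<dots> \<le> C * 1 * R"
      using C(1) that by (intro mult_mono mult_left_mono power_le_one) (auto simp: divide_le_eq_1)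
    finally have "K * norm (contract k s) \<le> K * (C * 1 * R)" using K(1) by (intro mult_left_mono)
    then show ?thesis using K(2) by (meson exp_le_cancel_iff order_trans)
  qed
  then show ?thesis by (intro exI[of _ "exp (K * (C * 1 * R))"]) simp
qed

lemma L2_mult_scaling_prod:
  assumes F: "F \<in> L2_bounded"
  shows "(\<lambda>s. F s * scaling_prod (contract k s)) \<in> L2"
    and "(\<lambda>k. L2_norm (\<lambda>s. F s * scaling_prod (contract k s))) \<longlonglongrightarrow> L2_norm F"
proof -
  obtain R where R: "\<And>s. s \<notin> cball 0 R \<Longrightarrow> F s = 0" and FL: "F \<in> L2"
    using F by (auto simp: L2_bounded_def)
  have [measurable]: "F \<in> borel_measurable borel" by (rule L2_measurable[OF FL])
  obtain M where M: "M \<ge> 0" "\<forall>k s. norm s \<le> R \<longrightarrow> cmod (scaling_prod (contract k s)) \<le> M"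
    using scaling_prod_contract_bound by blast
  have meas: "(\<lambda>s. F s * scaling_prod (contract k s)) \<in> borel_measurable borel" for k by measurable
  have w: "(\<lambda>s. complex_of_real M * F s) \<in> L2" using FL by (rule L2_cmult)
  have le: "cmod (F s * scaling_prod (contract k s)) \<le> cmod (M * F s)" for k s
  proof (cases "norm s \<le> R")
    case True
    then show ?thesis using M by (simp add: norm_mult mult.commute[of "cmod (F s)"] mult_right_mono)
  qed (simp add: R)
  show L: "(\<lambda>s. F s * scaling_prod (contract k s)) \<in> L2" for k
    by (rule L2_dominated[OF meas w le])
  have "(\<lambda>k. F s * scaling_prod (contract k s)) \<longlonglongrightarrow> F s" for s
    using tendsto_mult_left[OF scaling_prod_contract_tendsto, of "F s" s] by simp
  from L2_dominated_convergence[OF meas _ w le this]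
  have "(\<lambda>k. L2_norm (\<lambda>s. F s * scaling_prod (contract k s) - F s)) \<longlonglongrightarrow> 0" by simp
  then show "(\<lambda>k. L2_norm (\<lambda>s. F s * scaling_prod (contract k s))) \<longlonglongrightarrow> L2_norm F"
    by (rule L2_norm_tendsto[OF L FL])
qed

lemma coeff_eventually_has_sum:
  assumes "F \<in> L2_bounded"
  shows "\<forall>\<^sub>F k in sequentially.
    ((\<lambda>l. (cmod (coeff l ((E ^^ k) F)))\<^sup>2) has_sum (L2_norm (\<lambda>s. F s * scaling_prod (contract k s)))\<^sup>2) UNIV"
proof -
  obtain R where R: "\<And>s. s \<notin> cball 0 R \<Longrightarrow> F s = 0" and F: "F \<in> L2"
    using assms by (auto simp: L2_bounded_def)
  have [measurable]: "F \<in> borel_measurable borel" by (rule L2_measurable[OF F])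
  obtain C where C: "C > 0" "\<forall>j x. norm (contract j x) \<le> C * (1 / sqrt 2) ^ j * norm x"
    using contract_bound by blast
  have "(\<lambda>k. (1 / sqrt 2) ^ k) \<longlonglongrightarrow> (0::real)"
    by (rule LIMSEQ_power_zero) (simp add: real_less_lsqrt)
  from tendsto_mult_left_zero[OF tendsto_mult_right_zero[OF this, of C], of R]
  have "\<forall>\<^sub>F k in sequentially. C * (1 / sqrt 2) ^ k * R < 1"
    by (rule order_tendstoD(2)) simp
  then show ?thesis
  proof eventually_elim
    case (elim k)
    have zero: "(E ^^ k) F s = 0" if "s \<notin> torus_cell" for s
    proof (rule ccontr)
      assume "(E ^^ k) F s \<noteq> 0"
      then have "norm s < 1"
        using E_pow_bounded_support[where F=F and R=R and C=C and k=k and s=s, OF R C] elim by simp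
      then have "\<bar>s $ i\<bar> < pi" for i
        using component_le_norm_cart[of s i] pi_gt3 by linarith
      then have "- pi < s $ i \<and> s $ i < pi" for i by (metis abs_less_iff minus_less_iff)
      with that show False by (simp add: mem_torus_cell)
    qed
    have "L2_norm (\<lambda>s. (E ^^ k) F s * scaling_prod s) = L2_norm ((E ^^ k) (\<lambda>s. F s * scaling_prod (contract k s)))"
    proof -
      have "(E ^^ k) F s * scaling_prod s = (E ^^ k) (\<lambda>s. F s * scaling_prod (contract k s)) s" for s
        unfolding E_pow_apply by (simp add: contract_expand)
      then show ?thesis by simp
    qed
    also have "\<dots> = L2_norm (\<lambda>s. F s * scaling_prod (contract k s))"
      by (rule E_pow_norm[OF L2_mult_scaling_prod(1)[OF assms]])
    finally show ?case
      using coeff_Parseval[OF E_pow_L2[OF F] zero] by simp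
  qed
qed

definition energy :: "(real^2 \<Rightarrow> complex) \<Rightarrow> real" where
  "energy F = (\<Sum>\<^sub>\<infinity>l. (cmod (coeff l F))\<^sup>2)"

lemma
  assumes F: "F \<in> L2" and summ: "(\<lambda>l. (cmod (coeff l (E F)))\<^sup>2) summable_on UNIV"
  shows coeff_summable_step: "(\<lambda>l. (cmod (coeff l F))\<^sup>2) summable_on UNIV"
    and energy_mono: "energy F \<le> energy (E F)"
    and highpass_has_sum: "((\<lambda>l. (cmod (highpass_coeff (\<lambda>m. coeff m (E F)) l))\<^sup>2) has_sum (energy (E F) - energy F)) UNIV"
proof -
  let ?c = "\<lambda>m. coeff m (E F)"
  have "((\<lambda>l. (cmod (coeff l F))\<^sup>2 + (cmod (highpass_coeff ?c l))\<^sup>2) has_sum energy (E F)) UNIV"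
    unfolding coeff_refinement[OF F] energy_def
    by (rule filter_bank_has_sum[OF has_sum_infsum[OF summ]])
  then have S: "(\<lambda>l. (cmod (coeff l F))\<^sup>2 + (cmod (highpass_coeff ?c l))\<^sup>2) summable_on UNIV"
    and T: "(\<Sum>\<^sub>\<infinity>l. (cmod (coeff l F))\<^sup>2 + (cmod (highpass_coeff ?c l))\<^sup>2) = energy (E F)"
    by (auto simp: has_sum_iff)
  have low: "(\<lambda>l. (cmod (coeff l F))\<^sup>2) summable_on UNIV"
    using Infinite_Sum.abs_summable_on_comparison_test'[OF S, of "\<lambda>l. (cmod (coeff l F))\<^sup>2"] by simp
  have high: "(\<lambda>l. (cmod (highpass_coeff ?c l))\<^sup>2) summable_on UNIV"
    using Infinite_Sum.abs_summable_on_comparison_test'[OF S, of "\<lambda>l. (cmod (highpass_coeff ?c l))\<^sup>2"] by simp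
  have eq: "energy (E F) = energy F + (\<Sum>\<^sub>\<infinity>l. (cmod (highpass_coeff ?c l))\<^sup>2)"
    using T infsum_add[OF low high] unfolding energy_def by (rule trans[OF sym])
  show "(\<lambda>l. (cmod (coeff l F))\<^sup>2) summable_on UNIV" by (rule low)
  have "0 \<le> (\<Sum>\<^sub>\<infinity>l. (cmod (highpass_coeff ?c l))\<^sup>2)" by (rule infsum_nonneg) simp
  with eq show "energy F \<le> energy (E F)" by simp
  show "((\<lambda>l. (cmod (highpass_coeff ?c l))\<^sup>2) has_sum (energy (E F) - energy F)) UNIV"
    using has_sum_infsum[OF high] eq by simp
qed

lemma E_pow_Suc: "(E ^^ Suc k) F = (E ^^ k) (E F)"
  by (simp add: funpow_swap1)

lemma
  assumes F: "F \<in> L2_bounded"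
  shows coeff_summable_bounded: "(\<lambda>l. (cmod (coeff l F))\<^sup>2) summable_on UNIV"
    and energy_le_bounded: "energy F \<le> (L2_norm F)\<^sup>2"
    and energy_tendsto_bounded: "(\<lambda>k. energy ((E ^^ k) F)) \<longlonglongrightarrow> (L2_norm F)\<^sup>2"
proof -
  have descend: "(\<lambda>l. (cmod (coeff l F))\<^sup>2) summable_on UNIV"
    if "(\<lambda>l. (cmod (coeff l ((E ^^ k) F)))\<^sup>2) summable_on UNIV" "F \<in> L2" for k F
    using that
  proof (induction k arbitrary: F)
    case (Suc k)
    have "(\<lambda>l. (cmod (coeff l (E F)))\<^sup>2) summable_on UNIV"
      using Suc.prems(1) unfolding E_pow_Suc by (rule Suc.IH[OF _ E_L2[OF Suc.prems(2)]])
    with Suc.prems(2) show ?case by (rule coeff_summable_step)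
  qed simp
  have summ: "(\<lambda>l. (cmod (coeff l F))\<^sup>2) summable_on UNIV" if F: "F \<in> L2_bounded" for F
  proof -
    obtain k where "((\<lambda>l. (cmod (coeff l ((E ^^ k) F)))\<^sup>2) has_sum (L2_norm (\<lambda>s. F s * scaling_prod (contract k s)))\<^sup>2) UNIV"
      using coeff_eventually_has_sum[OF F] eventually_happens'[OF sequentially_bot] by blast
    then show ?thesis
      by (intro descend[where F=F and k=k] has_sum_imp_summable L2_bounded_imp_L2[OF F])
  qed
  show "(\<lambda>l. (cmod (coeff l F))\<^sup>2) summable_on UNIV" by (rule summ[OF F])
  have "\<forall>\<^sub>F k in sequentially. (L2_norm (\<lambda>s. F s * scaling_prod (contract k s)))\<^sup>2 = energy ((E ^^ k) F)"
    using coeff_eventually_has_sum[OF F] by eventually_elim (simp add: energy_def infsumI)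
  with tendsto_power[OF L2_mult_scaling_prod(2)[OF F], of 2]
  show lim: "(\<lambda>k. energy ((E ^^ k) F)) \<longlonglongrightarrow> (L2_norm F)\<^sup>2"
    by (rule Lim_transform_eventually)
  have "incseq (\<lambda>k. energy ((E ^^ k) F))"
  proof (rule incseq_SucI)
    fix k
    show "energy ((E ^^ k) F) \<le> energy ((E ^^ Suc k) F)"
      using energy_mono[OF L2_bounded_imp_L2[OF E_pow_L2_bounded[OF F]] summ[OF E_L2_bounded[OF E_pow_L2_bounded[OF F]]], of k]
      by simp
  qed
  from incseq_le[OF this lim, of 0] show "energy F \<le> (L2_norm F)\<^sup>2" by simp
qed

lemma
  assumes F: "F \<in> L2"
  shows coeff_summable: "(\<lambda>l. (cmod (coeff l F))\<^sup>2) summable_on UNIV"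
    and energy_tendsto: "(\<lambda>k. energy ((E ^^ k) F)) \<longlonglongrightarrow> (L2_norm F)\<^sup>2"
proof -
  let ?c = "\<lambda>k l F. coeff l ((E ^^ k) F)"
  have lin: "?c k l (\<lambda>t. F t - G t) = ?c k l F - ?c k l G" if "F \<in> L2" "G \<in> L2" for k l F G
  proof -
    have "(E ^^ k) (\<lambda>t. F t - G t) = (\<lambda>s. (E ^^ k) F s - (E ^^ k) G s)"
      by (simp add: fun_eq_iff E_pow_apply right_diff_distrib)
    then show ?thesis
      unfolding coeff_def using that by (simp add: L2_inner_diff_left E_pow_L2 scaling_hat_mod_L2)
  qed
  have cont: "cmod (?c k l F) \<le> L2_norm (scaling_hat_mod l) * L2_norm F" if "F \<in> L2" for k l F
    using L2_Cauchy_Schwarz[OF E_pow_L2[OF that] scaling_hat_mod_L2, of k l]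
    by (simp add: coeff_def E_pow_norm[OF that] mult.commute)
  have summ: "(\<lambda>l. (cmod (?c k l F))\<^sup>2) summable_on UNIV" if "F \<in> L2_bounded" for k F
    by (rule coeff_summable_bounded[OF E_pow_L2_bounded[OF that]])
  have bound: "(\<Sum>\<^sub>\<infinity>l. (cmod (?c k l F))\<^sup>2) \<le> (L2_norm F)\<^sup>2" if "F \<in> L2_bounded" for k F
    using energy_le_bounded[OF E_pow_L2_bounded[OF that], of k] E_pow_norm[OF L2_bounded_imp_L2[OF that], of k]
    by (simp add: energy_def)
  have "(\<lambda>l. (cmod (?c 0 l F))\<^sup>2) summable_on UNIV"
    by (rule L2_Bessel_dense_summable[where c="?c" and M="\<lambda>k l. L2_norm (scaling_hat_mod l)", OF lin cont summ bound F])
  then show "(\<lambda>l. (cmod (coeff l F))\<^sup>2) summable_on UNIV" by simp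
  show "(\<lambda>k. energy ((E ^^ k) F)) \<longlonglongrightarrow> (L2_norm F)\<^sup>2"
    unfolding energy_def
    by (rule L2_Bessel_dense_tendsto[where c="?c" and M="\<lambda>k l. L2_norm (scaling_hat_mod l)", OF lin cont summ bound F], assumption+)
      (rule energy_tendsto_bounded[unfolded energy_def])
qed

end

section \<open>The wavelet system\<close>

lemma has_sum_exhaust:
  fixes q :: "'i \<Rightarrow> real"
  assumes nonneg: "\<And>i. 0 \<le> q i" and sums: "\<And>N :: nat. (q has_sum s N) (S N)"
    and inc: "incseq S" and cover: "(\<Union>N. S N) = UNIV" and lim: "s \<longlonglongrightarrow> L"
  shows "(q has_sum L) UNIV"
proof -
  have inc_s: "incseq s"
  proof (rule incseq_SucI)
    fix N show "s N \<le> s (Suc N)"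
      using incseqD[OF inc, of N "Suc N"] by (intro has_sum_mono2[OF sums sums]) (auto simp: nonneg)
  qed
  have fin: "sum q F \<le> L" if F: "finite F" for F
  proof -
    have "\<exists>N. F \<subseteq> S N"
      using F
    proof (induction F rule: finite_induct)
      case (insert x F)
      then obtain N where N: "F \<subseteq> S N" by blast
      have "x \<in> (\<Union>N. S N)" using cover by simp
      then obtain M where M: "x \<in> S M" by blast
      have "S N \<subseteq> S (max N M)" "S M \<subseteq> S (max N M)"
        by (rule incseqD[OF inc], simp)+
      with N M show ?case by (intro exI[of _ "max N M"]) blast
    qed simp
    then obtain N where "F \<subseteq> S N" ..
    then have "sum q F \<le> s N"
      using F by (intro finite_sum_le_has_sum[OF sums]) (auto simp: nonneg)
    also have "\<dots> \<le> L" by (rule incseq_le[OF inc_s lim])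
    finally show ?thesis .
  qed
  have summ: "q summable_on UNIV"
    using fin by (intro nonneg_bdd_above_summable_on bdd_aboveI[of _ L]) (auto simp: nonneg)
  have "infsum q UNIV \<le> L"
    using fin by (intro infsum_le_finite_sums summ) auto
  moreover have "s N \<le> infsum q UNIV" for N
    by (rule has_sum_mono2[OF sums has_sum_infsum[OF summ]]) (auto simp: nonneg)
  then have "L \<le> infsum q UNIV"
    by (intro LIMSEQ_le_const2[OF lim]) auto
  ultimately show ?thesis using has_sum_infsum[OF summ] by simp
qed

context lawton_filter
begin

abbreviation D :: "(real^2 \<Rightarrow> complex) \<Rightarrow> real^2 \<Rightarrow> complex" where "D \<equiv> dilation A"

definition D_inv :: "(real^2 \<Rightarrow> complex) \<Rightarrow> real^2 \<Rightarrow> complex" where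
  "D_inv f t = complex_of_real (1 / sqrt 2) * f (matrix_inv (rmat A) *v t)"

lemma D_D_inv [simp]: "D (D_inv f) = f"
  by (simp add: fun_eq_iff dilation_def D_inv_def matrix_mult_matrix_inv[OF det_A(2)])

lemma D_inv_D: "D_inv (D f) = f"
  by (simp add: fun_eq_iff dilation_def D_inv_def matrix_mult_matrix_inv[OF det_A(2)])

lemma inv_D: "inv D = D_inv"
  by (rule inv_equality) (simp_all add: D_inv_D)

lemma borel_measurable_D_inv [measurable]:
  assumes [measurable]: "f \<in> borel_measurable borel"
  shows "D_inv f \<in> borel_measurable borel"
  unfolding D_inv_def[abs_def] by measurable

lemma D_inv_L2:
  assumes "f \<in> L2"
  shows "D_inv f \<in> L2"
proof (rule L2I)
  have [measurable]: "f \<in> borel_measurable borel" by (rule L2_measurable[OF assms])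
  show "D_inv f \<in> borel_measurable borel" by measurable
  have "integrable lborel (\<lambda>t. (cmod (D_inv f (rmat A *v t)))\<^sup>2)"
    using L2_integrable[OF assms]
    by (simp add: D_inv_def matrix_mult_matrix_inv[OF det_A(2)] norm_mult power_mult_distrib norm_divide power_divide)
  then show "integrable lborel (\<lambda>t. (cmod (D_inv f t))\<^sup>2)"
    using integrable_matrix[OF det_A(2), of "\<lambda>t. (cmod (D_inv f t))\<^sup>2"] by simp
qed

lemma D_inv_integrable:
  assumes "integrable lborel f"
  shows "integrable lborel (D_inv f)"
proof -
  have [measurable]: "f \<in> borel_measurable borel" using assms by auto
  have "integrable lborel (\<lambda>t. D_inv f (rmat A *v t))"
    using assms by (simp add: D_inv_def matrix_mult_matrix_inv[OF det_A(2)])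
  then show ?thesis using integrable_matrix[OF det_A(2), of "D_inv f"] by simp
qed

lemma D_pow_L2: "f \<in> L2 \<Longrightarrow> (D ^^ k) f \<in> L2"
  by (induction k) (simp_all add: dilation_L2[OF det_A(1)])

lemma D_inv_pow_L2: "f \<in> L2 \<Longrightarrow> (D_inv ^^ k) f \<in> L2"
  by (induction k) (simp_all add: D_inv_L2)

lemma D_inv_pow_integrable: "integrable lborel f \<Longrightarrow> integrable lborel ((D_inv ^^ k) f)"
  by (induction k) (simp_all add: D_inv_integrable)

lemma D_pow_inner: "f \<in> L2 \<Longrightarrow> g \<in> L2 \<Longrightarrow> L2_inner ((D ^^ k) f) ((D ^^ k) g) = L2_inner f g"
  by (induction k) (simp_all add: dilation_inner[OF det_A(1)] L2_measurable D_pow_L2)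

lemma D_pow_norm: "f \<in> L2 \<Longrightarrow> L2_norm ((D ^^ k) f) = L2_norm f"
  by (induction k) (simp_all add: dilation_norm[OF det_A(1)] D_pow_L2)

lemma D_pow_D_inv_pow: "(D ^^ k) ((D_inv ^^ k) f) = f"
proof (induction k arbitrary: f)
  case (Suc k)
  have "(D ^^ Suc k) ((D_inv ^^ Suc k) f) = D ((D ^^ k) ((D_inv ^^ k) (D_inv f)))"
    by (simp add: funpow_swap1[of D_inv])
  then show ?case unfolding Suc by simp
qed simp

lemma dilation_power_L2: "f \<in> L2 \<Longrightarrow> dilation_power A n f \<in> L2"
  unfolding dilation_power_def inv_D by (simp add: D_pow_L2 D_inv_pow_L2)

lemma dilation_power_shift: "(D ^^ N) (dilation_power A (int m - int N) f) = (D ^^ m) f"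
proof (cases "N \<le> m")
  case True
  then have "D ^^ m = D ^^ N \<circ> D ^^ (m - N)"
    using funpow_add[of N "m - N" D] by simp
  then have "(D ^^ m) f = (D ^^ N) ((D ^^ (m - N)) f)" by simp
  with True show ?thesis by (simp add: dilation_power_def nat_diff_distrib)
next
  case False
  then have "dilation_power A (int m - int N) f = (D_inv ^^ (N - m)) f"
    by (simp add: dilation_power_def inv_D nat_diff_distrib)
  moreover have "D ^^ N = D ^^ m \<circ> D ^^ (N - m)"
    using funpow_add[of m "N - m" D] False by simp
  then have "(D ^^ N) g = (D ^^ m) ((D ^^ (N - m)) g)" for g by simp
  ultimately show ?thesis by (simp add: D_pow_D_inv_pow)
qed

abbreviation \<psi> :: "real^2 \<Rightarrow> complex" where "\<psi> \<equiv> wavelet A h"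

lemma wavelet_eq: "\<psi> t = (\<Sum>n\<in>supp2. highpass n * D (translation n \<phi>) t)"
proof -
  have "\<psi> t = (\<Sum>\<^sub>\<infinity>n. highpass n * D (translation n \<phi>) t)"
    by (simp add: wavelet_def highpass_def)
  also have "\<dots> = (\<Sum>\<^sub>\<infinity>n\<in>supp2. highpass n * D (translation n \<phi>) t)"
    by (rule infsum_cong_neutral) (auto simp: highpass_outside_supp2)
  finally show ?thesis using finite_supp2 by simp
qed

lemma wavelet_L2: "\<psi> \<in> L2"
  unfolding wavelet_eq[abs_def]
  by (intro L2_sum L2_cmult dilation_L2[OF det_A(1)] translation_L2 scaling_function_L2)

lemma inner_translated_scaling:
  assumes "u \<in> L2" "integrable lborel u"
  shows "L2_inner u (translation l \<phi>) = coeff l (fourier_integral u)"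
proof -
  have um [measurable]: "u \<in> borel_measurable borel" by (rule L2_measurable[OF assms(1)])
  have "L2_inner u (translation l \<phi>) = L2_inner (translation l (translation (- l) u)) (translation l \<phi>)"
    unfolding translation_translation by (simp add: translation_def[abs_def])
  also have "\<dots> = L2_inner (translation (- l) u) \<phi>"
    using L2_measurable[OF scaling_function_L2] by (intro translation_inner) measurable
  also have "\<dots> = L2_inner (fourier_integral (translation (- l) u)) (scaling_hat A h)"
    by (rule has_L2_fourier_inner[OF scaling_function_fourier translation_L2[OF assms(1)] translation_integrable[OF assms(2)]])
  also have "\<dots> = coeff l (fourier_integral u)"
    unfolding coeff_def L2_inner_def
    by (intro Bochner_Integration.integral_cong refl)
      (simp add: fourier_translation scaling_hat_mod_def cnj_character)
  finally show ?thesis .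
qed

lemma inner_translated_wavelet:
  assumes v: "v \<in> L2" "integrable lborel v"
  shows "L2_inner v (translation l \<psi>) = highpass_coeff (\<lambda>m. coeff m (E (fourier_integral v))) l"
proof -
  have "translation l \<psi> = (\<lambda>t. \<Sum>n\<in>supp2. highpass n * D (translation (n + A *v l) \<phi>) t)"
  proof
    fix t
    have "D (translation n \<phi>) (t - rvec l) = D (translation (n + A *v l) \<phi>) t" for n
      using translation_dilation[of l A "translation n \<phi>"]
      by (simp add: translation_translation translation_def fun_eq_iff add.commute)
    then show "translation l \<psi> t = (\<Sum>n\<in>supp2. highpass n * D (translation (n + A *v l) \<phi>) t)"
      by (simp add: translation_def[of l] wavelet_eq)
  qed
  then have expansion: "L2_inner v (translation l \<psi>)
      = (\<Sum>n\<in>supp2. cnj (highpass n) * L2_inner v (D (translation (n + A *v l) \<phi>)))"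
    using v by (simp add: L2_inner_sum_right dilation_L2[OF det_A(1)] translation_L2 scaling_function_L2)
  have "L2_inner v (D (translation m \<phi>)) = coeff m (E (fourier_integral v))" for m
  proof -
    have "L2_inner v (D (translation m \<phi>)) = L2_inner (D (D_inv v)) (D (translation m \<phi>))" by simp
    also have "\<dots> = L2_inner (D_inv v) (translation m \<phi>)"
      by (intro dilation_inner[OF det_A(1)] L2_measurable D_inv_L2 v translation_L2 scaling_function_L2)
    also have "\<dots> = coeff m (fourier_integral (D_inv v))"
      by (intro inner_translated_scaling D_inv_L2 D_inv_integrable v)
    also have "fourier_integral (D_inv v) = E (fourier_integral v)"
      using fourier_dilation[OF det_A(1) L2_measurable[OF D_inv_L2[OF v(1)]]] by simp
    finally show ?thesis .
  qed
  then show ?thesis by (simp add: highpass_coeff_def expansion)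
qed

lemma fourier_D_inv_pow:
  assumes "v \<in> L2"
  shows "fourier_integral ((D_inv ^^ k) v) = (E ^^ k) (fourier_integral v)"
proof (induction k)
  case (Suc k)
  have "fourier_integral (D_inv w) = E (fourier_integral w)" if "w \<in> L2" for w
    using fourier_dilation[OF det_A(1) L2_measurable[OF D_inv_L2[OF that]]] by simp
  with Suc D_inv_pow_L2[OF assms] show ?case by simp
qed simp

lemma nonneg_scales_has_sum:
  assumes f: "f \<in> L2" "integrable lborel f"
  shows "((\<lambda>(n, l). (cmod (L2_inner f ((D ^^ n) (translation l \<psi>))))\<^sup>2) has_sum
    ((L2_norm f)\<^sup>2 - energy (fourier_integral f))) (UNIV :: (nat \<times> (int^2)) set)"
proof -
  let ?F = "fourier_integral f"
  let ?W = "\<lambda>n. energy ((E ^^ Suc n) ?F) - energy ((E ^^ n) ?F)"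
  have F: "?F \<in> L2" by (rule fourier_L2[OF f])
  have layer: "((\<lambda>l. (cmod (L2_inner f ((D ^^ n) (translation l \<psi>))))\<^sup>2) has_sum ?W n) UNIV" for n
  proof -
    let ?v = "(D_inv ^^ n) f"
    have v: "?v \<in> L2" "integrable lborel ?v"
      by (rule D_inv_pow_L2[OF f(1)], rule D_inv_pow_integrable[OF f(2)])
    have "L2_inner f ((D ^^ n) (translation l \<psi>)) = L2_inner ?v (translation l \<psi>)" for l
      using D_pow_inner[OF v(1) translation_L2[OF wavelet_L2], of n l] by (simp add: D_pow_D_inv_pow)
    moreover have "((\<lambda>l. (cmod (L2_inner ?v (translation l \<psi>)))\<^sup>2) has_sum ?W n) UNIV"
      unfolding inner_translated_wavelet[OF v] fourier_D_inv_pow[OF f(1)]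
      using highpass_has_sum[OF E_pow_L2[OF F] coeff_summable[OF E_L2[OF E_pow_L2[OF F]]], of n] by simp
    ultimately show ?thesis by simp
  qed
  have "?W sums ((L2_norm ?F)\<^sup>2 - energy ((E ^^ 0) ?F))"
    by (rule telescope_sums[OF energy_tendsto[OF F]])
  then have "?W sums ((L2_norm f)\<^sup>2 - energy ?F)"
    by (simp add: Plancherel[OF f])
  moreover have "0 \<le> ?W n" for n
    using has_sum_nonneg[OF layer[of n]] by simp
  ultimately have W: "(?W has_sum ((L2_norm f)\<^sup>2 - energy ?F)) UNIV"
    by (rule sums_nonneg_imp_has_sum)
  have "(\<lambda>(n, l). (cmod (L2_inner f ((D ^^ n) (translation l \<psi>))))\<^sup>2) summable_on (SIGMA n:UNIV. UNIV)"
    by (rule summable_on_SigmaI[OF _ has_sum_imp_summable[OF W]]) (use layer in auto)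
  from has_sum_SigmaI[OF _ W this] layer show ?thesis by simp
qed

end

lemma nn_integral_periodize':
  fixes u :: "real^2 \<Rightarrow> ennreal"
  assumes [measurable]: "u \<in> borel_measurable borel"
  shows "(\<integral>\<^sup>+l. (\<integral>\<^sup>+t. u (t + rvec l) * indicator unit_cell t \<partial>lborel) \<partial>count_space UNIV) = (\<integral>\<^sup>+t. u t \<partial>lborel)"
proof -
  have "(\<integral>\<^sup>+l. (\<integral>\<^sup>+t. u (t + rvec l) * indicator unit_cell t \<partial>lborel) \<partial>count_space UNIV)
      = (\<integral>\<^sup>+t. (\<integral>\<^sup>+l. u (t + rvec l) * indicator unit_cell t \<partial>count_space UNIV) \<partial>lborel)"
    by (rule nn_integral_count_space_nn_integral[symmetric]) auto
  also have "\<dots> = (\<integral>\<^sup>+t. u t \<partial>lborel)"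
    unfolding nn_integral_periodize[OF assms] by (simp add: nn_integral_multc)
  finally show ?thesis .
qed

lemma cball_subset_unit_cell: "r < 1/2 \<Longrightarrow> cball 0 r \<subseteq> unit_cell"
proof
  fix t :: "real^2" assume "r < 1/2" "t \<in> cball 0 r"
  then have "norm t < 1/2" by simp
  then have "- (1/2) \<le> t $ i \<and> t $ i < 1/2" for i using component_le_norm_cart[of t i] by linarith
  then show "t \<in> unit_cell" by (simp add: unit_cell_def)
qed

lemma nn_integral_shrinking_tendsto:
  fixes v :: "real^2 \<Rightarrow> ennreal"
  assumes [measurable]: "v \<in> borel_measurable borel" and fin: "(\<integral>\<^sup>+t. v t \<partial>lborel) < \<infinity>"
    and S [measurable]: "\<And>N. S N \<in> sets borel" and sub: "\<And>N. S N \<subseteq> cball 0 (\<rho> N)" and \<rho>: "\<rho> \<longlonglongrightarrow> 0"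
  shows "(\<lambda>N. \<integral>\<^sup>+t. v t * indicator (S N) t \<partial>lborel) \<longlonglongrightarrow> 0"
proof -
  have "(\<lambda>N. \<integral>\<^sup>+t. v t * indicator (S N) t \<partial>lborel) \<longlonglongrightarrow> (\<integral>\<^sup>+t. 0 \<partial>(lborel :: (real^2) measure))"
  proof (rule nn_integral_dominated_convergence[where w=v])
    show "AE t in lborel. (\<lambda>N. v t * indicator (S N) t) \<longlonglongrightarrow> 0"
      using AE_lborel_singleton[of 0]
    proof eventually_elim
      case (elim t)
      then have "\<forall>\<^sub>F N in sequentially. \<rho> N < norm t"
        using order_tendstoD(2)[OF \<rho>, of "norm t"] by simp
      then have "\<forall>\<^sub>F N in sequentially. v t * indicator (S N) t = 0"
      proof eventually_elim
        case (elim N)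
        then have "t \<notin> S N" using sub[of N] by auto
        then show ?case by simp
      qed
      then show ?case by (rule tendsto_eventually)
    qed
  qed (use fin in \<open>auto split: split_indicator\<close>)
  then show ?thesis by simp
qed

context lawton_filter
begin

lemma D_pow_apply:
  fixes f :: "real^2 \<Rightarrow> complex"
  shows "(D ^^ k) f t = sqrt 2 ^ k * f (((*v) (rmat A) ^^ k) t)"
proof (induction k arbitrary: t)
  case (Suc k)
  have "(D ^^ Suc k) f t = sqrt 2 * (D ^^ k) f (rmat A *v t)" by (simp add: dilation_def)
  also have "\<dots> = sqrt 2 ^ Suc k * f (((*v) (rmat A) ^^ Suc k) t)" unfolding Suc by (simp add: funpow_swap1)
  finally show ?case .
qed simp

lemma D_pow_integrable: "integrable lborel f \<Longrightarrow> integrable lborel ((D ^^ k) f)"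
  by (induction k) (simp_all add: dilation_integrable[OF det_A(1)])

text \<open>
  The functions \<open>(D ^^ N) f\<close> live on balls shrinking to the origin, so their inner products with the
  translates of the scaling function only see that function near the integer lattice, a null set.
\<close>

lemma energy_D_pow_tendsto:
  assumes "f \<in> L2_bounded"
  shows "(\<lambda>N. energy (fourier_integral ((D ^^ N) f))) \<longlonglongrightarrow> 0"
proof -
  obtain R where R: "\<And>t. t \<notin> cball 0 R \<Longrightarrow> f t = 0" and f: "f \<in> L2"
    using assms by (auto simp: L2_bounded_def)
  have fi: "integrable lborel f" by (rule L2_bounded_support_integrable[OF f R])
  obtain c where c: "c > 0" "\<forall>j x. c * sqrt 2 ^ j * norm x \<le> norm (((*v) (rmat A) ^^ j) x)"
    using expanding_matrices(1)[OF A] unfolding expanding_def by blast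
  define \<rho> where "\<rho> N = R / c * (1 / sqrt 2) ^ N" for N :: nat
  have "(\<lambda>N. (1 / sqrt 2) ^ N) \<longlonglongrightarrow> (0::real)"
    by (rule LIMSEQ_power_zero) (simp add: real_less_lsqrt)
  from tendsto_mult_right_zero[OF this, of "R / c"] have \<rho>: "\<rho> \<longlonglongrightarrow> 0"
    unfolding \<rho>_def[abs_def] .
  define S where "S N = cball 0 (\<rho> N) \<inter> unit_cell" for N
  have S [measurable]: "S N \<in> sets borel" for N by (simp add: S_def)
  let ?u = "\<lambda>N. (D ^^ N) f"
  have u: "?u N \<in> L2" "integrable lborel (?u N)" for N
    by (rule D_pow_L2[OF f], rule D_pow_integrable[OF fi])
  have supp_u: "t \<in> S N" if nz: "?u N t \<noteq> 0" and N: "\<rho> N < 1/2" for N t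
  proof -
    have "f (((*v) (rmat A) ^^ N) t) \<noteq> 0" using nz unfolding D_pow_apply by simp
    then have "norm (((*v) (rmat A) ^^ N) t) \<le> R" using R by fastforce
    moreover have "c * sqrt 2 ^ N * norm t \<le> norm (((*v) (rmat A) ^^ N) t)" using c(2) by simp
    ultimately have "c * sqrt 2 ^ N * norm t \<le> R" by linarith
    then have "norm t \<le> \<rho> N" using c(1) by (simp add: \<rho>_def field_simps)
    then have "t \<in> cball 0 (\<rho> N)" by simp
    then show ?thesis using cball_subset_unit_cell[OF N] by (auto simp: S_def)
  qed
  have [measurable]: "\<phi> \<in> borel_measurable borel" by (rule L2_measurable[OF scaling_function_L2])
  let ?v = "\<lambda>l t. ennreal ((cmod (\<phi> (t + rvec l)))\<^sup>2)"
  define a where "a N l = (\<integral>\<^sup>+t. ?v l t * indicator (S N) t \<partial>lborel)" for N l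
  have phi: "(\<integral>\<^sup>+t. ennreal ((cmod (\<phi> t))\<^sup>2) \<partial>lborel) < \<infinity>"
    by (simp add: L2_nn_integral[OF scaling_function_L2])
  have vfin: "(\<integral>\<^sup>+t. ?v l t \<partial>lborel) < \<infinity>" for l
    using phi nn_integral_translate[of "\<lambda>t. ennreal ((cmod (\<phi> t))\<^sup>2)" "rvec l"] by simp
  have a_lim: "(\<lambda>N. a N l) \<longlonglongrightarrow> 0" for l
    unfolding a_def by (rule nn_integral_shrinking_tendsto[OF _ vfin S _ \<rho>]) (auto simp: S_def)
  have "(\<lambda>N. \<integral>\<^sup>+l. a N l \<partial>count_space UNIV) \<longlonglongrightarrow> (\<integral>\<^sup>+l. 0 \<partial>count_space (UNIV :: (int^2) set))"
  proof (rule nn_integral_dominated_convergence)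
    show "AE l in count_space UNIV. a N l \<le> (\<integral>\<^sup>+t. ?v l t * indicator unit_cell t \<partial>lborel)" for N
      unfolding a_def by (intro AE_I2 nn_integral_mono) (auto simp: S_def split: split_indicator)
    show "(\<integral>\<^sup>+l. (\<integral>\<^sup>+t. ?v l t * indicator unit_cell t \<partial>lborel) \<partial>count_space UNIV) < \<infinity>"
      using nn_integral_periodize'[of "\<lambda>t. ennreal ((cmod (\<phi> t))\<^sup>2)"] phi by simp
  qed (use a_lim in auto)
  then have sum_lim: "(\<lambda>N. ennreal ((L2_norm f)\<^sup>2) * (\<integral>\<^sup>+l. a N l \<partial>count_space UNIV)) \<longlonglongrightarrow> 0"
    using ennreal_tendsto_cmult[of "ennreal ((L2_norm f)\<^sup>2)" "\<lambda>N. \<integral>\<^sup>+l. a N l \<partial>count_space UNIV" 0] by simp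
  have bound: "ennreal (energy (fourier_integral (?u N))) \<le> ennreal ((L2_norm f)\<^sup>2) * (\<integral>\<^sup>+l. a N l \<partial>count_space UNIV)"
    if N: "\<rho> N < 1/2" for N
  proof -
    have "((\<lambda>l. (cmod (coeff l (fourier_integral (?u N))))\<^sup>2) has_sum energy (fourier_integral (?u N))) UNIV"
      unfolding energy_def by (intro has_sum_infsum coeff_summable fourier_L2 u)
    from has_sum_reindex_bij_betw[of uminus UNIV UNIV, THEN iffD2, OF _ this]
    have hs: "((\<lambda>l. (cmod (L2_inner (?u N) (translation (- l) \<phi>)))\<^sup>2) has_sum energy (fourier_integral (?u N))) UNIV"
      by (simp add: inner_translated_scaling[OF u] bij_uminus)
    have le: "ennreal ((cmod (L2_inner (?u N) (translation (- l) \<phi>)))\<^sup>2) \<le> ennreal ((L2_norm f)\<^sup>2) * a N l" for l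
    proof -
      define w where "w t = translation (- l) \<phi> t * indicator (S N) t" for t
      have w: "w \<in> L2" unfolding w_def[abs_def]
        by (intro L2_indicator translation_L2 scaling_function_L2 S)
      have "L2_inner (?u N) (translation (- l) \<phi>) = L2_inner (?u N) w"
        unfolding L2_inner_def w_def
        by (intro Bochner_Integration.integral_cong refl) (use supp_u[OF _ N] in \<open>auto split: split_indicator\<close>)
      then have "cmod (L2_inner (?u N) (translation (- l) \<phi>)) \<le> L2_norm f * L2_norm w"
        using L2_Cauchy_Schwarz[OF u(1) w, of N] D_pow_norm[OF f, of N] by simp
      then have "(cmod (L2_inner (?u N) (translation (- l) \<phi>)))\<^sup>2 \<le> (L2_norm f)\<^sup>2 * (L2_norm w)\<^sup>2"
        unfolding power_mult_distrib[symmetric] by (intro power_mono) auto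
      then have "ennreal ((cmod (L2_inner (?u N) (translation (- l) \<phi>)))\<^sup>2) \<le> ennreal ((L2_norm f)\<^sup>2) * ennreal ((L2_norm w)\<^sup>2)"
        by (simp add: ennreal_leI flip: ennreal_mult)
      also have "ennreal ((L2_norm w)\<^sup>2) = a N l"
        unfolding L2_nn_integral[OF w, symmetric] a_def
        by (intro nn_integral_cong) (auto simp: w_def translation_def rvec_minus split: split_indicator)
      finally show ?thesis .
    qed
    have "ennreal (energy (fourier_integral (?u N)))
        = (\<integral>\<^sup>+l. ennreal ((cmod (L2_inner (?u N) (translation (- l) \<phi>)))\<^sup>2) \<partial>count_space UNIV)"
      by (rule nn_integral_count_space_has_sum[OF hs, symmetric]) simp
    also have "\<dots> \<le> (\<integral>\<^sup>+l. ennreal ((L2_norm f)\<^sup>2) * a N l \<partial>count_space UNIV)"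
      by (intro nn_integral_mono le)
    also have "\<dots> = ennreal ((L2_norm f)\<^sup>2) * (\<integral>\<^sup>+l. a N l \<partial>count_space UNIV)"
      by (rule nn_integral_cmult) simp
    finally show ?thesis .
  qed
  have "\<forall>\<^sub>F N in sequentially. ennreal (energy (fourier_integral (?u N))) \<le> ennreal ((L2_norm f)\<^sup>2) * (\<integral>\<^sup>+l. a N l \<partial>count_space UNIV)"
    using order_tendstoD(2)[OF \<rho>, of "1/2"] by (simp add: eventually_mono[OF _ bound])
  then have "(\<lambda>N. ennreal (energy (fourier_integral (?u N)))) \<longlonglongrightarrow> ennreal 0"
    using tendsto_sandwich[OF _ _ tendsto_const sum_lim] by simp
  moreover have "0 \<le> energy F" for F
    unfolding energy_def by (rule infsum_nonneg) simp
  ultimately show ?thesis by (subst (asm) tendsto_ennreal_iff) auto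
qed

definition wavelet_system :: "int \<times> (int^2) \<Rightarrow> real^2 \<Rightarrow> complex" where
  "wavelet_system = (\<lambda>(n, l). dilation_power A n (translation l \<psi>))"

lemma wavelet_system_L2: "wavelet_system i \<in> L2"
  unfolding wavelet_system_def by (cases i) (simp add: dilation_power_L2 translation_L2 wavelet_L2)

lemma wavelet_system_bounded_has_sum:
  assumes "f \<in> L2_bounded"
  shows "((\<lambda>i. (cmod (L2_inner f (wavelet_system i)))\<^sup>2) has_sum (L2_norm f)\<^sup>2) UNIV"
proof (rule has_sum_exhaust)
  obtain R where R: "\<And>t. t \<notin> cball 0 R \<Longrightarrow> f t = 0" and f: "f \<in> L2"
    using assms by (auto simp: L2_bounded_def)
  have fi: "integrable lborel f" by (rule L2_bounded_support_integrable[OF f R])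
  let ?S = "\<lambda>N :: nat. {- int N..} \<times> (UNIV :: (int^2) set)"
  let ?s = "\<lambda>N. (L2_norm f)\<^sup>2 - energy (fourier_integral ((D ^^ N) f))"
  show "((\<lambda>i. (cmod (L2_inner f (wavelet_system i)))\<^sup>2) has_sum ?s N) (?S N)" for N
  proof -
    let ?j = "\<lambda>(m :: nat, l). (int m - int N, l)"
    have bij: "bij_betw ?j UNIV (?S N)"
    proof (rule bij_betw_byWitness[where f'="\<lambda>(n, l). (nat (n + int N), l)"])
    qed auto
    have "((\<lambda>(m, l). (cmod (L2_inner ((D ^^ N) f) ((D ^^ m) (translation l \<psi>))))\<^sup>2) has_sum ?s N) UNIV"
      using nonneg_scales_has_sum[OF D_pow_L2[OF f] D_pow_integrable[OF fi], of N] by (simp add: D_pow_norm[OF f])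
    moreover have "(\<lambda>(m, l). (cmod (L2_inner ((D ^^ N) f) ((D ^^ m) (translation l \<psi>))))\<^sup>2)
        = (\<lambda>i. (cmod (L2_inner f (wavelet_system (?j i))))\<^sup>2)"
    proof
      fix i :: "nat \<times> (int^2)"
      obtain m l where i: "i = (m, l)" by (cases i)
      have "L2_inner ((D ^^ N) f) ((D ^^ m) (translation l \<psi>))
          = L2_inner f (dilation_power A (int m - int N) (translation l \<psi>))"
        unfolding dilation_power_shift[symmetric, of m _ N]
        by (rule D_pow_inner[OF f dilation_power_L2[OF translation_L2[OF wavelet_L2]]])
      then show "(case i of (m, l) \<Rightarrow> (cmod (L2_inner ((D ^^ N) f) ((D ^^ m) (translation l \<psi>))))\<^sup>2)
          = (cmod (L2_inner f (wavelet_system (?j i))))\<^sup>2"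
        by (simp add: i wavelet_system_def)
    qed
    ultimately show ?thesis
      using has_sum_reindex_bij_betw[OF bij, of "\<lambda>i. (cmod (L2_inner f (wavelet_system i)))\<^sup>2" "?s N"] by simp
  qed
  show "incseq ?S" by (auto simp: incseq_def)
  show "(\<Union>N. ?S N) = UNIV"
  proof (intro equalityI subsetI UNIV_I)
    fix x :: "int \<times> (int^2)"
    have "x \<in> ?S (nat (- fst x))" by (cases x) simp
    then show "x \<in> (\<Union>N. ?S N)" by (rule UN_I[OF UNIV_I])
  qed
  show "?s \<longlonglongrightarrow> (L2_norm f)\<^sup>2"
    using tendsto_diff[OF tendsto_const energy_D_pow_tendsto[OF assms], of "(L2_norm f)\<^sup>2"] by simp
qed simp

lemma wavelet_system_frame: "normalized_tight_frame UNIV wavelet_system"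
  unfolding normalized_tight_frame_def
proof (intro conjI ballI)
  show "countable (UNIV :: (int \<times> (int^2)) set)" by simp
  show "wavelet_system i \<in> L2" for i by (rule wavelet_system_L2)
  fix f assume f: "f \<in> L2"
  let ?c = "\<lambda>(k :: nat) i f. L2_inner f (wavelet_system i)"
  have lin: "?c k i (\<lambda>t. F t - G t) = ?c k i F - ?c k i G" if "F \<in> L2" "G \<in> L2" for k i F G
    using that by (simp add: L2_inner_diff_left wavelet_system_L2)
  have cont: "cmod (?c k i F) \<le> L2_norm (wavelet_system i) * L2_norm F" if "F \<in> L2" for k i F
    using L2_Cauchy_Schwarz[OF that wavelet_system_L2[of i]] by (simp add: mult.commute)
  have summ: "(\<lambda>i. (cmod (?c k i F))\<^sup>2) summable_on UNIV" if "F \<in> L2_bounded" for k F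
    using wavelet_system_bounded_has_sum[OF that] by (rule has_sum_imp_summable)
  have eq: "(\<Sum>\<^sub>\<infinity>i. (cmod (?c k i F))\<^sup>2) = (L2_norm F)\<^sup>2" if "F \<in> L2_bounded" for k F
    using wavelet_system_bounded_has_sum[OF that] by (rule infsumI)
  have bound: "(\<Sum>\<^sub>\<infinity>i. (cmod (?c k i F))\<^sup>2) \<le> (L2_norm F)\<^sup>2" if "F \<in> L2_bounded" for k F
    by (rule eq_refl[OF eq[OF that]])
  have S: "(\<lambda>i. (cmod (?c 0 i f))\<^sup>2) summable_on UNIV"
    by (rule L2_Bessel_dense_summable[where c="?c" and M="\<lambda>k i. L2_norm (wavelet_system i)", OF lin cont summ bound f])
  have "(\<lambda>k. \<Sum>\<^sub>\<infinity>i. (cmod (?c k i f))\<^sup>2) \<longlonglongrightarrow> (L2_norm f)\<^sup>2"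
    by (rule L2_Bessel_dense_tendsto[where c="?c" and M="\<lambda>k i. L2_norm (wavelet_system i)", OF lin cont summ bound f], assumption+)
      (simp add: eq)
  then have "(\<Sum>\<^sub>\<infinity>i. (cmod (L2_inner f (wavelet_system i)))\<^sup>2) = (L2_norm f)\<^sup>2"
    by (simp add: LIMSEQ_const_iff)
  with has_sum_infsum[OF S]
  show "((\<lambda>i. (cmod (L2_inner f (wavelet_system i)))\<^sup>2) has_sum (L2_norm f)\<^sup>2) UNIV" by simp
qed

end

theorem theorem5p1:
  fixes A :: "int^2^2" and h :: "int^2 \<Rightarrow> complex"
  assumes "A \<in> matrices_type1 \<union> matrices_type2"
    and "finitely_supported h"
    and "lawton A h"
  shows "normalized_tight_frame (UNIV :: (int \<times> (int^2)) set)
           (\<lambda>(n, l). dilation_power A n (translation l (wavelet A h)))"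
proof -
  interpret lawton_filter A h
    using assms by unfold_locales
  show ?thesis
    using wavelet_system_frame unfolding wavelet_system_def .
qed

end
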